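(* Let $\eta\in\mathbb{R}$ and $L\in\mathbb{R}$ with $-1\neq L>-3/2$ if $\eta\ne0$, and $L>-3/2$ if $\eta=0$. For $n\in\mathbb{Z}_+$ and $\rho\neq0$ one has $$R_n^{(L)}(\eta;\rho)=\frac{\sqrt{(L+1)^2+\eta^2}}{L+1}\sqrt{\frac{2L+2n+3}{2L+3}}\,\Big(F_L(\eta,\rho)G_{L+n+1}(\eta,\rho)-F_{L+n+1}(\eta,\rho)G_L(\eta,\rho)\Big).$$
   Context: $\mathbb{Z}_+=\{0,1,2,\dots\}$. Put $$w_n=\frac{\sqrt{(n+1)^2+\eta^2}}{(n+1)\sqrt{(2n+1)(2n+3)}},\qquad \lambda_n=-\frac{\eta}{n(n+1)}$$ for indices $n=L+1,L+2,\dots$ (with $\lambda_n=0$ for all $n$ if $\eta=0$). The polynomials $P_n^{(L)}(\eta;z)$ in $z$ are given by $P_{-1}^{(L)}=0$, $P_0^{(L)}=1$ and $$zP_n^{(L)}(\eta;z)=w_{L+n}P_{n-1}^{(L)}(\eta;z)+\lambda_{L+n+1}P_n^{(L)}(\eta;z)+w_{L+n+1}P_{n+1}^{(L)}(\eta;z),\quad n\in\mathbb{Z}_+,$$ (for $n=0$ the first term on the right is absent), and $R_n^{(L)}(\eta;\rho)=P_n^{(L)}(\eta;\rho^{-1})$ for $\rho\ne0$. $F_L(\eta,\rho)$ and $G_L(\eta,\rho)$ are the regular and irregular Coulomb wave functions, two linearly independent solutions of $$\frac{d^2u}{d\rho^2}+\Big[1-\frac{2\eta}{\rho}-\frac{L(L+1)}{\rho^2}\Big]u=0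 .$$ Here $F_L(\eta,\rho)=C_L(\eta)\rho^{L+1}\phi_L(\eta,\rho)$ with $\phi_L(\eta,\rho)=e^{-i\rho}\,{}_1F_1(L+1-i\eta,2L+2,2i\rho)$ and $C_L(\eta)=2^Le^{-\pi\eta/2}|\Gamma(L+1+i\eta)|/\Gamma(2L+2)$. For $\rho>0$, $G_L(\eta,\rho)$ is the unique solution with $G_L(\eta,\rho)=\cos\theta_L+o(1)$ as $\rho\to+\infty$, where $\theta_L=\rho-\eta\ln(2\rho)-\frac{L\pi}{2}+\arg\Gamma(L+1+i\eta)$ (correspondingly $F_L=\sin\theta_L+o(1)$). For other $\rho\neq0$ all these functions are obtained by analytic continuation along one common path (the same branch of $\log\rho$ for all of them). In the case $L=-1$, $\eta=0$ all expressions are understood as limits $L\to-1^+$ with $\eta=0$: $\sqrt{(L+1)^2}/(L+1)$ is read as $1$, $F_{-1}(0,\rho)=\cos\rho$, $G_{-1}(0,\rho)=-\sin\rho$. *)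

theory Defs
  imports "HOL-Complex_Analysis.Complex_Analysis" "HOL-Computational_Algebra.Polynomial"
begin

definition coulomb_w :: "real \<Rightarrow> real \<Rightarrow> real" where
  "coulomb_w \<eta> x = sqrt ((x + 1)\<^sup>2 + \<eta>\<^sup>2) / ((x + 1) * sqrt ((2 * x + 1) * (2 * x + 3)))"

(* For \<eta> = 0 this is 0 for every x, because y / 0 = 0. *)
definition coulomb_lambda :: "real \<Rightarrow> real \<Rightarrow> real" where
  "coulomb_lambda \<eta> x = - \<eta> / (x * (x + 1))"

(* The three-term recurrence solved for its leading term; see coulomb_P_recurrence. *)
fun coulomb_P :: "real \<Rightarrow> real \<Rightarrow> nat \<Rightarrow> complex poly" where
  "coulomb_P L \<eta> 0 = 1"
| "coulomb_P L \<eta> (Suc 0) =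
     smult (of_real (1 / coulomb_w \<eta> (L + 1))) [:- of_real (coulomb_lambda \<eta> (L + 1)), 1:]"
| "coulomb_P L \<eta> (Suc (Suc n)) =
     smult (of_real (1 / coulomb_w \<eta> (L + real n + 2)))
       ([:- of_real (coulomb_lambda \<eta> (L + real n + 2)), 1:] * coulomb_P L \<eta> (Suc n)
        - smult (of_real (coulomb_w \<eta> (L + real n + 1))) (coulomb_P L \<eta> n))"

lemma coulomb_w_pos:
  assumes "x > - 1 / 2"
  shows "coulomb_w \<eta> x > 0"
proof -
  have "(x + 1)\<^sup>2 + \<eta>\<^sup>2 > 0" "x + 1 > 0" "(2 * x + 1) * (2 * x + 3) > 0"
    using assms by (auto intro!: add_pos_nonneg mult_pos_pos)
  then show ?thesis by (simp add: coulomb_w_def)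
qed

lemma coulomb_P_recurrence:
  assumes "L > - 3 / 2"
  shows "z * poly (coulomb_P L \<eta> n) z =
    (if n = 0 then 0 else of_real (coulomb_w \<eta> (L + real n)) * poly (coulomb_P L \<eta> (n - 1)) z)
    + of_real (coulomb_lambda \<eta> (L + real n + 1)) * poly (coulomb_P L \<eta> n) z
    + of_real (coulomb_w \<eta> (L + real n + 1)) * poly (coulomb_P L \<eta> (n + 1)) z"
proof (cases n)
  case 0
  have "coulomb_w \<eta> (L + 1) \<noteq> 0"
    using coulomb_w_pos[of "L + 1" \<eta>] assms by simp
  then show ?thesis using 0 by (simp add: field_simps)
next
  case (Suc m)
  have "coulomb_w \<eta> (L + real m + 2) \<noteq> 0"
    using coulomb_w_pos[of "L + real m + 2" \<eta>] assms by simp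
  moreover have "L + real n + 1 = L + real m + 2" "L + real n = L + real m + 1"
    using Suc by simp_all
  ultimately show ?thesis using Suc by (simp add: field_simps)
qed

definition coulomb_R :: "real \<Rightarrow> real \<Rightarrow> nat \<Rightarrow> complex \<Rightarrow> complex" where
  "coulomb_R L \<eta> n \<rho> = poly (coulomb_P L \<eta> n) (inverse \<rho>)"

definition hyp1F1 :: "complex \<Rightarrow> complex \<Rightarrow> complex \<Rightarrow> complex" where
  "hyp1F1 a b z = (\<Sum>k. pochhammer a k / pochhammer b k * z ^ k / fact k)"

definition coulomb_phi :: "real \<Rightarrow> real \<Rightarrow> complex \<Rightarrow> complex" where
  "coulomb_phi L \<eta> \<rho> = exp (- \<i> * \<rho>) *
     hyp1F1 (of_real (L + 1) - \<i> * of_real \<eta>) (of_real (2 * L + 2)) (2 * \<i> * \<rho>)"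

definition coulomb_C :: "real \<Rightarrow> real \<Rightarrow> real" where
  "coulomb_C L \<eta> = 2 powr L * exp (- pi * \<eta> / 2) *
     cmod (Gamma (of_real (L + 1) + \<i> * of_real \<eta>)) / Gamma (2 * L + 2)"

(* The Coulomb wave functions live on the Riemann surface of the logarithm, which is
   parametrized by t = log \<rho>: a point is a value \<rho> = exp t together with a branch of
   log \<rho>, and \<rho>^(L+1) is exp ((L+1) t). Real t corresponds to \<rho> > 0, and analytic
   continuation from the positive half-line becomes extension to an entire function of t.
   The parameters L = -1, \<eta> = 0 are the limit L -> -1 from the right with \<eta> = 0. *)
definition coulomb_F :: "real \<Rightarrow> real \<Rightarrow> complex \<Rightarrow> complex" where
  "coulomb_F L \<eta> t =
     (if L = - 1 \<and> \<eta> = 0 then cos (exp t)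
      else of_real (coulomb_C L \<eta>) * exp (of_real (L + 1) * t) * coulomb_phi L \<eta> (exp t))"

definition coulomb_solution :: "real \<Rightarrow> real \<Rightarrow> (real \<Rightarrow> real) \<Rightarrow> bool" where
  "coulomb_solution L \<eta> u \<longleftrightarrow>
     (\<exists>u'. \<forall>\<rho>>0. (u has_real_derivative u' \<rho>) (at \<rho>) \<and>
        (u' has_real_derivative - (1 - 2 * \<eta> / \<rho> - L * (L + 1) / \<rho>\<^sup>2) * u \<rho>) (at \<rho>))"

(* Only the value modulo 2 pi matters, so the principal argument is as good as any other. *)
definition coulomb_theta :: "real \<Rightarrow> real \<Rightarrow> real \<Rightarrow> real" where
  "coulomb_theta L \<eta> \<rho> =
     \<rho> - \<eta> * ln (2 * \<rho>) - L * pi / 2 + Arg (Gamma (of_real (L + 1) + \<i> * of_real \<eta>))"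

(* The value at \<rho> > 0 of the unique solution asymptotic to cos theta. The description ranges
   over values, since a solution is determined only on the positive half-line. *)
definition coulomb_G_pos :: "real \<Rightarrow> real \<Rightarrow> real \<Rightarrow> real" where
  "coulomb_G_pos L \<eta> \<rho> =
     (THE y. \<exists>g. coulomb_solution L \<eta> g \<and>
        ((\<lambda>x. g x - cos (coulomb_theta L \<eta> x)) \<longlongrightarrow> 0) at_top \<and> y = g \<rho>)"

definition log_continuation :: "(real \<Rightarrow> real) \<Rightarrow> complex \<Rightarrow> complex" where
  "log_continuation f =
     (THE h. h holomorphic_on UNIV \<and> (\<forall>s::real. h (of_real s) = of_real (f (exp s))))"

definition coulomb_G :: "real \<Rightarrow> real \<Rightarrow> complex \<Rightarrow> complex" where
  "coulomb_G L \<eta> t =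
     (if L = - 1 \<and> \<eta> = 0 then - sin (exp t)
      else log_continuation (coulomb_G_pos L \<eta>) t)"

end

theory Submission
  imports Defs "HOL-Real_Asymp.Real_Asymp"
begin

text \<open>
  Put \<open>H\<^sub>L = G\<^sub>L + i F\<^sub>L\<close>. For real \<open>\<rho> > 0\<close> this is the solution of the Coulomb equation asymptotic
  to \<open>e\<^sup>i\<^sup>\<theta>\<close>, and it is unique: a solution tending to \<open>0\<close> vanishes, by constancy of Wronskians. The
  first-order operator \<open>(L / \<rho> + \<eta> / L) + d/d\<rho>\<close> maps solutions for \<open>L\<close> to solutions for \<open>L - 1\<close>, and
  uniqueness identifies its value on \<open>H\<^sub>L\<close> as \<open>sqrt (L\<^sup>2 + \<eta>\<^sup>2) / L\<close> times \<open>H\<^sub>L\<^sub>-\<^sub>1\<close>. Hence \<open>F\<close> and \<open>G\<close>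
  satisfy the same three-term recurrence in \<open>L\<close>, which is the one defining the polynomials, and the
  first step reduces to the Wronskian \<open>F' G - F G' = 1\<close>.

  For \<open>L > 0\<close> the solution \<open>H\<^sub>L\<close> is an explicit Laplace integral. Its behaviour at \<open>\<infinity>\<close> gives the phase;
  its behaviour at \<open>0\<close>, compared with that of the power series of \<open>F\<^sub>L\<close>, gives the Wronskians of \<open>F\<^sub>L\<close>
  with \<open>H\<^sub>L\<close> and \<open>cnj H\<^sub>L\<close> and thereby \<open>F\<^sub>L = Im H\<^sub>L\<close> with the correct constant. Smaller \<open>L\<close> are reached
  by the lowering operator. In the variable \<open>log \<rho>\<close> the equation has entire coefficients, so everything
  is entire and the identity on the real line implies the general one.
\<close>

section \<open>Second-order equations with entire coefficients\<close>

text \<open>F is fixed by its power series at \<rho> = 0, G by its behaviour at infinity, and the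
  obstacle is to connect the two ends with the right constants. The Laplace integral is computable
  at both: rescaling the integration variable turns each limit into a Gamma integral. At 0 this
  produces a factor \<open>\<i> powr b\<close> whose phase is undone by the normalisation chosen at
  infinity, so the leading coefficient of H at 0 is real. This is why H and \<open>cnj H\<close>
  have the same Wronskian with F, and F is then (H - cnj H) / 2i. The lowering operator comes from a
  factorisation: with S = l/\<rho> + \<eta>/l and R^2 = 1 + \<eta>^2/l^2 the equation for l reads
  (d/d\<rho> - S)(d/d\<rho> + S) H = - R^2 H, and exchanging the two factors gives the equation for
  l - 1. The Laplace integral serves L > 0, so reaching L > -3/2 takes up to two lowering steps. The
  operator is undefined at l = 0, which is why L = -1, \<eta> = 0 enters only at the end, through
  the explicit solution exp (i \<rho>).\<close>

fun ode_coeff :: "complex fps \<Rightarrow> complex \<Rightarrow> complex \<Rightarrow> nat \<Rightarrow> complex" where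
  "ode_coeff q c d 0 = c"
| "ode_coeff q c d (Suc 0) = d"
| "ode_coeff q c d (Suc (Suc n)) =
     (of_nat (Suc n) * ode_coeff q c d (Suc n)
       - (\<Sum>k\<in>{..n}. fps_nth q (n - k) * ode_coeff q c d k)) / of_nat (Suc n * Suc (Suc n))"

lemma ode_coeff_fps:
  "fps_deriv (fps_deriv (Abs_fps (ode_coeff q c d))) =
     fps_deriv (Abs_fps (ode_coeff q c d)) - q * Abs_fps (ode_coeff q c d)"
proof (rule fps_ext)
  fix n
  define v where "v = ode_coeff q c d"
  have "fps_nth (q * Abs_fps v) n = (\<Sum>k\<in>{..n}. fps_nth q (n - k) * v k)"
    by (subst mult.commute) (simp add: fps_mult_nth atLeast0AtMost mult.commute[of "v _"])
  moreover have "of_nat (Suc n * Suc (Suc n)) * v (Suc (Suc n)) =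
      of_nat (Suc n) * v (Suc n) - (\<Sum>k\<in>{..n}. fps_nth q (n - k) * v k)"
    unfolding v_def ode_coeff.simps(3) by (simp del: ode_coeff.simps of_nat_Suc)
  ultimately show "fps_nth (fps_deriv (fps_deriv (Abs_fps v))) n =
     fps_nth (fps_deriv (Abs_fps v) - q * Abs_fps v) n"
    by (simp add: algebra_simps)
qed

text \<open>Let \<open>M n\<close> be the maximum of the weighted sizes \<open>v k\<close> for k
  \<le> n. The recurrence bounds \<open>v (n + 2)\<close> by (r + r^2 K) / (n + 2) times
  \<open>M (n + 1)\<close>, so the running maximum stops growing once n reaches r + r^2 K.\<close>

lemma ode_coeff_bounded:
  assumes q: "fps_conv_radius q = \<infinity>" and r: "r > 0"
  obtains B where "\<And>n. norm (ode_coeff q c d n) * r ^ n \<le> B"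
proof -
  define v where "v n = norm (ode_coeff q c d n) * r ^ n" for n
  have "summable (\<lambda>n. fps_nth q n * of_real r ^ n)"
    by (rule summable_fps) (use q in auto)
  then have "(\<lambda>n. fps_nth q n * of_real r ^ n) \<longlonglongrightarrow> 0" by (rule summable_LIMSEQ_zero)
  then have "Bseq (\<lambda>n. fps_nth q n * of_real r ^ n)" by (intro convergent_imp_Bseq) (auto simp: convergent_def)
  then obtain K where K: "K > 0" "\<And>n. norm (fps_nth q n * of_real r ^ n) \<le> K"
    by (auto simp: Bseq_def)
  have qK: "norm (fps_nth q n) * r ^ n \<le> K" for n
    using K(2)[of n] r by (simp add: norm_mult norm_power)
  define M where "M n = Max (v ` {..n})" for n
  have vM: "v k \<le> M n" if "k \<le> n" for k n unfolding M_def using that by (intro Max_ge) auto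
  have v0: "v n \<ge> 0" for n using r by (simp add: v_def)
  have step: "v (Suc (Suc n)) \<le> M (Suc n)" if n: "r + r\<^sup>2 * K \<le> n" for n
  proof -
    have M0: "M (Suc n) \<ge> 0" using vM[of 0 "Suc n"] v0[of 0] by simp
    have "v (Suc (Suc n)) = norm (of_nat (Suc n) * ode_coeff q c d (Suc n)
       - (\<Sum>k\<in>{..n}. fps_nth q (n - k) * ode_coeff q c d k)) * r ^ Suc (Suc n) / (real (Suc n) * real (Suc (Suc n)))"
      unfolding v_def ode_coeff.simps(3) norm_divide norm_of_nat of_nat_mult by (simp add: norm_mult del: ode_coeff.simps of_nat_Suc)
    also have "\<dots> \<le> (real (Suc n) * (r * M (Suc n)) + real (Suc n) * (r\<^sup>2 * K * M (Suc n))) / (real (Suc n) * real (Suc (Suc n)))"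
    proof (rule divide_right_mono)
      have "norm (of_nat (Suc n) * ode_coeff q c d (Suc n)
         - (\<Sum>k\<in>{..n}. fps_nth q (n - k) * ode_coeff q c d k)) * r ^ Suc (Suc n)
       \<le> (real (Suc n) * norm (ode_coeff q c d (Suc n)) +
         (\<Sum>k\<in>{..n}. norm (fps_nth q (n - k) * ode_coeff q c d k))) * r ^ Suc (Suc n)"
        using r by (intro mult_right_mono order_trans[OF norm_triangle_ineq4] add_mono norm_sum)
           (auto simp: norm_mult simp del: of_nat_Suc)
      also have "\<dots> = real (Suc n) * (r * v (Suc n)) +
          (\<Sum>k\<in>{..n}. r\<^sup>2 * ((norm (fps_nth q (n - k)) * r ^ (n - k)) * v k))"
      proof -
        have "norm (fps_nth q (n - k) * ode_coeff q c d k) * r ^ Suc (Suc n) =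
          r\<^sup>2 * ((norm (fps_nth q (n - k)) * r ^ (n - k)) * v k)" if "k \<le> n" for k
        proof -
          have "r ^ Suc (Suc n) = r\<^sup>2 * (r ^ (n - k) * r ^ k)"
            using that by (simp add: power2_eq_square flip: power_add)
          then show ?thesis by (simp add: v_def norm_mult)
        qed
        then have "(\<Sum>k\<in>{..n}. norm (fps_nth q (n - k) * ode_coeff q c d k)) * r ^ Suc (Suc n) =
            (\<Sum>k\<in>{..n}. r\<^sup>2 * ((norm (fps_nth q (n - k)) * r ^ (n - k)) * v k))"
          unfolding sum_distrib_right by (intro sum.cong) auto
        then show ?thesis unfolding distrib_right by (simp add: v_def mult_ac)
      qed
      also have "\<dots> \<le> real (Suc n) * (r * M (Suc n)) + (\<Sum>k\<in>{..n}. r\<^sup>2 * (K * M (Suc n)))"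
        using r vM v0 M0 qK K(1) by (intro add_mono mult_left_mono sum_mono mult_mono) auto
      also have "\<dots> = real (Suc n) * (r * M (Suc n)) + real (Suc n) * (r\<^sup>2 * K * M (Suc n))"
        by simp
      finally show "norm (of_nat (Suc n) * ode_coeff q c d (Suc n)
         - (\<Sum>k\<in>{..n}. fps_nth q (n - k) * ode_coeff q c d k)) * r ^ Suc (Suc n) \<le> \<dots>" .
    qed simp
    also have "\<dots> = ((r + r\<^sup>2 * K) / real (Suc (Suc n))) * M (Suc n)"
      by (simp add: divide_simps del: of_nat_Suc) (simp add: algebra_simps)
    also have "\<dots> \<le> 1 * M (Suc n)"
      using n M0 by (intro mult_right_mono) (auto simp: divide_simps)
    finally show ?thesis by simp
  qed
  obtain N :: nat where N: "r + r\<^sup>2 * K \<le> N" using real_arch_simple by blast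
  have "v n \<le> M (Suc N)" for n
  proof (induction n rule: less_induct)
    case (less n)
    show ?case
    proof (cases "n \<le> Suc N")
      case False
      then obtain m where m: "n = Suc (Suc m)" "m \<ge> N" by (metis Suc_le_D not_less_eq_eq Suc_le_mono)
      have "M (Suc m) \<le> M (Suc N)"
        unfolding M_def[of "Suc m"] using less m by (subst Max_le_iff) auto
      moreover have "v n \<le> M (Suc m)" unfolding m by (rule step) (use N m in linarith)
      ultimately show ?thesis by simp
    qed (use vM in auto)
  qed
  then show ?thesis using that unfolding v_def by blast
qed

lemma ode_coeff_conv_radius:
  assumes q: "fps_conv_radius q = \<infinity>"
  shows "fps_conv_radius (Abs_fps (ode_coeff q c d)) = \<infinity>"
proof -
  have "conv_radius (ode_coeff q c d) \<ge> \<infinity>"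
  proof (rule conv_radius_geI_ex)
    fix r :: real assume r: "0 < r"
    \<comment> \<open>The bound is taken at radius 2r, which leaves the geometric factor (1/2)^n at
      radius r.\<close>
    obtain B where B: "\<And>n. norm (ode_coeff q c d n) * (2 * r) ^ n \<le> B"
      using ode_coeff_bounded[OF q, of "2 * r"] r by auto
    have "summable (\<lambda>n. ode_coeff q c d n * of_real r ^ n)"
    proof (rule summable_comparison_test')
      show "summable (\<lambda>n. B * (1 / 2) ^ n)" by (intro summable_mult summable_geometric) auto
      fix n :: nat
      have "norm (ode_coeff q c d n * of_real r ^ n) = norm (ode_coeff q c d n) * (2 * r) ^ n * (1 / 2) ^ n"
        using r by (simp add: norm_mult norm_power power_mult_distrib field_simps)
      also have "\<dots> \<le> B * (1 / 2) ^ n" using B by (intro mult_right_mono) auto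
      finally show "norm (ode_coeff q c d n * of_real r ^ n) \<le> B * (1 / 2) ^ n" .
    qed
    then show "\<exists>z. norm z = r \<and> summable (\<lambda>n. ode_coeff q c d n * z ^ n)"
      using r by (intro exI[of _ "of_real r"]) auto
  qed
  then show ?thesis by (simp add: fps_conv_radius_def)
qed

text \<open>The equation is v'' = v' - q v because substituting \<rho> = exp t into the Coulomb
  equation produces an extra first derivative. The free initial values c and d supply a basis of
  solutions.\<close>

lemma entire_ode_solution:
  fixes q :: "complex \<Rightarrow> complex"
  assumes q: "fps_conv_radius Q = \<infinity>" "\<And>z. q z = eval_fps Q z"
  obtains v v' where "v 0 = c" "v' 0 = d"
    "\<And>z. (v has_field_derivative v' z) (at z)"
    "\<And>z. (v' has_field_derivative v' z - q z * v z) (at z)"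
proof -
  define V where "V = Abs_fps (ode_coeff Q c d)"
  have V: "fps_conv_radius V = \<infinity>" unfolding V_def by (rule ode_coeff_conv_radius) fact
  have V': "fps_conv_radius (fps_deriv V) = \<infinity>" using fps_conv_radius_deriv[of V] V by simp
  have QV: "fps_conv_radius (Q * V) = \<infinity>" using fps_conv_radius_mult[of Q V] V q by simp
  have eq: "fps_deriv (fps_deriv V) = fps_deriv V - Q * V" unfolding V_def by (rule ode_coeff_fps)
  show ?thesis
  proof
    show "eval_fps V 0 = c" "eval_fps (fps_deriv V) 0 = d"
      by (simp_all add: eval_fps_at_0 V_def)
    fix z
    show "(eval_fps V has_field_derivative eval_fps (fps_deriv V) z) (at z)"
      by (rule has_field_derivative_eval_fps) (simp add: V)
    have "(eval_fps (fps_deriv V) has_field_derivative eval_fps (fps_deriv (fps_deriv V)) z) (at z)"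
      by (rule has_field_derivative_eval_fps) (simp add: V')
    then show "(eval_fps (fps_deriv V) has_field_derivative eval_fps (fps_deriv V) z - q z * eval_fps V z) (at z)"
      unfolding eq using V V' QV q by (subst (asm) eval_fps_diff) (auto simp: eval_fps_mult)
  qed
qed

section \<open>The Coulomb equation on the positive half-line\<close>

text \<open>The derivative is carried along as an argument because Wronskians, limits and ladder
  relations all refer to it; complex values admit H together with its conjugate.\<close>

definition coulomb_ode :: "real \<Rightarrow> real \<Rightarrow> (real \<Rightarrow> complex) \<Rightarrow> (real \<Rightarrow> complex) \<Rightarrow> bool" where
  "coulomb_ode L \<eta> u u' \<longleftrightarrow>
     (\<forall>\<rho>>0. (u has_vector_derivative u' \<rho>) (at \<rho>) \<and>
       (u' has_vector_derivative of_real (- (1 - 2 * \<eta> / \<rho> - L * (L + 1) / \<rho>\<^sup>2)) * u \<rho>) (at \<rho>))"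

lemma coulomb_odeD:
  assumes "coulomb_ode L \<eta> u u'" "\<rho> > 0"
  shows "(u has_vector_derivative u' \<rho>) (at \<rho>)"
    and "(u' has_vector_derivative of_real (- (1 - 2 * \<eta> / \<rho> - L * (L + 1) / \<rho>\<^sup>2)) * u \<rho>) (at \<rho>)"
  using assms by (auto simp: coulomb_ode_def)

lemma coulomb_ode_wronskian:
  assumes u: "coulomb_ode L \<eta> u u'" and v: "coulomb_ode L \<eta> v v'"
  obtains c where "\<And>\<rho>. \<rho> > 0 \<Longrightarrow> u' \<rho> * v \<rho> - u \<rho> * v' \<rho> = c"
proof -
  have "((\<lambda>\<rho>. u' \<rho> * v \<rho> - u \<rho> * v' \<rho>) has_vector_derivative 0) (at \<rho>)" if "\<rho> > 0" for \<rho>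
    by (rule has_vector_derivative_eq_rhs
        [OF has_vector_derivative_diff[OF has_vector_derivative_mult has_vector_derivative_mult]])
       (rule coulomb_odeD[OF u that] coulomb_odeD[OF v that], rule coulomb_odeD[OF u that] coulomb_odeD[OF v that],
        rule coulomb_odeD[OF u that] coulomb_odeD[OF v that], rule coulomb_odeD[OF u that] coulomb_odeD[OF v that],
        simp add: algebra_simps)
  then have "\<And>\<rho>. \<rho> \<in> {0<..} \<Longrightarrow>
      ((\<lambda>\<rho>. u' \<rho> * v \<rho> - u \<rho> * v' \<rho>) has_derivative (\<lambda>h. 0)) (at \<rho> within {0<..})"
    by (auto simp: has_vector_derivative_def intro: has_derivative_at_withinI)
  then obtain c where "\<And>\<rho>. \<rho> \<in> {0<..} \<Longrightarrow> u' \<rho> * v \<rho> - u \<rho> * v' \<rho> = c"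
    using has_derivative_zero_constant[OF convex_real_interval(3)[of 0], where f = "\<lambda>\<rho>. u' \<rho> * v \<rho> - u \<rho> * v' \<rho>"] by blast
  then show ?thesis using that by auto
qed

lemma coulomb_ode_diff:
  assumes "coulomb_ode L \<eta> u u'" "coulomb_ode L \<eta> v v'"
  shows "coulomb_ode L \<eta> (\<lambda>\<rho>. u \<rho> - v \<rho>) (\<lambda>\<rho>. u' \<rho> - v' \<rho>)"
  using assms unfolding coulomb_ode_def right_diff_distrib
  by (auto intro!: has_vector_derivative_diff)

lemma coulomb_ode_cnj:
  assumes "coulomb_ode L \<eta> u u'"
  shows "coulomb_ode L \<eta> (\<lambda>\<rho>. cnj (u \<rho>)) (\<lambda>\<rho>. cnj (u' \<rho>))"
  unfolding coulomb_ode_def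
proof safe
  fix \<rho> :: real assume r: "\<rho> > 0"
  show "((\<lambda>\<rho>. cnj (u \<rho>)) has_vector_derivative cnj (u' \<rho>)) (at \<rho>)"
    by (rule has_vector_derivative_cnj) (rule coulomb_odeD[OF assms r])
  show "((\<lambda>\<rho>. cnj (u' \<rho>)) has_vector_derivative
      of_real (- (1 - 2 * \<eta> / \<rho> - L * (L + 1) / \<rho>\<^sup>2)) * cnj (u \<rho>)) (at \<rho>)"
    using has_vector_derivative_cnj[OF coulomb_odeD(2)[OF assms r]] by simp
qed

lemma coulomb_ode_of_real:
  assumes "\<And>\<rho>. \<rho> > 0 \<Longrightarrow> (g has_real_derivative g' \<rho>) (at \<rho>)"
    "\<And>\<rho>. \<rho> > 0 \<Longrightarrow> (g' has_real_derivative - (1 - 2 * \<eta> / \<rho> - L * (L + 1) / \<rho>\<^sup>2) * g \<rho>) (at \<rho>)"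
  shows "coulomb_ode L \<eta> (\<lambda>\<rho>. of_real (g \<rho>)) (\<lambda>\<rho>. of_real (g' \<rho>))"
  unfolding coulomb_ode_def of_real_mult[symmetric]
  by (intro allI impI conjI has_vector_derivative_of_real assms)

lemma coulomb_ode_Re:
  assumes "coulomb_ode L \<eta> u u'" "\<rho> > 0"
  shows "((\<lambda>\<rho>. Re (u \<rho>)) has_real_derivative Re (u' \<rho>)) (at \<rho>)"
    "((\<lambda>\<rho>. Re (u' \<rho>)) has_real_derivative - (1 - 2 * \<eta> / \<rho> - L * (L + 1) / \<rho>\<^sup>2) * Re (u \<rho>)) (at \<rho>)"
proof -
  have *: "((\<lambda>\<rho>. Re (f \<rho>)) has_real_derivative Re d) (at \<rho>)"
    if "(f has_vector_derivative d) (at \<rho>)" for f d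
    unfolding has_real_derivative_iff_has_vector_derivative
    using bounded_linear.has_vector_derivative[OF bounded_linear_Re that] .
  show "((\<lambda>\<rho>. Re (u \<rho>)) has_real_derivative Re (u' \<rho>)) (at \<rho>)"
    using *[OF coulomb_odeD(1)[OF assms]] .
  show "((\<lambda>\<rho>. Re (u' \<rho>)) has_real_derivative - (1 - 2 * \<eta> / \<rho> - L * (L + 1) / \<rho>\<^sup>2) * Re (u \<rho>)) (at \<rho>)"
    using *[OF coulomb_odeD(2)[OF assms]] by (simp add: )
qed

text \<open>Two entire solutions in t = log \<rho> restrict to a basis on the half-line. The
  coefficients of u in this basis are Wronskians, hence constants, and the same combination is
  entire.\<close>

lemma coulomb_ode_entire_continuation:
  assumes u: "coulomb_ode L \<eta> u u'"
  obtains h where "h holomorphic_on UNIV" "\<And>s. h (of_real s) = u (exp s)"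
proof -
  define q where "q z = exp (2 * z) - of_real (2 * \<eta>) * exp z - of_real (L * (L + 1))" for z :: complex
  define Q where "Q = fps_exp 2 - fps_const (of_real (2 * \<eta>)) * fps_exp 1 - fps_const (of_real (L * (L + 1)) :: complex)"
  have r1: "fps_conv_radius (fps_const (of_real (2 * \<eta>)) * fps_exp (1::complex)) = \<infinity>"
    using fps_conv_radius_mult[of "fps_const (of_real (2 * \<eta>))" "fps_exp (1::complex)"] by simp
  have r2: "fps_conv_radius (fps_exp 2 - fps_const (of_real (2 * \<eta>)) * fps_exp (1::complex)) = \<infinity>"
    using fps_conv_radius_diff[of "fps_exp 2" "fps_const (of_real (2 * \<eta>)) * fps_exp (1::complex)"] r1 by simp
  have r3: "fps_conv_radius Q = \<infinity>"
    using fps_conv_radius_diff[of "fps_exp 2 - fps_const (of_real (2 * \<eta>)) * fps_exp (1::complex)"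
        "fps_const (of_real (L * (L + 1)))"] r2 by (simp add: Q_def)
  have q: "q z = eval_fps Q z" for z
    unfolding q_def Q_def using r1 r2 by (simp add: eval_fps_diff eval_fps_mult)
  obtain v1 v1' where v1: "v1 0 = 1" "v1' 0 = 0" "\<And>z. (v1 has_field_derivative v1' z) (at z)"
    "\<And>z. (v1' has_field_derivative v1' z - q z * v1 z) (at z)"
    using entire_ode_solution[of Q q, OF r3 q] by blast
  obtain v2 v2' where v2: "v2 0 = 0" "v2' 0 = 1" "\<And>z. (v2 has_field_derivative v2' z) (at z)"
    "\<And>z. (v2' has_field_derivative v2' z - q z * v2 z) (at z)"
    using entire_ode_solution[of Q q, OF r3 q] by blast
  have ode: "coulomb_ode L \<eta> (\<lambda>\<rho>. v (of_real (ln \<rho>))) (\<lambda>\<rho>. v' (of_real (ln \<rho>)) / of_real \<rho>)"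
    if v: "\<And>z. (v has_field_derivative v' z) (at z)"
      "\<And>z. (v' has_field_derivative v' z - q z * v z) (at z)" for v v' :: "complex \<Rightarrow> complex"
    unfolding coulomb_ode_def
  proof safe
    fix \<rho> :: real assume r: "\<rho> > 0"
    have ln: "((\<lambda>\<rho>. of_real (ln \<rho>)) has_vector_derivative (of_real (1 / \<rho>) :: complex)) (at \<rho>)"
      using r by (intro has_vector_derivative_of_real) (auto intro!: derivative_eq_intros)
    have inv: "((\<lambda>\<rho>. of_real (1 / \<rho>)) has_vector_derivative (of_real (- 1 / \<rho>\<^sup>2) :: complex)) (at \<rho>)"
      using r by (intro has_vector_derivative_of_real)
        (auto intro!: derivative_eq_intros simp: power2_eq_square)
    have d1: "((\<lambda>\<rho>. v (of_real (ln \<rho>))) has_vector_derivative of_real (1 / \<rho>) * v' (of_real (ln \<rho>))) (at \<rho>)"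
      using field_vector_diff_chain_at[OF ln v(1)] by (simp add: o_def)
    then show "((\<lambda>\<rho>. v (of_real (ln \<rho>))) has_vector_derivative v' (of_real (ln \<rho>)) / of_real \<rho>) (at \<rho>)"
      by simp
    have d2: "((\<lambda>\<rho>. v' (of_real (ln \<rho>))) has_vector_derivative
        of_real (1 / \<rho>) * (v' (of_real (ln \<rho>)) - q (of_real (ln \<rho>)) * v (of_real (ln \<rho>)))) (at \<rho>)"
      using field_vector_diff_chain_at[OF ln v(2)] by (simp add: o_def)
    have qr: "q (of_real (ln \<rho>)) = of_real (\<rho>\<^sup>2 - 2 * \<eta> * \<rho> - L * (L + 1))"
      using r by (simp add: q_def exp_of_real exp_double)
    have "((\<lambda>\<rho>. v' (of_real (ln \<rho>)) * of_real (1 / \<rho>)) has_vector_derivative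
       of_real (- (1 - 2 * \<eta> / \<rho> - L * (L + 1) / \<rho>\<^sup>2)) * v (of_real (ln \<rho>))) (at \<rho>)"
      by (rule has_vector_derivative_eq_rhs[OF has_vector_derivative_mult[OF d2 inv]])
        (use r in \<open>simp add: qr field_simps power2_eq_square\<close>)
    then show "((\<lambda>\<rho>. v' (of_real (ln \<rho>)) / of_real \<rho>) has_vector_derivative
       of_real (- (1 - 2 * \<eta> / \<rho> - L * (L + 1) / \<rho>\<^sup>2)) * v (of_real (ln \<rho>))) (at \<rho>)"
      by simp
  qed
  note V1 = ode[OF v1(3,4)] and V2 = ode[OF v2(3,4)]
  obtain w where w: "\<And>\<rho>. \<rho> > 0 \<Longrightarrow> v1' (of_real (ln \<rho>)) / of_real \<rho> * v2 (of_real (ln \<rho>))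
      - v1 (of_real (ln \<rho>)) * (v2' (of_real (ln \<rho>)) / of_real \<rho>) = w"
    using coulomb_ode_wronskian[OF V1 V2] by metis
  \<comment> \<open>Evaluated at \<rho> = 1, that is t = 0, where the initial values of the basis
    are known.\<close>
  have w1: "w = - 1" using w[of 1] v1(1,2) v2(1,2) by simp
  obtain A where A: "\<And>\<rho>. \<rho> > 0 \<Longrightarrow> u' \<rho> * v1 (of_real (ln \<rho>)) - u \<rho> * (v1' (of_real (ln \<rho>)) / of_real \<rho>) = A"
    using coulomb_ode_wronskian[OF u V1] by metis
  obtain B where B: "\<And>\<rho>. \<rho> > 0 \<Longrightarrow> u' \<rho> * v2 (of_real (ln \<rho>)) - u \<rho> * (v2' (of_real (ln \<rho>)) / of_real \<rho>) = B"
    using coulomb_ode_wronskian[OF u V2] by metis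
  show ?thesis
  proof (rule that[of "\<lambda>z. A * v2 z - B * v1 z"])
    show "(\<lambda>z. A * v2 z - B * v1 z) holomorphic_on UNIV"
      using v1(3) v2(3) by (intro holomorphic_intros) (auto simp: holomorphic_on_open)
    fix s :: real
    have "A * v2 (of_real s) - B * v1 (of_real s) =
      - u (exp s) * (v1' (of_real s) / of_real (exp s) * v2 (of_real s) - v1 (of_real s) * (v2' (of_real s) / of_real (exp s)))"
      unfolding A[of "exp s", OF exp_gt_zero, symmetric] B[of "exp s", OF exp_gt_zero, symmetric] ln_exp
      by (simp add: algebra_simps)
    also have "\<dots> = u (exp s)" using w[of "exp s"] w1 by simp
    finally show "A * v2 (of_real s) - B * v1 (of_real s) = u (exp s)" .
  qed
qed


section \<open>Solutions asymptotic to exp (i \<theta>), their uniqueness, and G as a real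
  part\<close>

text \<open>The limit of the derivative is recorded too, because constant Wronskians are evaluated
  at infinity.\<close>

definition outgoing :: "real \<Rightarrow> real \<Rightarrow> (real \<Rightarrow> complex) \<Rightarrow> (real \<Rightarrow> complex) \<Rightarrow> bool" where
  "outgoing L \<eta> H H' \<longleftrightarrow> coulomb_ode L \<eta> H H' \<and>
     ((\<lambda>\<rho>. H \<rho> * cis (- coulomb_theta L \<eta> \<rho>)) \<longlongrightarrow> 1) at_top \<and>
     ((\<lambda>\<rho>. H' \<rho> * cis (- coulomb_theta L \<eta> \<rho>)) \<longlongrightarrow> \<i>) at_top"

text \<open>The Wronskian is constant, so its value is its limit at infinity; there the phases
  cancel against their conjugates and i * 1 - 1 * cnj i remains.\<close>

lemma outgoing_wronskian:
  assumes H: "outgoing L \<eta> H H'" and r: "\<rho> > 0"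
  shows "H' \<rho> * cnj (H \<rho>) - H \<rho> * cnj (H' \<rho>) = 2 * \<i>"
proof -
  let ?e = "\<lambda>\<rho>. cis (- coulomb_theta L \<eta> \<rho>)"
  have ode: "coulomb_ode L \<eta> H H'" using H by (simp add: outgoing_def)
  obtain c where c: "\<And>\<rho>. \<rho> > 0 \<Longrightarrow> H' \<rho> * cnj (H \<rho>) - H \<rho> * cnj (H' \<rho>) = c"
    using coulomb_ode_wronskian[OF ode coulomb_ode_cnj[OF ode]] by metis
  have "((\<lambda>\<rho>. (H' \<rho> * ?e \<rho>) * cnj (H \<rho> * ?e \<rho>) - (H \<rho> * ?e \<rho>) * cnj (H' \<rho> * ?e \<rho>)) \<longlongrightarrow>
      \<i> * cnj 1 - 1 * cnj \<i>) at_top"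
    using H unfolding outgoing_def by (intro tendsto_intros) auto
  also have "(\<lambda>\<rho>. (H' \<rho> * ?e \<rho>) * cnj (H \<rho> * ?e \<rho>) - (H \<rho> * ?e \<rho>) * cnj (H' \<rho> * ?e \<rho>)) =
      (\<lambda>\<rho>. H' \<rho> * cnj (H \<rho>) - H \<rho> * cnj (H' \<rho>))"
  proof
    fix \<rho>
    have "(H' \<rho> * ?e \<rho>) * cnj (H \<rho> * ?e \<rho>) - (H \<rho> * ?e \<rho>) * cnj (H' \<rho> * ?e \<rho>) =
       (H' \<rho> * cnj (H \<rho>) - H \<rho> * cnj (H' \<rho>)) * (?e \<rho> * cnj (?e \<rho>))"
      by (simp add: algebra_simps)
    also have "?e \<rho> * cnj (?e \<rho>) = 1" by (simp add: cis_mult cis_cnj)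
    finally show "(H' \<rho> * ?e \<rho>) * cnj (H \<rho> * ?e \<rho>) - (H \<rho> * ?e \<rho>) * cnj (H' \<rho> * ?e \<rho>) =
       H' \<rho> * cnj (H \<rho>) - H \<rho> * cnj (H' \<rho>)" by simp
  qed
  finally have "((\<lambda>\<rho>. H' \<rho> * cnj (H \<rho>) - H \<rho> * cnj (H' \<rho>)) \<longlongrightarrow> 2 * \<i>) at_top" by simp
  moreover have "((\<lambda>\<rho>. H' \<rho> * cnj (H \<rho>) - H \<rho> * cnj (H' \<rho>)) \<longlongrightarrow> c) at_top"
    by (rule tendsto_eventually, rule eventually_mono[OF eventually_gt_at_top[of 0]]) (rule c)
  ultimately have "c = 2 * \<i>" using tendsto_unique trivial_limit_at_top_linorder by blast
  then show ?thesis using c r by simp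
qed

text \<open>Only the linear term of \<theta> contributes in the limit, since the logarithm varies
  slowly.\<close>

lemma coulomb_theta_shift:
  "((\<lambda>\<rho>. coulomb_theta L \<eta> (\<rho> + pi / 2) - coulomb_theta L \<eta> \<rho>) \<longlongrightarrow> pi / 2) at_top"
proof -
  have "((\<lambda>\<rho>. ln (2 * (\<rho> + pi / 2)) - ln (2 * \<rho>)) \<longlongrightarrow> 0) at_top" by real_asymp
  then have "((\<lambda>\<rho>. pi / 2 - \<eta> * (ln (2 * (\<rho> + pi / 2)) - ln (2 * \<rho>))) \<longlongrightarrow> pi / 2 - \<eta> * 0) at_top"
    by (intro tendsto_intros)
  then show ?thesis by (simp add: coulomb_theta_def algebra_simps)
qed

text \<open>A solution is \<open>\<alpha> H + \<beta> cnj H\<close> with constants \<open>\<alpha>, \<beta>\<close>. If it tends to \<open>0\<close>, then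
  so does \<open>\<alpha> e\<^sup>2\<^sup>i\<^sup>\<theta> + \<beta>\<close>; but a shift of \<open>\<rho>\<close> by \<open>\<pi> / 2\<close> asymptotically flips the sign
  of the exponential.\<close>
lemma coulomb_ode_vanishing_at_infinity:
  assumes H: "outgoing L \<eta> H H'" and u: "coulomb_ode L \<eta> u u'"
    and lim: "(u \<longlongrightarrow> 0) at_top" and r: "\<rho> > 0"
  shows "u \<rho> = 0"
proof -
  let ?\<theta> = "coulomb_theta L \<eta>"
  let ?e = "\<lambda>\<rho>. cis (- ?\<theta> \<rho>)"
  have ode: "coulomb_ode L \<eta> H H'" and lH: "((\<lambda>\<rho>. H \<rho> * ?e \<rho>) \<longlongrightarrow> 1) at_top"
    using H by (auto simp: outgoing_def)
  obtain A where A: "\<And>\<rho>. \<rho> > 0 \<Longrightarrow> u' \<rho> * H \<rho> - u \<rho> * H' \<rho> = A"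
    using coulomb_ode_wronskian[OF u ode] by metis
  obtain B where B: "\<And>\<rho>. \<rho> > 0 \<Longrightarrow> u' \<rho> * cnj (H \<rho>) - u \<rho> * cnj (H' \<rho>) = B"
    using coulomb_ode_wronskian[OF u coulomb_ode_cnj[OF ode]] by metis
  \<comment> \<open>Cramer's rule for u in the basis H, \<open>cnj H\<close>, whose Wronskian is
    2i.\<close>
  have comb: "A * cnj (H \<rho>) - B * H \<rho> = - (2 * \<i>) * u \<rho>" if "\<rho> > 0" for \<rho>
    unfolding A[OF that, symmetric] B[OF that, symmetric] outgoing_wronskian[OF H that, symmetric]
    by (simp add: algebra_simps)
  have ee: "?e \<rho> * cis (?\<theta> \<rho>) = 1" for \<rho> by (simp add: cis_mult)
  have bd: "((\<lambda>\<rho>. g \<rho> * cis (f \<rho>)) \<longlongrightarrow> 0) at_top" if "(g \<longlongrightarrow> 0) at_top"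
    for g :: "real \<Rightarrow> complex" and f :: "real \<Rightarrow> real"
  proof (rule tendsto_norm_zero_cancel)
    show "((\<lambda>\<rho>. norm (g \<rho> * cis (f \<rho>))) \<longlongrightarrow> 0) at_top"
      using tendsto_norm_zero[OF that] by (simp add: norm_mult)
  qed
  \<comment> \<open>After multiplication by exp (i \<theta>), this is the error of replacing H by
    exp (i \<theta>) and \<open>cnj H\<close> by exp (- i \<theta>).\<close>
  have "((\<lambda>\<rho>. A * cnj (H \<rho> * ?e \<rho> - 1) - (B * (H \<rho> * ?e \<rho> - 1)) * cis (2 * ?\<theta> \<rho>)) \<longlongrightarrow> A * cnj (1 - 1) - 0) at_top"
    by (intro tendsto_diff bd tendsto_mult tendsto_const tendsto_cnj lH)
       (use tendsto_mult[OF tendsto_const tendsto_diff[OF lH tendsto_const], of B 1] in simp)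
  moreover have "((\<lambda>\<rho>. (- (2 * \<i>) * u \<rho>) * cis (?\<theta> \<rho>)) \<longlongrightarrow> 0) at_top"
    by (rule bd) (use tendsto_mult[OF tendsto_const lim, of "- (2 * \<i>)"] in simp)
  ultimately have "((\<lambda>\<rho>. (- (2 * \<i>) * u \<rho>) * cis (?\<theta> \<rho>) -
      (A * cnj (H \<rho> * ?e \<rho> - 1) - (B * (H \<rho> * ?e \<rho> - 1)) * cis (2 * ?\<theta> \<rho>))) \<longlongrightarrow> 0 - (A * cnj (1 - 1) - 0)) at_top"
    by (intro tendsto_diff[of _ 0])
  then have "((\<lambda>\<rho>. (- (2 * \<i>) * u \<rho>) * cis (?\<theta> \<rho>) -
      (A * cnj (H \<rho> * ?e \<rho> - 1) - (B * (H \<rho> * ?e \<rho> - 1)) * cis (2 * ?\<theta> \<rho>))) \<longlongrightarrow> 0) at_top"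
    by simp
  moreover have "\<forall>\<^sub>F \<rho> in at_top. (- (2 * \<i>) * u \<rho>) * cis (?\<theta> \<rho>) -
      (A * cnj (H \<rho> * ?e \<rho> - 1) - (B * (H \<rho> * ?e \<rho> - 1)) * cis (2 * ?\<theta> \<rho>)) = A - B * cis (2 * ?\<theta> \<rho>)"
  proof (rule eventually_mono[OF eventually_gt_at_top[of 0]])
    fix \<rho> :: real assume "\<rho> > 0"
    have "cis (2 * ?\<theta> \<rho>) = cis (?\<theta> \<rho>) * cis (?\<theta> \<rho>)" by (simp add: cis_mult)
    moreover have "cnj (?e \<rho>) = cis (?\<theta> \<rho>)" by (simp add: cis_cnj)
    ultimately show "(- (2 * \<i>) * u \<rho>) * cis (?\<theta> \<rho>) -
      (A * cnj (H \<rho> * ?e \<rho> - 1) - (B * (H \<rho> * ?e \<rho> - 1)) * cis (2 * ?\<theta> \<rho>)) = A - B * cis (2 * ?\<theta> \<rho>)"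
      unfolding comb[OF \<open>\<rho> > 0\<close>, symmetric] using ee[of \<rho>] by simp algebra
  qed
  ultimately have lim0: "((\<lambda>\<rho>. A - B * cis (2 * ?\<theta> \<rho>)) \<longlongrightarrow> 0) at_top"
    by (rule Lim_transform_eventually)
  have "((\<lambda>\<rho>. A - B * cis (2 * ?\<theta> (\<rho> + pi / 2))) \<longlongrightarrow> 0) at_top"
    using filterlim_compose[OF lim0 filterlim_tendsto_add_at_top[OF tendsto_const filterlim_ident], of "pi / 2"]
    by (simp add: add.commute)
  moreover have "((\<lambda>\<rho>. cis (2 * (?\<theta> (\<rho> + pi / 2) - ?\<theta> \<rho>))) \<longlongrightarrow> cis (2 * (pi / 2))) at_top"
    by (intro tendsto_intros coulomb_theta_shift)
  then have "((\<lambda>\<rho>. cis (2 * (?\<theta> (\<rho> + pi / 2) - ?\<theta> \<rho>)) + 1) \<longlongrightarrow> cis (2 * (pi / 2)) + 1) at_top"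
    by (intro tendsto_add tendsto_const)
  then have "((\<lambda>\<rho>. cis (2 * (?\<theta> (\<rho> + pi / 2) - ?\<theta> \<rho>)) + 1) \<longlongrightarrow> 0) at_top" by simp
  then have "((\<lambda>\<rho>. B * ((cis (2 * (?\<theta> (\<rho> + pi / 2) - ?\<theta> \<rho>)) + 1) * cis (2 * ?\<theta> \<rho>))) \<longlongrightarrow> 0) at_top"
    using tendsto_mult[OF tendsto_const bd, of _ B] by simp
  \<comment> \<open>Adding the shifted and the unshifted expression cancels the exponentials up to a
    null term, which leaves the constant 2A.\<close>
  ultimately have "((\<lambda>\<rho>. (A - B * cis (2 * ?\<theta> (\<rho> + pi / 2))) + (A - B * cis (2 * ?\<theta> \<rho>)) +
      B * ((cis (2 * (?\<theta> (\<rho> + pi / 2) - ?\<theta> \<rho>)) + 1) * cis (2 * ?\<theta> \<rho>))) \<longlongrightarrow> 0 + 0 + 0) at_top"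
    by (intro tendsto_add lim0)
  also have "(\<lambda>\<rho>. (A - B * cis (2 * ?\<theta> (\<rho> + pi / 2))) + (A - B * cis (2 * ?\<theta> \<rho>)) +
      B * ((cis (2 * (?\<theta> (\<rho> + pi / 2) - ?\<theta> \<rho>)) + 1) * cis (2 * ?\<theta> \<rho>))) = (\<lambda>\<rho>. 2 * A)"
    by (rule ext) (simp add: algebra_simps cis_mult)
  finally have A0: "A = 0" by (simp add: tendsto_const_iff)
  \<comment> \<open>With A = 0 this norm is the constant |B|, since \<open>cis\<close> has norm
    1.\<close>
  have "((\<lambda>\<rho>. norm (A - B * cis (2 * ?\<theta> \<rho>))) \<longlongrightarrow> 0) at_top" using lim0 by (rule tendsto_norm_zero)
  then have "B = 0" using A0 by (simp add: norm_mult tendsto_const_iff)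
  then show ?thesis using comb[OF r] A0 by simp
qed

lemma outgoing_diff_cis:
  assumes "outgoing L \<eta> H H'"
  shows "((\<lambda>\<rho>. H \<rho> - cis (coulomb_theta L \<eta> \<rho>)) \<longlongrightarrow> 0) at_top"
proof (rule tendsto_norm_zero_cancel)
  have "((\<lambda>\<rho>. norm (H \<rho> * cis (- coulomb_theta L \<eta> \<rho>) - 1)) \<longlongrightarrow> norm (1 - 1 :: complex)) at_top"
    using assms unfolding outgoing_def by (intro tendsto_intros) auto
  moreover have "norm (H \<rho> * cis (- coulomb_theta L \<eta> \<rho>) - 1) = norm (H \<rho> - cis (coulomb_theta L \<eta> \<rho>))" for \<rho>
  proof -
    have "H \<rho> - cis (coulomb_theta L \<eta> \<rho>) =
        (H \<rho> * cis (- coulomb_theta L \<eta> \<rho>) - 1) * cis (coulomb_theta L \<eta> \<rho>)"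
      by (simp add: algebra_simps cis_mult)
    then show ?thesis by (simp add: norm_mult)
  qed
  ultimately show "((\<lambda>\<rho>. norm (H \<rho> - cis (coulomb_theta L \<eta> \<rho>))) \<longlongrightarrow> 0) at_top" by simp
qed

lemma outgoing_unique:
  assumes "outgoing L \<eta> H H'" "outgoing L \<eta> K K'" "\<rho> > 0"
  shows "H \<rho> = K \<rho>"
proof -
  have "coulomb_ode L \<eta> (\<lambda>\<rho>. H \<rho> - K \<rho>) (\<lambda>\<rho>. H' \<rho> - K' \<rho>)"
    using assms by (intro coulomb_ode_diff) (auto simp: outgoing_def)
  moreover have "((\<lambda>\<rho>. H \<rho> - K \<rho>) \<longlongrightarrow> 0) at_top"
    using tendsto_diff[OF outgoing_diff_cis[OF assms(1)] outgoing_diff_cis[OF assms(2)]] by simp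
  ultimately have "H \<rho> - K \<rho> = 0" by (rule coulomb_ode_vanishing_at_infinity[OF assms(1) _ _ assms(3)])
  then show ?thesis by simp
qed

lemma outgoing_unique_deriv:
  assumes "outgoing L \<eta> H H'" "outgoing L \<eta> K K'" "\<rho> > 0"
  shows "H' \<rho> = K' \<rho>"
proof -
  have "(H has_vector_derivative H' \<rho>) (at \<rho>)" "(K has_vector_derivative K' \<rho>) (at \<rho>)"
    using assms by (auto simp: outgoing_def dest: coulomb_odeD)
  then have "(K has_vector_derivative H' \<rho>) (at \<rho>)"
    using has_vector_derivative_transform_within_open[of H "H' \<rho>" \<rho> "{0<..}" K]
      outgoing_unique[OF assms(1,2)] assms(3) by auto
  then show ?thesis using \<open>(K has_vector_derivative K' \<rho>) (at \<rho>)\<close> vector_derivative_unique_at by blast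
qed

text \<open>\<open>Re H\<close> is a real solution asymptotic to cos \<theta>; any other differs
  from it by a solution that tends to 0, and such a solution vanishes.\<close>

lemma coulomb_G_pos_eq:
  assumes H: "outgoing L \<eta> H H'" and r: "\<rho> > 0"
  shows "coulomb_G_pos L \<eta> \<rho> = Re (H \<rho>)"
  unfolding coulomb_G_pos_def
proof (rule the_equality)
  have ode: "coulomb_ode L \<eta> H H'" using H by (simp add: outgoing_def)
  have lim: "((\<lambda>x. Re (H x) - cos (coulomb_theta L \<eta> x)) \<longlongrightarrow> 0) at_top"
    using tendsto_Re[OF outgoing_diff_cis[OF H]] by simp
  have "coulomb_solution L \<eta> (\<lambda>\<rho>. Re (H \<rho>))"
    unfolding coulomb_solution_def using coulomb_ode_Re[OF ode] by (intro exI[of _ "\<lambda>\<rho>. Re (H' \<rho>)"]) auto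
  with lim show "\<exists>g. coulomb_solution L \<eta> g \<and>
      ((\<lambda>x. g x - cos (coulomb_theta L \<eta> x)) \<longlongrightarrow> 0) at_top \<and> Re (H \<rho>) = g \<rho>"
    by (intro exI[of _ "\<lambda>\<rho>. Re (H \<rho>)"]) auto
  fix y
  assume "\<exists>g. coulomb_solution L \<eta> g \<and> ((\<lambda>x. g x - cos (coulomb_theta L \<eta> x)) \<longlongrightarrow> 0) at_top \<and> y = g \<rho>"
  then obtain g where g: "coulomb_solution L \<eta> g"
      "((\<lambda>x. g x - cos (coulomb_theta L \<eta> x)) \<longlongrightarrow> 0) at_top" "y = g \<rho>" by blast
  from g(1) obtain g' where "\<And>\<rho>. \<rho> > 0 \<Longrightarrow> (g has_real_derivative g' \<rho>) (at \<rho>)"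
    "\<And>\<rho>. \<rho> > 0 \<Longrightarrow> (g' has_real_derivative - (1 - 2 * \<eta> / \<rho> - L * (L + 1) / \<rho>\<^sup>2) * g \<rho>) (at \<rho>)"
    unfolding coulomb_solution_def by blast
  then have go: "coulomb_ode L \<eta> (\<lambda>\<rho>. of_real (g \<rho>)) (\<lambda>\<rho>. of_real (g' \<rho>))" by (rule coulomb_ode_of_real)
  have "coulomb_ode L \<eta> (\<lambda>\<rho>. of_real (Re (H \<rho>))) (\<lambda>\<rho>. of_real (Re (H' \<rho>)))"
    by (rule coulomb_ode_of_real) (use coulomb_ode_Re[OF ode] in auto)
  note coulomb_ode_diff[OF go this]
  moreover have "((\<lambda>x. complex_of_real (g x) - of_real (Re (H x))) \<longlongrightarrow> 0) at_top"
    using tendsto_of_real[OF tendsto_diff[OF g(2) lim]] by simp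
  ultimately have "complex_of_real (g \<rho>) - of_real (Re (H \<rho>)) = 0"
    by (rule coulomb_ode_vanishing_at_infinity[OF H _ _ r])
  then show "y = Re (H \<rho>)" using g(3) by simp
qed

lemma entire_eqI_real:
  assumes "f holomorphic_on UNIV" "g holomorphic_on UNIV" "\<And>s::real. f (of_real s) = g (of_real s)"
  shows "f z = g z"
proof -
  have "(0::complex) islimpt range complex_of_real"
    unfolding islimpt_approachable
  proof safe
    fix e :: real assume "e > 0"
    then show "\<exists>x'\<in>range complex_of_real. x' \<noteq> 0 \<and> dist x' 0 < e"
      by (intro bexI[OF _ rangeI[of _ "e / 2"]]) auto
  qed
  moreover have "(\<lambda>z. f z - g z) holomorphic_on UNIV"
    using assms by (intro holomorphic_intros)
  ultimately have "f z - g z = 0"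
    using analytic_continuation[of "\<lambda>z. f z - g z" UNIV "range of_real" 0 z] assms(3) by auto
  then show ?thesis by simp
qed

text \<open>Resolves both definite descriptions behind G: the value on the half-line by uniqueness
  of the asymptotic solution, the continuation by the identity theorem.\<close>

lemma coulomb_G_outgoing:
  assumes H: "outgoing L \<eta> H H'" and L: "\<not> (L = - 1 \<and> \<eta> = 0)"
  shows "coulomb_G L \<eta> holomorphic_on UNIV"
    and "coulomb_G L \<eta> (of_real s) = of_real (Re (H (exp s)))"
proof -
  have "coulomb_ode L \<eta> H H'" using H by (simp add: outgoing_def)
  then have "coulomb_ode L \<eta> (\<lambda>\<rho>. of_real (Re (H \<rho>))) (\<lambda>\<rho>. of_real (Re (H' \<rho>)))"
    by (intro coulomb_ode_of_real coulomb_ode_Re)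
  then obtain h where h: "h holomorphic_on UNIV" "\<And>s. h (of_real s) = of_real (Re (H (exp s)))"
    using coulomb_ode_entire_continuation by blast
  have "log_continuation (coulomb_G_pos L \<eta>) = h"
    unfolding log_continuation_def
  proof (rule the_equality)
    show *: "h holomorphic_on UNIV \<and> (\<forall>s::real. h (of_real s) = of_real (coulomb_G_pos L \<eta> (exp s)))"
      using h coulomb_G_pos_eq[OF H] by simp
    show "k = h" if "k holomorphic_on UNIV \<and> (\<forall>s::real. k (of_real s) = of_real (coulomb_G_pos L \<eta> (exp s)))" for k
      by (rule ext, rule entire_eqI_real) (use that * in simp_all)
  qed
  then have "coulomb_G L \<eta> = h" using L unfolding coulomb_G_def by (intro ext) auto
  with h show "coulomb_G L \<eta> holomorphic_on UNIV"
     "coulomb_G L \<eta> (of_real s) = of_real (Re (H (exp s)))" by auto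
qed


section \<open>The lowering operator on normalised solutions\<close>

text \<open>The functional equation of Gamma determines the argument only modulo 2 \<pi>, hence the
  formulation through \<open>cis\<close>.\<close>

lemma cis_Arg_Gamma_plus1:
  assumes "z \<notin> \<int>\<^sub>\<le>\<^sub>0"
  shows "cis (Arg (Gamma (z + 1))) = sgn z * cis (Arg (Gamma z))"
proof -
  have "z \<noteq> 0" "Gamma z \<noteq> 0" using assms by (auto simp: Gamma_eq_zero_iff)
  then show ?thesis
    using assms by (simp add: cis_Arg Gamma_plus1 sgn_mult)
qed

text \<open>Since S' = - l/\<rho>^2, the equations for l and l - 1 have the coefficients S^2 - R^2 -
  S' and S^2 - R^2 + S'. Hence K = (S H + H') / R satisfies K' = S K - R H and solves the second
  equation; the division by R normalises the limit at infinity.\<close>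

lemma outgoing_lower:
  assumes H: "outgoing l \<eta> H H'" and l0: "l > - 1" "l \<noteq> 0"
  defines "R \<equiv> sqrt (l\<^sup>2 + \<eta>\<^sup>2) / l"
  defines "S \<equiv> \<lambda>\<rho>. of_real (l / \<rho> + \<eta> / l)"
  defines "K \<equiv> \<lambda>\<rho>. (S \<rho> * H \<rho> + H' \<rho>) / of_real R"
  shows "outgoing (l - 1) \<eta> K (\<lambda>\<rho>. S \<rho> * K \<rho> - of_real R * H \<rho>)"
proof -
  have ode: "coulomb_ode l \<eta> H H'"
    and lH: "((\<lambda>\<rho>. H \<rho> * cis (- coulomb_theta l \<eta> \<rho>)) \<longlongrightarrow> 1) at_top"
    and lH': "((\<lambda>\<rho>. H' \<rho> * cis (- coulomb_theta l \<eta> \<rho>)) \<longlongrightarrow> \<i>) at_top"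
    using H by (auto simp: outgoing_def)
  have pos: "l\<^sup>2 + \<eta>\<^sup>2 > 0" using l0 by (simp add: add_pos_nonneg)
  have R0: "R \<noteq> 0" using pos l0 by (simp add: R_def)
  have R2: "R\<^sup>2 = 1 + \<eta>\<^sup>2 / l\<^sup>2"
    using pos l0 by (simp add: R_def power_divide field_simps)
  define z where "z = Complex l \<eta>"
  have z: "of_real l + \<i> * of_real \<eta> = z" by (simp add: z_def complex_eq_iff)
  have zn: "z \<notin> \<int>\<^sub>\<le>\<^sub>0"
  proof
    assume "z \<in> \<int>\<^sub>\<le>\<^sub>0"
    then obtain n where "z = - of_nat n" by (auto elim!: nonpos_Ints_cases')
    then have "l = - real n" by (simp add: z_def complex_eq_iff)
    with l0 show False by auto
  qed
  have norm_z: "norm z = sqrt (l\<^sup>2 + \<eta>\<^sup>2)" by (simp add: z_def cmod_def)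
  \<comment> \<open>The constant phase by which exp (- i \<theta>) changes when l is lowered:
    \<theta> gains \<pi>/2, and the change in the argument of Gamma contributes the phase of z = l +
    i \<eta>.\<close>
  define \<kappa> where "\<kappa> = - \<i> * sgn z"
  have shift: "cis (- coulomb_theta (l - 1) \<eta> \<rho>) = cis (- coulomb_theta l \<eta> \<rho>) * \<kappa>" for \<rho>
  proof -
    have e: "of_real (l - 1 + 1) + \<i> * of_real \<eta> = z" "of_real (l + 1) + \<i> * of_real \<eta> = z + 1"
      using z by (simp_all add: algebra_simps)
    have "- coulomb_theta (l - 1) \<eta> \<rho> =
        - coulomb_theta l \<eta> \<rho> + (- (pi / 2) + (Arg (Gamma (z + 1)) + - Arg (Gamma z)))"
      unfolding coulomb_theta_def e by (simp add: field_simps)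
    then have "cis (- coulomb_theta (l - 1) \<eta> \<rho>) = cis (- coulomb_theta l \<eta> \<rho>) *
        (cis (- (pi / 2)) * (cis (Arg (Gamma (z + 1))) * cis (- Arg (Gamma z))))"
      by (simp only: cis_mult)
    also have "cis (- (pi / 2)) = - \<i>" by (simp add: complex_eq_iff)
    also have "cis (Arg (Gamma (z + 1))) * cis (- Arg (Gamma z)) = sgn z"
      unfolding cis_Arg_Gamma_plus1[OF zn] by (simp add: mult.assoc cis_mult)
    finally show ?thesis by (simp add: \<kappa>_def)
  qed
  have lS: "(S \<longlongrightarrow> of_real (\<eta> / l)) at_top"
  proof -
    have "((\<lambda>\<rho>. l / \<rho> + \<eta> / l) \<longlongrightarrow> 0 + \<eta> / l) at_top"
      by (intro tendsto_add tendsto_const tendsto_divide_0[OF tendsto_const] filterlim_at_top_imp_at_infinity filterlim_ident)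
    then show ?thesis unfolding S_def using tendsto_of_real by fastforce
  qed
  \<comment> \<open>As \<eta> + i l = i * cnj z and R = |z| / l, the first factor is i * cnj z /
    |z|, whose phase \<kappa> undoes.\<close>
  have lim1: "(of_real (\<eta> / l) * 1 + \<i>) / of_real R * \<kappa> = 1"
  proof -
    have "of_real (\<eta> / l) + \<i> = \<i> * cnj z / of_real l"
      using l0 by (simp add: z_def complex_eq_iff field_simps)
    moreover have Rn: "of_real R = of_real (norm z) / (of_real l :: complex)" by (simp add: norm_z R_def)
    moreover have nz: "norm z \<noteq> 0" using pos norm_z by auto
    moreover have "cnj z * sgn z = of_real (norm z)"
    proof -
      have "sgn z * of_real (norm z) = z"
        using nz by (simp add: sgn_div_norm divide_inverse scaleR_conv_of_real)
      then have "cnj z * sgn z * of_real (norm z) = z * cnj z" by (simp add: mult_ac)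
      also have "\<dots> = of_real (norm z) * of_real (norm z)"
        by (simp add: power2_eq_square flip: complex_norm_square)
      finally have "cnj z * sgn z * of_real (norm z) = of_real (norm z) * of_real (norm z)" .
      then show ?thesis using nz by simp
    qed
    ultimately show ?thesis using l0 by (simp add: \<kappa>_def field_simps)
  qed
  have lim2: "of_real (\<eta> / l) * 1 - of_real R * (1 * \<kappa>) = \<i>"
  proof -
    have "of_real (norm z) * sgn z = z"
      by (cases "z = 0") (simp_all add: sgn_div_norm divide_inverse scaleR_conv_of_real)
    then have Rs: "of_real R * sgn z = z / of_real l" by (simp add: norm_z R_def)
    have "of_real (\<eta> / l) * 1 - of_real R * (1 * \<kappa>) = of_real (\<eta> / l) + \<i> * (z / of_real l)"
      unfolding Rs[symmetric] by (simp add: \<kappa>_def mult_ac)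
    also have "\<dots> = \<i>" using l0 by (simp add: z_def complex_eq_iff)
    finally show ?thesis .
  qed
  have lK: "((\<lambda>\<rho>. K \<rho> * cis (- coulomb_theta (l - 1) \<eta> \<rho>)) \<longlongrightarrow> 1) at_top"
  proof -
    have "((\<lambda>\<rho>. (S \<rho> * (H \<rho> * cis (- coulomb_theta l \<eta> \<rho>)) + H' \<rho> * cis (- coulomb_theta l \<eta> \<rho>)) / of_real R * \<kappa>)
       \<longlongrightarrow> (of_real (\<eta> / l) * 1 + \<i>) / of_real R * \<kappa>) at_top"
      using R0 by (intro tendsto_intros lS lH lH') auto
    then show ?thesis unfolding lim1 K_def shift by (simp add: algebra_simps add_divide_distrib)
  qed
  have lK': "((\<lambda>\<rho>. (S \<rho> * K \<rho> - of_real R * H \<rho>) * cis (- coulomb_theta (l - 1) \<eta> \<rho>)) \<longlongrightarrow> \<i>) at_top"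
  proof -
    have "((\<lambda>\<rho>. S \<rho> * (K \<rho> * cis (- coulomb_theta (l - 1) \<eta> \<rho>)) -
        of_real R * (H \<rho> * cis (- coulomb_theta l \<eta> \<rho>) * \<kappa>)) \<longlongrightarrow>
        of_real (\<eta> / l) * 1 - of_real R * (1 * \<kappa>)) at_top"
      by (intro tendsto_intros lS lH lK)
    then show ?thesis unfolding lim2 by (simp add: algebra_simps shift)
  qed
  have "coulomb_ode (l - 1) \<eta> K (\<lambda>\<rho>. S \<rho> * K \<rho> - of_real R * H \<rho>)"
    unfolding coulomb_ode_def
  proof safe
    fix \<rho> :: real assume r: "\<rho> > 0"
    note dH = coulomb_odeD[OF ode r]
    have dS: "(S has_vector_derivative of_real (- l / \<rho>\<^sup>2)) (at \<rho>)"
      unfolding S_def using r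
      by (intro has_vector_derivative_of_real) (auto intro!: derivative_eq_intros simp: power2_eq_square)
    have S2: "S \<rho> * S \<rho> = of_real (l\<^sup>2 / \<rho>\<^sup>2 + 2 * \<eta> / \<rho> + \<eta>\<^sup>2 / l\<^sup>2)"
      using r l0 unfolding S_def of_real_mult[symmetric] of_real_eq_iff by (simp add: field_simps power2_eq_square)
    have RR: "of_real R * of_real R = (of_real (1 + \<eta>\<^sup>2 / l\<^sup>2) :: complex)"
      unfolding R2[symmetric] by (simp add: power2_eq_square)
    have RK: "of_real R * K \<rho> = S \<rho> * H \<rho> + H' \<rho>" using R0 by (simp add: K_def)
    have up: "of_real (- (1 - 2 * \<eta> / \<rho> - l * (l + 1) / \<rho>\<^sup>2)) + of_real (- l / \<rho>\<^sup>2) =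
        S \<rho> * S \<rho> - of_real R * of_real R"
      unfolding S2 RR using r by (simp add: field_simps power2_eq_square)
    have down: "of_real (- (1 - 2 * \<eta> / \<rho> - (l - 1) * ((l - 1) + 1) / \<rho>\<^sup>2)) =
        of_real (- l / \<rho>\<^sup>2) + S \<rho> * S \<rho> - of_real R * of_real R"
      unfolding S2 RR using r by (simp add: field_simps power2_eq_square)
    define D where "D = S \<rho> * K \<rho> - of_real R * H \<rho>"
    have "((\<lambda>\<rho>. S \<rho> * H \<rho> + H' \<rho>) has_vector_derivative
        S \<rho> * H' \<rho> + of_real (- l / \<rho>\<^sup>2) * H \<rho> +
        of_real (- (1 - 2 * \<eta> / \<rho> - l * (l + 1) / \<rho>\<^sup>2)) * H \<rho>) (at \<rho>)"
      by (intro has_vector_derivative_add has_vector_derivative_mult dS dH)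
    also have "S \<rho> * H' \<rho> + of_real (- l / \<rho>\<^sup>2) * H \<rho> +
        of_real (- (1 - 2 * \<eta> / \<rho> - l * (l + 1) / \<rho>\<^sup>2)) * H \<rho> =
        S \<rho> * H' \<rho> + (S \<rho> * S \<rho> - of_real R * of_real R) * H \<rho>"
      unfolding up[symmetric] by (simp add: algebra_simps)
    also have "\<dots> = of_real R * D"
      unfolding D_def using RK by algebra
    finally have "((\<lambda>\<rho>. inverse (of_real R) * (S \<rho> * H \<rho> + H' \<rho>)) has_vector_derivative
        inverse (of_real R) * (of_real R * D)) (at \<rho>)"
      by (rule has_vector_derivative_mult_right)
    moreover have "K = (\<lambda>\<rho>. inverse (of_real R) * (S \<rho> * H \<rho> + H' \<rho>))"
      by (simp add: K_def fun_eq_iff divide_inverse mult.commute)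
    moreover have "inverse (of_real R) * (of_real R * D) = D" using R0 by simp
    ultimately have "(K has_vector_derivative D) (at \<rho>)" by (simp only:)
    then show dK: "(K has_vector_derivative S \<rho> * K \<rho> - of_real R * H \<rho>) (at \<rho>)"
      unfolding D_def .
    have "((\<lambda>\<rho>. S \<rho> * K \<rho> - of_real R * H \<rho>) has_vector_derivative
        S \<rho> * (S \<rho> * K \<rho> - of_real R * H \<rho>) + of_real (- l / \<rho>\<^sup>2) * K \<rho> - of_real R * H' \<rho>) (at \<rho>)"
      by (intro has_vector_derivative_diff has_vector_derivative_mult has_vector_derivative_mult_right dS dK dH)
    also have "S \<rho> * (S \<rho> * K \<rho> - of_real R * H \<rho>) + of_real (- l / \<rho>\<^sup>2) * K \<rho> - of_real R * H' \<rho> =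
      of_real (- (1 - 2 * \<eta> / \<rho> - (l - 1) * ((l - 1) + 1) / \<rho>\<^sup>2)) * K \<rho>"
      unfolding down using RK by algebra
    finally show "((\<lambda>\<rho>. S \<rho> * K \<rho> - of_real R * H \<rho>) has_vector_derivative
      of_real (- (1 - 2 * \<eta> / \<rho> - (l - 1) * ((l - 1) + 1) / \<rho>\<^sup>2)) * K \<rho>) (at \<rho>)" .
  qed
  with lK lK' show ?thesis by (simp add: outgoing_def)
qed

section \<open>Laplace integrals\<close>

text \<open>The modulus is |z|^(Re b) exp (- Im b * Im (Ln z)), and the imaginary part of the
  principal logarithm is at most \<pi> in absolute value.\<close>

lemma norm_powr_le:
  fixes z b :: complex
  assumes "z \<noteq> 0"
  shows "norm (z powr b) \<le> norm z powr Re b * exp (pi * \<bar>Im b\<bar>)"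
proof -
  have "norm (z powr b) = exp (Re b * ln (norm z) - Im b * Im (Ln z))"
    using assms by (simp add: powr_def)
  also have "\<dots> \<le> exp (Re b * ln (norm z) + pi * \<bar>Im b\<bar>)"
  proof -
    have "\<bar>Im b * Im (Ln z)\<bar> \<le> \<bar>Im b\<bar> * pi"
      unfolding abs_mult using mpi_less_Im_Ln[OF assms] Im_Ln_le_pi[OF assms] by (intro mult_left_mono) auto
    then show ?thesis by (simp add: mult.commute)
  qed
  also have "\<dots> = norm z powr Re b * exp (pi * \<bar>Im b\<bar>)" using assms by (simp add: powr_def exp_add)
  finally show ?thesis .
qed

lemma powr_le_exp:
  fixes m c :: real
  assumes "m \<ge> 0" "c > 0"
  obtains M where "M > 0" "\<And>s. s \<ge> 0 \<Longrightarrow> (1 + s) powr m \<le> M * exp (c * s)"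
proof -
  \<comment> \<open>With e \<le> 1 and m e \<le> c, the chain e (1 + s) \<le> 1 + e s \<le> exp (e
    s) can be raised to the power m.\<close>
  define e where "e = min 1 (c / (m + 1))"
  have e: "0 < e" "e \<le> 1" "m * e \<le> c"
  proof -
    show "0 < e" "e \<le> 1" using assms by (auto simp: e_def)
    have "m * e \<le> m * (c / (m + 1))" using assms by (intro mult_left_mono) (auto simp: e_def)
    also have "\<dots> \<le> c" using assms by (simp add: field_simps)
    finally show "m * e \<le> c" .
  qed
  show ?thesis
  proof
    show "(1 / e) powr m > 0" using e by simp
    fix s :: real assume s: "s \<ge> 0"
    have "e * (1 + s) \<le> 1 + e * s" using e by (simp add: algebra_simps)
    also have "\<dots> \<le> exp (e * s)" by simp
    finally have "1 + s \<le> 1 / e * exp (e * s)" using e by (simp add: field_simps)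
    then have "(1 + s) powr m \<le> (1 / e * exp (e * s)) powr m"
      using assms s by (intro powr_mono2) auto
    also have "\<dots> = (1 / e) powr m * exp (m * e * s)" using e
      by (subst powr_mult) (auto simp: powr_def mult_ac)
    also have "\<dots> \<le> (1 / e) powr m * exp (c * s)"
      using e s by (intro mult_left_mono) (auto intro!: mult_right_mono)
    finally show "(1 + s) powr m \<le> (1 / e) powr m * exp (c * s)" .
  qed
qed

text \<open>With \<open>a = L + i \<eta>\<close> and \<open>b = cnj a\<close>, the Laplace transform \<open>J\<close> of this weight gives the Coulomb
  function \<open>G + i F\<close> as a constant times \<open>e\<^sup>i\<^sup>\<rho> \<rho>\<^sup>L\<^sup>+\<^sup>1 J (2 \<rho>)\<close>.\<close>
definition laplace_weight :: "complex \<Rightarrow> complex \<Rightarrow> real \<Rightarrow> complex" where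
  "laplace_weight a b s = (if s > 0 then of_real s powr a * (1 + \<i> * of_real s) powr b else 0)"

lemma laplace_weight_measurable [measurable]: "laplace_weight a b \<in> borel_measurable borel"
proof -
  have "(\<lambda>s. of_real s powr a * (1 + \<i> * of_real s) powr b) \<in> borel_measurable (restrict_space borel {0<..})"
  proof (rule borel_measurable_continuous_on_restrict)
    show "continuous_on {0<..} (\<lambda>s. of_real s powr a * (1 + \<i> * of_real s) powr b)"
      by (intro continuous_intros) (auto simp: complex_nonpos_Reals_iff complex_eq_iff)
  qed
  then have "(\<lambda>s. indicator {0<..} s *\<^sub>R (of_real s powr a * (1 + \<i> * of_real s) powr b)) \<in> borel_measurable borel"
    by (subst (asm) borel_measurable_restrict_space_iff) auto
  also have "(\<lambda>s. indicator {0<..} s *\<^sub>R (of_real s powr a * (1 + \<i> * of_real s) powr b)) = laplace_weight a b"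
    by (auto simp: laplace_weight_def fun_eq_iff)
  finally show ?thesis .
qed

text \<open>Differentiating the Laplace transform brings down factors of s; absorbing them into a
  keeps the derivatives in the same family.\<close>

lemma laplace_weight_mult: "of_real s * laplace_weight a b s = laplace_weight (a + 1) b s"
  by (simp add: laplace_weight_def powr_add powr_to_1)

lemma norm_laplace_weight_le:
  assumes "s > 0" "Re b \<ge> 0"
  shows "norm (laplace_weight a b s) \<le> exp (pi * \<bar>Im b\<bar>) * (s powr Re a * (1 + s) powr Re b)"
proof -
  have nz: "1 + \<i> * of_real s \<noteq> 0" by (simp add: complex_eq_iff)
  have "norm (1 + \<i> * of_real s) \<le> 1 + s" using norm_triangle_ineq[of 1 "\<i> * of_real s"] assms by (simp add: norm_mult)
  then have "norm ((1 + \<i> * of_real s) powr b) \<le> (1 + s) powr Re b * exp (pi * \<bar>Im b\<bar>)"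
    using assms by (intro order_trans[OF norm_powr_le[OF nz]] mult_right_mono powr_mono2) auto
  moreover have "norm (of_real s powr a) = s powr Re a" using assms by (simp add: norm_powr_real_powr)
  ultimately show ?thesis using assms by (simp add: laplace_weight_def norm_mult mult_ac mult_left_mono)
qed

text \<open>Half of the exponential absorbs (1 + s)^q; with the other half the integrand is that of
  the Gamma integral at p + 1.\<close>

lemma integrable_powr_exp:
  fixes p q c :: real
  assumes "p > - 1" "q \<ge> 0" "c > 0"
  shows "integrable lborel (\<lambda>s. indicator {0<..} s * (s powr p * (1 + s) powr q * exp (- c * s)))"
proof -
  obtain M where M: "M > 0" "\<And>s. s \<ge> 0 \<Longrightarrow> (1 + s) powr q \<le> M * exp (c / 2 * s)"
    using powr_le_exp[of q "c / 2"] assms by auto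
  have "(\<lambda>t. complex_of_real t powr (of_real (p + 1) - 1) / of_real (exp (c / 2 * t))) absolutely_integrable_on {0<..}"
    using assms by (intro absolutely_integrable_Gamma_integral) auto
  then have "integrable lebesgue (\<lambda>t. indicator {0<..} t *\<^sub>R (complex_of_real t powr (of_real (p + 1) - 1) / of_real (exp (c / 2 * t))))"
    by (simp add: set_integrable_def)
  then have "integrable lebesgue (\<lambda>t. norm (indicator {0<..} t *\<^sub>R (complex_of_real t powr (of_real (p + 1) - 1) / of_real (exp (c / 2 * t)))))"
    by (rule integrable_norm)
  also have "(\<lambda>t. norm (indicator {0<..} t *\<^sub>R (complex_of_real t powr (of_real (p + 1) - 1) / of_real (exp (c / 2 * t))))) =
     (\<lambda>t. indicator {0<..} t * (t powr p * exp (- (c / 2) * t)))"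
  proof
    fix t
    show "norm (indicator {0<..} t *\<^sub>R (complex_of_real t powr (of_real (p + 1) - 1) / of_real (exp (c / 2 * t)))) =
       indicator {0<..} t * (t powr p * exp (- (c / 2) * t))"
      by (cases "t > 0") (simp_all add: norm_divide norm_powr_real_powr exp_minus field_simps)
  qed
  finally have "integrable lborel (\<lambda>t. indicator {0<..} t * (t powr p * exp (- (c / 2) * t)))"
    by (subst (asm) integrable_completion) auto
  then have "integrable lborel (\<lambda>t. M * (indicator {0<..} t * (t powr p * exp (- (c / 2) * t))))" by simp
  then show ?thesis
  proof (rule Bochner_Integration.integrable_bound)
    show "AE s in lborel. norm (indicator {0<..} s * (s powr p * (1 + s) powr q * exp (- c * s)))
      \<le> norm (M * (indicator {0<..} s * (s powr p * exp (- (c / 2) * s))))"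
    proof (rule AE_I2)
      fix s :: real
      have "(1 + s) powr q * exp (- c * s) \<le> M * exp (- (c / 2) * s)" if "s > 0"
      proof -
        have "(1 + s) powr q * exp (- c * s) \<le> M * exp (c / 2 * s) * exp (- c * s)"
          using M(2)[of s] that by (intro mult_right_mono) auto
        also have "\<dots> = M * exp (- (c / 2) * s)" by (simp flip: exp_add add: field_simps)
        finally show ?thesis .
      qed
      then show "norm (indicator {0<..} s * (s powr p * (1 + s) powr q * exp (- c * s)))
      \<le> norm (M * (indicator {0<..} s * (s powr p * exp (- (c / 2) * s))))"
        using M(1) by (cases "s > 0") (auto simp: abs_mult mult.assoc mult_left_mono mult.left_commute[of M])
    qed
  qed measurable
qed

lemma integrable_laplace_weight:
  assumes "Re a > - 1" "Re b \<ge> 0" "c > 0"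
  shows "integrable lborel (\<lambda>s. of_real (exp (- c * s)) * laplace_weight a b s)"
proof (rule Bochner_Integration.integrable_bound)
  show "integrable lborel (\<lambda>s. exp (pi * \<bar>Im b\<bar>) * (indicator {0<..} s * (s powr Re a * (1 + s) powr Re b * exp (- c * s))))"
    using integrable_powr_exp[OF assms] by simp
  show "AE s in lborel. norm (of_real (exp (- c * s)) * laplace_weight a b s) \<le>
    norm (exp (pi * \<bar>Im b\<bar>) * (indicator {0<..} s * (s powr Re a * (1 + s) powr Re b * exp (- c * s))))"
  proof (rule AE_I2)
    fix s
    show "norm (of_real (exp (- c * s)) * laplace_weight a b s) \<le>
       norm (exp (pi * \<bar>Im b\<bar>) * (indicator {0<..} s * (s powr Re a * (1 + s) powr Re b * exp (- c * s))))"
      using norm_laplace_weight_le[of s b a] assms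
      by (cases "s > 0") (auto simp: norm_mult abs_mult mult_ac laplace_weight_def[of _ _ s] intro: order_trans[OF mult_left_mono])
  qed
qed measurable

definition coulomb_laplace :: "complex \<Rightarrow> complex \<Rightarrow> real \<Rightarrow> complex" where
  "coulomb_laplace a b c = (\<integral>s. of_real (exp (- c * s)) * laplace_weight a b s \<partial>lborel)"

text \<open>Differentiation under the integral by an explicit remainder: with h = (y - c) s, the
  error exp (- h) - 1 + h is at most h^2 exp |h|, so the total error is quadratic in y - c.\<close>

lemma coulomb_laplace_has_vector_derivative:
  assumes ab: "Re a > - 1" "Re b \<ge> 0" and c: "c > 0"
  shows "(coulomb_laplace a b has_vector_derivative - coulomb_laplace (a + 1) b c) (at c)"
  unfolding has_vector_derivative_def
proof (rule has_derivativeI_sandwich)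
  show "c / 2 > 0" using c by simp
  show "bounded_linear (\<lambda>x. x *\<^sub>R - coulomb_laplace (a + 1) b c)" by (rule bounded_linear_scaleR_left)
  \<comment> \<open>The factor s^2 of the remainder raises a by 2, and |y - c| < c/2 costs at most
    half of the exponential decay.\<close>
  define C where "C = (\<integral>s. norm (of_real (exp (- (c / 2) * s)) * laplace_weight (a + 1 + 1) b s) \<partial>lborel)"
  have i2: "integrable lborel (\<lambda>s. norm (of_real (exp (- (c / 2) * s)) * laplace_weight (a + 1 + 1) b s))"
    using ab c by (intro integrable_norm integrable_laplace_weight) auto
  show "((\<lambda>y. C * norm (y - c)) \<longlongrightarrow> 0) (at c)"
    by (rule tendsto_eq_intros tendsto_norm_zero LIM_zero tendsto_ident_at refl | simp)+
  fix y assume y: "y \<noteq> c" "dist y c < c / 2"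
  then have y0: "y > 0" by (auto simp: dist_real_def abs_if split: if_splits)
  have eq: "coulomb_laplace a b y - coulomb_laplace a b c - (y - c) *\<^sub>R - coulomb_laplace (a + 1) b c =
     (\<integral>s. of_real (exp (- y * s)) * laplace_weight a b s - of_real (exp (- c * s)) * laplace_weight a b s +
        of_real (y - c) * (of_real (exp (- c * s)) * laplace_weight (a + 1) b s) \<partial>lborel)"
    using integrable_laplace_weight[OF ab y0] integrable_laplace_weight[OF ab c] integrable_laplace_weight[of "a + 1" b c] ab c
    by (simp add: coulomb_laplace_def scaleR_conv_of_real)
  have "norm (coulomb_laplace a b y - coulomb_laplace a b c - (y - c) *\<^sub>R - coulomb_laplace (a + 1) b c) \<le>
     (\<integral>s. (y - c)\<^sup>2 * norm (of_real (exp (- (c / 2) * s)) * laplace_weight (a + 1 + 1) b s) \<partial>lborel)"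
    unfolding eq
  proof (rule Bochner_Integration.integral_norm_bound_integral)
    show "integrable lborel (\<lambda>s. of_real (exp (- y * s)) * laplace_weight a b s - of_real (exp (- c * s)) * laplace_weight a b s +
        of_real (y - c) * (of_real (exp (- c * s)) * laplace_weight (a + 1) b s))"
      using ab c y0 by (intro Bochner_Integration.integrable_add Bochner_Integration.integrable_diff
          integrable_laplace_weight integrable_mult_right) auto
    show "integrable lborel (\<lambda>s. (y - c)\<^sup>2 * norm (of_real (exp (- (c / 2) * s)) * laplace_weight (a + 1 + 1) b s))"
      using i2 by simp
    fix s :: real
    show "norm (of_real (exp (- y * s)) * laplace_weight a b s - of_real (exp (- c * s)) * laplace_weight a b s +
        of_real (y - c) * (of_real (exp (- c * s)) * laplace_weight (a + 1) b s)) \<le>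
        (y - c)\<^sup>2 * norm (of_real (exp (- (c / 2) * s)) * laplace_weight (a + 1 + 1) b s)"
    proof (cases "s > 0")
      case True
      define h where "h = (y - c) * s"
      have "norm (exp (of_real (- h) :: complex) - (\<Sum>k\<le>1. of_real (- h) ^ k / fact k)) \<le>
          exp \<bar>Re (of_real (- h))\<bar> * norm (of_real (- h) :: complex) ^ Suc 1 / fact 1"
        by (rule Taylor_exp)
      also have "exp (of_real (- h) :: complex) - (\<Sum>k\<le>1. of_real (- h) ^ k / fact k) = of_real (exp (- h) - 1 + h)"
        by (simp add: exp_of_real[symmetric])
      finally have T: "\<bar>exp (- h) - 1 + h\<bar> \<le> exp \<bar>h\<bar> * h\<^sup>2"
        unfolding norm_of_real by (simp add: power2_eq_square)
      have "\<bar>h\<bar> \<le> c / 2 * s" using y True by (auto simp: h_def abs_mult dist_real_def)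
      then have "exp \<bar>h\<bar> \<le> exp (c / 2 * s)" by simp
      then have T2: "\<bar>exp (- h) - 1 + h\<bar> \<le> exp (c / 2 * s) * h\<^sup>2"
        using T mult_right_mono[of "exp \<bar>h\<bar>" "exp (c / 2 * s)" "h\<^sup>2"] by auto
      have "of_real (exp (- y * s)) * laplace_weight a b s - of_real (exp (- c * s)) * laplace_weight a b s +
        of_real (y - c) * (of_real (exp (- c * s)) * laplace_weight (a + 1) b s) =
        of_real (exp (- c * s) * (exp (- h) - 1 + h)) * laplace_weight a b s"
      proof -
        have "exp (- y * s) = exp (- c * s) * exp (- h)"
          by (simp add: h_def algebra_simps flip: exp_add)
        then show ?thesis unfolding laplace_weight_mult[symmetric] by (simp add: h_def algebra_simps)
      qed
      also have "norm \<dots> = exp (- c * s) * \<bar>exp (- h) - 1 + h\<bar> * norm (laplace_weight a b s)"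
        unfolding norm_mult norm_of_real abs_mult by simp
      also have "\<dots> \<le> exp (- c * s) * (exp (c / 2 * s) * h\<^sup>2) * norm (laplace_weight a b s)"
        using T2 by (intro mult_right_mono mult_left_mono) auto
      also have "\<dots> = (y - c)\<^sup>2 * norm (of_real (exp (- (c / 2) * s)) * laplace_weight (a + 1 + 1) b s)"
      proof -
        have "exp (- c * s) * exp (c / 2 * s) = exp (- (c / 2) * s)" by (simp flip: exp_add add: field_simps)
        then show ?thesis unfolding laplace_weight_mult[symmetric] norm_mult norm_of_real h_def
          by (simp add: power2_eq_square mult_ac)
      qed
      finally show ?thesis .
    qed (simp add: laplace_weight_def)
  qed
  then have "norm (coulomb_laplace a b y - coulomb_laplace a b c - (y - c) *\<^sub>R - coulomb_laplace (a + 1) b c) \<le> (norm (y - c))\<^sup>2 * C"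
    by (simp add: C_def)
  then show "norm (coulomb_laplace a b y - coulomb_laplace a b c - (y - c) *\<^sub>R - coulomb_laplace (a + 1) b c) / norm (y - c) \<le> C * norm (y - c)"
    using y by (simp add: divide_le_eq power2_eq_square mult_ac)
qed


section \<open>Limits of the Laplace integral at both ends, and its differential equation\<close>

lemma powr_of_real_exp:
  assumes "x > 0"
  shows "complex_of_real x powr a = exp (a * of_real (ln x))"
  using assms by (simp add: powr_def Ln_of_real)

text \<open>A positive factor leaves the argument unchanged, so no branch correction
  appears.\<close>

lemma powr_times_of_real:
  fixes z b :: complex
  assumes "x > 0" "z \<noteq> 0"
  shows "(of_real x * z) powr b = of_real x powr b * z powr b"
  using assms by (simp add: powr_def Ln_times_of_real Ln_of_real distrib_left exp_add)

text \<open>Carries Euler's integral over from the gauge integral to the Bochner integral on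
  \<open>lborel\<close> in which the Laplace integrals are written.\<close>

lemma Gamma_lborel_integral:
  assumes "Re z > 0"
  shows "(\<integral>t. (if t > 0 then of_real (exp (- t)) * of_real t powr (z - 1) else 0) \<partial>lborel) = Gamma z"
proof -
  have m: "(\<lambda>t. if t > 0 then of_real (exp (- t)) * of_real t powr (z - 1) else 0) =
     (\<lambda>t. indicator {0<..} t *\<^sub>R (complex_of_real t powr (z - 1) / of_real (exp t)))"
    by (auto simp: fun_eq_iff exp_minus divide_inverse mult.commute)
  have 1: "(\<lambda>t. complex_of_real t powr (z - 1) / of_real (exp t)) absolutely_integrable_on {0<..}"
    using assms by (rule absolutely_integrable_Gamma_integral')
  have "(\<lambda>t. if t > 0 then of_real (exp (- t)) * of_real t powr (z - 1) else 0) \<in> borel_measurable borel"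
  proof -
    have "(\<lambda>t. of_real (exp (- t)) * laplace_weight (z - 1) 0 t) \<in> borel_measurable borel" by measurable
    also have "(\<lambda>t. of_real (exp (- t)) * laplace_weight (z - 1) 0 t) =
        (\<lambda>t. if t > 0 then of_real (exp (- t)) * of_real t powr (z - 1) else 0)"
      by (auto simp: laplace_weight_def fun_eq_iff complex_eq_iff)
    finally show ?thesis .
  qed
  then have "(\<integral>t. (if t > 0 then of_real (exp (- t)) * of_real t powr (z - 1) else 0) \<partial>lborel) =
     (\<integral>t. (if t > 0 then of_real (exp (- t)) * of_real t powr (z - 1) else 0) \<partial>lebesgue)"
    by (subst integral_completion) auto
  also have "\<dots> = (LINT t:{0<..}|lebesgue. complex_of_real t powr (z - 1) / of_real (exp t))"
    unfolding m set_lebesgue_integral_def ..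
  also have "\<dots> = integral {0<..} (\<lambda>t. complex_of_real t powr (z - 1) / of_real (exp t))"
    using set_lebesgue_integral_eq_integral(2)[OF 1] .
  also have "\<dots> = Gamma z" using Gamma_integral_complex'[OF assms] by (rule integral_unique)
  finally show ?thesis .
qed

lemma coulomb_laplace_scale:
  assumes c: "c > 0"
  shows "of_real c powr (a + 1) * coulomb_laplace a b c =
    (\<integral>x. (if x > 0 then of_real (exp (- x)) * of_real x powr a * (1 + \<i> * of_real (x / c)) powr b else 0) \<partial>lborel)"
proof -
  let ?f = "\<lambda>s. of_real (exp (- c * s)) * laplace_weight a b s"
  have "coulomb_laplace a b c = of_real (1 / c) * (\<integral>x. ?f (0 + 1 / c * x) \<partial>lborel)"
    unfolding coulomb_laplace_def using lborel_integral_real_affine[of "1 / c" ?f 0] c by (simp add: scaleR_conv_of_real)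
  then have "of_real c powr (a + 1) * coulomb_laplace a b c =
     of_real c powr a * (\<integral>x. ?f (0 + 1 / c * x) \<partial>lborel)"
    using c by (simp add: powr_add powr_to_1)
  also have "\<dots> = (\<integral>x. of_real c powr a * ?f (0 + 1 / c * x) \<partial>lborel)"
    by (rule integral_mult_right_zero[symmetric])
  also have "\<dots> = (\<integral>x. (if x > 0 then of_real (exp (- x)) * of_real x powr a * (1 + \<i> * of_real (x / c)) powr b else 0) \<partial>lborel)"
  proof (rule Bochner_Integration.integral_cong[OF refl])
    fix x :: real
    show "of_real c powr a * ?f (0 + 1 / c * x) =
      (if x > 0 then of_real (exp (- x)) * of_real x powr a * (1 + \<i> * of_real (x / c)) powr b else 0)"
    proof (cases "x > 0")
      case True
      then have "of_real c powr a * of_real (1 / c * x) powr a = of_real x powr a"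
        using powr_times_of_real[of c "of_real (1 / c * x)" a] c by simp
      then show ?thesis using True c by (simp add: laplace_weight_def)
    qed (use c in \<open>simp add: laplace_weight_def zero_less_divide_iff\<close>)
  qed
  finally show ?thesis .
qed

text \<open>After the substitution x = c s the factor (1 + i x/c)^b tends to 1, which leaves Euler's
  integral.\<close>

lemma coulomb_laplace_at_top:
  assumes ab: "Re a > - 1" "Re b \<ge> 0"
  shows "((\<lambda>c. of_real c powr (a + 1) * coulomb_laplace a b c) \<longlongrightarrow> Gamma (a + 1)) at_top"
proof -
  let ?s = "\<lambda>c x. (if x > 0 then of_real (exp (- x)) * of_real x powr a * (1 + \<i> * of_real (x / c)) powr b else 0)"
  let ?g = "\<lambda>x. (if x > 0 then of_real (exp (- x)) * of_real x powr (a + 1 - 1) else 0 :: complex)"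
  let ?w = "\<lambda>x. exp (pi * \<bar>Im b\<bar>) * (indicator {0<..} x * (x powr Re a * (1 + x) powr Re b * exp (- 1 * x)))"
  have m: "(\<lambda>x. of_real (exp (- x)) * (indicator {0<..} x *\<^sub>R (of_real x powr a * (1 + \<i> * of_real (x / c)) powr b))) \<in> borel_measurable borel"
    if "c > 0" for c
  proof -
    have "(\<lambda>s. of_real s powr a * (1 + \<i> * of_real (s / c)) powr b) \<in> borel_measurable (restrict_space borel {0<..})"
    proof (rule borel_measurable_continuous_on_restrict)
      show "continuous_on {0<..} (\<lambda>s. of_real s powr a * (1 + \<i> * of_real (s / c)) powr b)"
        using that by (intro continuous_intros) (auto simp: complex_nonpos_Reals_iff complex_eq_iff)
    qed
    then have [measurable]: "(\<lambda>s. indicator {0<..} s *\<^sub>R (of_real s powr a * (1 + \<i> * of_real (s / c)) powr b)) \<in> borel_measurable borel"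
      by (subst (asm) borel_measurable_restrict_space_iff) auto
    show ?thesis by measurable
  qed
  have meq: "?s c = (\<lambda>x. of_real (exp (- x)) * (indicator {0<..} x *\<^sub>R (of_real x powr a * (1 + \<i> * of_real (x / c)) powr b)))" for c
    by (auto simp: fun_eq_iff)
  \<comment> \<open>Replacing c by \<open>max 1 c\<close> gives x / c \<le> x for every parameter,
    so that one dominating function serves.\<close>
  have "((\<lambda>c. integral\<^sup>L lborel (?s (max 1 c))) \<longlongrightarrow> integral\<^sup>L lborel ?g) at_top"
  proof (rule integral_dominated_convergence_at_top[where w = ?w])
    have "(\<lambda>x. of_real (exp (- x)) * laplace_weight a 0 x) \<in> borel_measurable borel" by measurable
    also have "(\<lambda>x. of_real (exp (- x)) * laplace_weight a 0 x) = ?g"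
      by (auto simp: laplace_weight_def fun_eq_iff complex_eq_iff)
    finally show "?g \<in> borel_measurable lborel" by simp
    show "?s (max 1 c) \<in> borel_measurable lborel" for c
      unfolding meq using m[of "max 1 c"] by simp
    show "integrable lborel ?w" using integrable_powr_exp[OF ab, of 1] by simp
    show "\<forall>\<^sub>F c in at_top. AE x in lborel. norm (?s (max 1 c) x) \<le> ?w x"
    proof (rule always_eventually, rule allI, rule AE_I2)
      fix c x :: real
      let ?c = "max 1 c"
      show "norm (?s ?c x) \<le> ?w x"
      proof (cases "x > 0")
        case True
        have nz: "1 + \<i> * of_real (x / ?c) \<noteq> 0" by (simp add: complex_eq_iff)
        have "norm (1 + \<i> * of_real (x / ?c)) \<le> 1 + x / ?c"
          using norm_triangle_ineq[of 1 "\<i> * of_real (x / ?c)"] True by (simp add: norm_mult norm_divide)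
        also have "\<dots> \<le> 1 + x" using True by (simp add: divide_le_eq)
        finally have "norm ((1 + \<i> * of_real (x / ?c)) powr b) \<le> (1 + x) powr Re b * exp (pi * \<bar>Im b\<bar>)"
          using ab by (intro order_trans[OF norm_powr_le[OF nz]] mult_right_mono powr_mono2) auto
        moreover have "norm (of_real x powr a) = x powr Re a" using True by (simp add: norm_powr_real_powr)
        ultimately have "norm (?s ?c x) \<le> exp (- x) * x powr Re a * ((1 + x) powr Re b * exp (pi * \<bar>Im b\<bar>))"
          using True by (auto simp: norm_mult intro!: mult_left_mono)
        also have "\<dots> = ?w x" using True by (simp add: mult_ac)
        finally show ?thesis .
      qed auto
    qed
    show "AE x in lborel. ((\<lambda>c. ?s (max 1 c) x) \<longlongrightarrow> ?g x) at_top"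
    proof (rule AE_I2)
      fix x :: real
      have "((\<lambda>c. 1 + \<i> * of_real (x / max 1 c)) \<longlongrightarrow> 1 + \<i> * of_real 0) at_top"
        by (intro tendsto_intros) real_asymp
      then have "((\<lambda>c. (1 + \<i> * of_real (x / max 1 c)) powr b) \<longlongrightarrow> 1 powr b) at_top"
        by (intro tendsto_powr_complex tendsto_const) auto
      then show "((\<lambda>c. ?s (max 1 c) x) \<longlongrightarrow> ?g x) at_top"
        using tendsto_mult[OF tendsto_const, of _ _ _ "of_real (exp (- x)) * of_real x powr a"] by fastforce
    qed
  qed
  then have "((\<lambda>c. integral\<^sup>L lborel (?s (max 1 c))) \<longlongrightarrow> Gamma (a + 1)) at_top"
    using ab by (subst (asm) Gamma_lborel_integral) auto
  moreover have "\<forall>\<^sub>F c in at_top. integral\<^sup>L lborel (?s (max 1 c)) = of_real c powr (a + 1) * coulomb_laplace a b c"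
    using eventually_ge_at_top[of 1]
  proof eventually_elim
    case (elim c)
    then have "max 1 c = c" "c > 0" by auto
    then show ?case by (simp only: coulomb_laplace_scale)
  qed
  ultimately show ?thesis by (rule Lim_transform_eventually)
qed

text \<open>The additional power c^b turns (1 + i x/c)^b into (c + i x)^b, whose limit is i^b x^b;
  the exponents of x then add up to a + b.\<close>

lemma coulomb_laplace_at_0:
  assumes ab: "Re a > - 1" "Re b \<ge> 0"
  shows "((\<lambda>c. of_real c powr (a + b + 1) * coulomb_laplace a b c) \<longlongrightarrow> \<i> powr b * Gamma (a + b + 1)) (at_right 0)"
proof -
  let ?s = "\<lambda>c x. (if x > 0 then of_real (exp (- x)) * of_real x powr a * (of_real c + \<i> * of_real x) powr b else 0)"
  let ?g = "\<lambda>x. \<i> powr b * (if x > 0 then of_real (exp (- x)) * of_real x powr (a + b + 1 - 1) else 0 :: complex)"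
  let ?w = "\<lambda>x. exp (pi * \<bar>Im b\<bar>) * (indicator {0<..} x * (x powr Re a * (1 + x) powr Re b * exp (- 1 * x)))"
  \<comment> \<open>The limit at 0 is taken along inverses of a parameter tending to infinity. The
    values stay in (0, 1], hence |c + i x| \<le> 1 + x.\<close>
  let ?c = "\<lambda>c. inverse (max 1 c)"
  have m: "(\<lambda>x. of_real (exp (- x)) * (indicator {0<..} x *\<^sub>R (of_real x powr a * (of_real c + \<i> * of_real x) powr b))) \<in> borel_measurable borel"
    if "c > 0" for c
  proof -
    have "(\<lambda>s. of_real s powr a * (of_real c + \<i> * of_real s) powr b) \<in> borel_measurable (restrict_space borel {0<..})"
    proof (rule borel_measurable_continuous_on_restrict)
      show "continuous_on {0<..} (\<lambda>s. of_real s powr a * (of_real c + \<i> * of_real s) powr b)"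
        using that by (intro continuous_intros) (auto simp: complex_nonpos_Reals_iff complex_eq_iff)
    qed
    then have [measurable]: "(\<lambda>s. indicator {0<..} s *\<^sub>R (of_real s powr a * (of_real c + \<i> * of_real s) powr b)) \<in> borel_measurable borel"
      by (subst (asm) borel_measurable_restrict_space_iff) auto
    show ?thesis by measurable
  qed
  have meq: "?s c = (\<lambda>x. of_real (exp (- x)) * (indicator {0<..} x *\<^sub>R (of_real x powr a * (of_real c + \<i> * of_real x) powr b)))" for c
    by (auto simp: fun_eq_iff)
  have "((\<lambda>c. integral\<^sup>L lborel (?s (?c c))) \<longlongrightarrow> integral\<^sup>L lborel ?g) at_top"
  proof (rule integral_dominated_convergence_at_top[where w = ?w])
    have "(\<lambda>x. \<i> powr b * (of_real (exp (- x)) * laplace_weight (a + b) 0 x)) \<in> borel_measurable borel" by measurable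
    also have "(\<lambda>x. \<i> powr b * (of_real (exp (- x)) * laplace_weight (a + b) 0 x)) = ?g"
      by (auto simp: laplace_weight_def fun_eq_iff complex_eq_iff)
    finally show "?g \<in> borel_measurable lborel" by simp
    show "?s (?c c) \<in> borel_measurable lborel" for c
      unfolding meq using m[of "?c c"] by simp
    show "integrable lborel ?w" using integrable_powr_exp[OF ab, of 1] by simp
    show "\<forall>\<^sub>F c in at_top. AE x in lborel. norm (?s (?c c) x) \<le> ?w x"
    proof (rule always_eventually, rule allI, rule AE_I2)
      fix c x :: real
      define d where "d = ?c c"
      have d: "0 < d" "d \<le> 1" by (auto simp: d_def inverse_le_1_iff)
      show "norm (?s (?c c) x) \<le> ?w x"
        unfolding d_def[symmetric]
      proof (cases "x > 0")
        case True
        have nz: "of_real d + \<i> * of_real x \<noteq> 0" using d by (simp add: complex_eq_iff)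
        have "norm (of_real d + \<i> * of_real x) \<le> d + x"
          using norm_triangle_ineq[of "of_real d" "\<i> * of_real x"] True d by (simp add: norm_mult)
        also have "\<dots> \<le> 1 + x" using d by simp
        finally have "norm ((of_real d + \<i> * of_real x) powr b) \<le> (1 + x) powr Re b * exp (pi * \<bar>Im b\<bar>)"
          using ab by (intro order_trans[OF norm_powr_le[OF nz]] mult_right_mono powr_mono2) auto
        moreover have "norm (of_real x powr a) = x powr Re a" using True by (simp add: norm_powr_real_powr)
        ultimately have "norm (?s d x) \<le> exp (- x) * x powr Re a * ((1 + x) powr Re b * exp (pi * \<bar>Im b\<bar>))"
          using True by (auto simp: norm_mult intro!: mult_left_mono)
        also have "\<dots> = ?w x" using True by (simp add: mult_ac)
        finally show "norm (?s d x) \<le> ?w x" .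
      qed auto
    qed
    show "AE x in lborel. ((\<lambda>c. ?s (?c c) x) \<longlongrightarrow> ?g x) at_top"
    proof (rule AE_I2)
      fix x :: real
      show "((\<lambda>c. ?s (?c c) x) \<longlongrightarrow> ?g x) at_top"
      proof (cases "x > 0")
        case True
        have "((\<lambda>c. of_real (?c c) + \<i> * of_real x) \<longlongrightarrow> of_real 0 + \<i> * of_real x) at_top"
          by (intro tendsto_intros) real_asymp
        then have "((\<lambda>c. (of_real (?c c) + \<i> * of_real x) powr b) \<longlongrightarrow> (of_real 0 + \<i> * of_real x) powr b) at_top"
          using True by (intro tendsto_powr_complex tendsto_const) (auto simp: complex_nonpos_Reals_iff)
        also have "(of_real 0 + \<i> * of_real x) powr b = \<i> powr b * of_real x powr b"
          using powr_times_of_real[of x \<i> b] True by (simp add: mult.commute)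
        finally have "((\<lambda>c. of_real (exp (- x)) * of_real x powr a * (of_real (?c c) + \<i> * of_real x) powr b) \<longlongrightarrow>
            of_real (exp (- x)) * of_real x powr a * (\<i> powr b * of_real x powr b)) at_top"
          by (intro tendsto_intros)
        then show ?thesis using True by (simp add: powr_add mult_ac)
      qed auto
    qed
  qed
  also have "integral\<^sup>L lborel ?g = \<i> powr b * Gamma (a + b + 1)"
    using ab Gamma_lborel_integral[of "a + b + 1"]
      integral_mult_right_zero[of lborel "\<i> powr b" "\<lambda>x. if x > 0 then of_real (exp (- x)) * of_real x powr (a + b + 1 - 1) else 0"]
    by simp
  finally have "((\<lambda>c. integral\<^sup>L lborel (?s (?c c))) \<longlongrightarrow> \<i> powr b * Gamma (a + b + 1)) at_top" .
  moreover have "\<forall>\<^sub>F c in at_top. integral\<^sup>L lborel (?s (?c c)) = of_real (inverse c) powr (a + b + 1) * coulomb_laplace a b (inverse c)"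
    using eventually_ge_at_top[of 1]
  proof eventually_elim
    case (elim t)
    define c where "c = inverse t"
    have c: "c > 0" "?c t = c" using elim by (auto simp: c_def)
    have "of_real c powr (a + b + 1) * coulomb_laplace a b c = of_real c powr b * (of_real c powr (a + 1) * coulomb_laplace a b c)"
      using c by (simp add: powr_add mult_ac)
    also have "\<dots> = of_real c powr b * (\<integral>x. (if x > 0 then of_real (exp (- x)) * of_real x powr a * (1 + \<i> * of_real (x / c)) powr b else 0) \<partial>lborel)"
      using c by (simp add: coulomb_laplace_scale)
    also have "\<dots> = (\<integral>x. of_real c powr b * (if x > 0 then of_real (exp (- x)) * of_real x powr a * (1 + \<i> * of_real (x / c)) powr b else 0) \<partial>lborel)"
      by (rule integral_mult_right_zero[symmetric])
    also have "\<dots> = integral\<^sup>L lborel (?s c)"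
    proof (rule Bochner_Integration.integral_cong[OF refl])
      fix x :: real
      have "1 + \<i> * of_real (x / c) \<noteq> 0" by (simp add: complex_eq_iff)
      then have "of_real c powr b * (1 + \<i> * of_real (x / c)) powr b = (of_real c * (1 + \<i> * of_real (x / c))) powr b"
        using powr_times_of_real[of c "1 + \<i> * of_real (x / c)" b] c by simp
      also have "of_real c * (1 + \<i> * of_real (x / c)) = of_real c + \<i> * of_real x"
        using c by (simp add: field_simps)
      finally show "of_real c powr b * (if x > 0 then of_real (exp (- x)) * of_real x powr a * (1 + \<i> * of_real (x / c)) powr b else 0) = ?s c x"
        by (auto simp: mult_ac)
    qed
    finally show ?case unfolding c(2) c_def[symmetric] by (rule sym)
  qed
  ultimately have "((\<lambda>c. of_real (inverse c) powr (a + b + 1) * coulomb_laplace a b (inverse c)) \<longlongrightarrow> \<i> powr b * Gamma (a + b + 1)) at_top"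
    by (rule Lim_transform_eventually)
  then show ?thesis unfolding filterlim_at_right_to_top .
qed

text \<open>The derivative of exp (- c s) s^(a+1) (1 + i s)^(b+1) integrates to 0 over the
  half-line. Since raising a amounts to - d/dc, the outcome is a second-order equation for the
  transform.\<close>

lemma coulomb_laplace_by_parts:
  assumes ab: "Re a > - 1" "Re b \<ge> 0" and c: "c > 0"
  shows "(a + 1) * coulomb_laplace a b c + \<i> * (a + b + 2) * coulomb_laplace (a + 1) b c
    = of_real c * (coulomb_laplace (a + 1) b c + \<i> * coulomb_laplace (a + 1 + 1) b c)"
proof -
  define F where "F s = of_real (exp (- c * s)) * (of_real s powr (a + 1) * (1 + \<i> * of_real s) powr (b + 1))" for s
  define f where "f s = of_real (exp (- c * s)) * (of_real s powr a * (1 + \<i> * of_real s) powr b) *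
     ((a + 1) * (1 + \<i> * of_real s) + \<i> * (b + 1) * of_real s - of_real c * of_real s * (1 + \<i> * of_real s))" for s
  let ?k = "\<lambda>s. (a + 1) * (of_real (exp (- c * s)) * laplace_weight a b s) +
       \<i> * (a + b + 2) * (of_real (exp (- c * s)) * laplace_weight (a + 1) b s) -
       of_real c * (of_real (exp (- c * s)) * laplace_weight (a + 1) b s + \<i> * (of_real (exp (- c * s)) * laplace_weight (a + 1 + 1) b s))"
  have i0: "integrable lborel (\<lambda>s. of_real (exp (- c * s)) * laplace_weight a b s)"
    and i1: "integrable lborel (\<lambda>s. of_real (exp (- c * s)) * laplace_weight (a + 1) b s)"
    and i2: "integrable lborel (\<lambda>s. of_real (exp (- c * s)) * laplace_weight (a + 1 + 1) b s)"
    using ab c integrable_laplace_weight[of a b c] integrable_laplace_weight[of "a + 1" b c] integrable_laplace_weight[of "a + 1 + 1" b c]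
    by simp_all
  have kf: "?k s = indicator (einterval 0 \<infinity>) s *\<^sub>R f s" for s
  proof (cases "s > 0")
    case True
    then have "einterval 0 \<infinity> = {0<..}" by (auto simp: einterval_def)
    then show ?thesis using True unfolding laplace_weight_mult[symmetric] f_def
      by (simp add: laplace_weight_def[of a b s]) (simp add: algebra_simps)
  qed (auto simp: laplace_weight_def einterval_def)
  have "(LBINT s=0..\<infinity>. f s) = 0 - 0"
  proof (rule interval_integral_FTC_integrable)
    show "(0::ereal) < \<infinity>" by simp
    have "(F has_vector_derivative f s) (at s)" if s: "s > 0" for s
    proof -
      have nz: "1 + \<i> * of_real s \<notin> \<real>\<^sub>\<le>\<^sub>0" by (auto simp: complex_nonpos_Reals_iff)
      have nz0: "1 + \<i> * of_real s \<noteq> 0" by (simp add: complex_eq_iff)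
      have "((\<lambda>z. exp (- of_real c * z) * (z powr (a + 1) * (1 + \<i> * z) powr (b + 1))) has_field_derivative
        exp (- of_real c * of_real s) * (of_real s powr a * (1 + \<i> * of_real s) powr b) *
     ((a + 1) * (1 + \<i> * of_real s) + \<i> * (b + 1) * of_real s - of_real c * of_real s * (1 + \<i> * of_real s))) (at (of_real s))"
        using s nz nz0
        by (auto intro!: derivative_eq_intros simp: powr_add powr_to_1 powr_diff complex_nonpos_Reals_iff)
           (simp add: field_simps)
      from has_vector_derivative_real_field[OF this] show ?thesis
        by (simp add: F_def[abs_def] f_def exp_of_real flip: of_real_mult of_real_minus)
    qed
    then show "\<And>x. 0 < ereal x \<Longrightarrow> ereal x < \<infinity> \<Longrightarrow> (F has_vector_derivative f x) (at x)" by simp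
    show "\<And>x. 0 < ereal x \<Longrightarrow> ereal x < \<infinity> \<Longrightarrow> isCont f x"
      unfolding f_def by (intro continuous_intros) (auto simp: complex_nonpos_Reals_iff complex_eq_iff)
    show "set_integrable lborel (einterval 0 \<infinity>) f"
      unfolding set_integrable_def kf[symmetric] using i0 i1 i2 by (intro Bochner_Integration.integrable_add Bochner_Integration.integrable_diff integrable_mult_right)
    have Fb: "norm (F s) \<le> exp (pi * \<bar>Im b\<bar>) * (s powr (Re a + 1) * (1 + s) powr (Re b + 1) * exp (- c * s))" if "s > 0" for s
    proof -
      have "norm (laplace_weight (a + 1) (b + 1) s) \<le> exp (pi * \<bar>Im (b + 1)\<bar>) * (s powr Re (a + 1) * (1 + s) powr Re (b + 1))"
        using that ab by (intro norm_laplace_weight_le) auto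
      then show ?thesis using that
        by (auto simp: F_def laplace_weight_def norm_mult mult_ac intro: order_trans[OF mult_left_mono])
    qed
    have "\<forall>\<^sub>F s in at_top. norm (F s) \<le> exp (pi * \<bar>Im b\<bar>) * (s powr (Re a + 1) * (1 + s) powr (Re b + 1) * exp (- c * s))"
      by (rule eventually_mono[OF eventually_gt_at_top[of 0]]) (rule Fb)
    moreover have "((\<lambda>s. exp (pi * \<bar>Im b\<bar>) * (s powr (Re a + 1) * (1 + s) powr (Re b + 1) * exp (- c * s))) \<longlongrightarrow> 0) at_top"
      using c ab by real_asymp
    ultimately have "(F \<longlongrightarrow> 0) at_top" by (rule Lim_null_comparison)
    then show "((F \<circ> real_of_ereal) \<longlongrightarrow> 0) (at_left \<infinity>)" by (simp add: ereal_tendsto_simps)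
    have "\<forall>\<^sub>F s in (at_right 0). norm (F s) \<le> exp (pi * \<bar>Im b\<bar>) * (s powr (Re a + 1) * (1 + s) powr (Re b + 1) * exp (- c * s))"
      by (rule eventually_mono[OF eventually_at_right_less[of 0]]) (rule Fb)
    moreover have "((\<lambda>s. exp (pi * \<bar>Im b\<bar>) * (s powr (Re a + 1) * (1 + s) powr (Re b + 1) * exp (- c * s))) \<longlongrightarrow> 0) (at_right 0)"
      using c ab by real_asymp
    ultimately have "(F \<longlongrightarrow> 0) (at_right 0)" by (rule Lim_null_comparison)
    then show "((F \<circ> real_of_ereal) \<longlongrightarrow> 0) (at_right 0)" by (simp add: ereal_tendsto_simps zero_ereal_def)
  qed
  then have "(\<integral>s. ?k s \<partial>lborel) = 0"
    unfolding kf by (simp add: interval_lebesgue_integral_def set_lebesgue_integral_def)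
  moreover have "(\<integral>s. ?k s \<partial>lborel) = (a + 1) * coulomb_laplace a b c + \<i> * (a + b + 2) * coulomb_laplace (a + 1) b c
    - of_real c * (coulomb_laplace (a + 1) b c + \<i> * coulomb_laplace (a + 1 + 1) b c)"
    using i0 i1 i2 by (simp add: coulomb_laplace_def)
  ultimately show ?thesis by simp
qed

section \<open>The confluent hypergeometric function\<close>

definition hyp1F1_fps :: "complex \<Rightarrow> complex \<Rightarrow> complex fps" where
  "hyp1F1_fps a b = Abs_fps (\<lambda>k. pochhammer a k / (pochhammer b k * fact k))"

lemma eval_hyp1F1_fps: "eval_fps (hyp1F1_fps a b) z = hyp1F1 a b z"
  by (simp add: eval_fps_def hyp1F1_def hyp1F1_fps_def field_simps)

lemma add_of_nat_neq_0_nonpos_Ints: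
  assumes "(b::complex) \<notin> \<int>\<^sub>\<le>\<^sub>0"
  shows "b + of_nat n \<noteq> 0"
proof
  assume "b + of_nat n = 0"
  then have "b = - of_nat n" by (simp add: eq_neg_iff_add_eq_0)
  with assms show False by auto
qed

lemma hyp1F1_fps_rec:
  assumes "b \<notin> \<int>\<^sub>\<le>\<^sub>0"
  shows "of_nat (Suc n) * (b + of_nat n) * fps_nth (hyp1F1_fps a b) (Suc n) =
    (a + of_nat n) * fps_nth (hyp1F1_fps a b) n"
proof -
  have "pochhammer b n \<noteq> 0" "b + of_nat n \<noteq> 0"
    using assms by (auto simp: pochhammer_eq_0_iff dest: add_of_nat_neq_0_nonpos_Ints)
  then show ?thesis
    by (simp add: hyp1F1_fps_def pochhammer_Suc divide_simps del: of_nat_Suc)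
qed

lemma hyp1F1_fps_conv_radius:
  assumes b: "b \<notin> \<int>\<^sub>\<le>\<^sub>0"
  shows "fps_conv_radius (hyp1F1_fps a b) = \<infinity>"
proof -
  have "conv_radius (fps_nth (hyp1F1_fps a b)) \<ge> \<infinity>"
  proof (rule conv_radius_geI_ex)
    fix r :: real assume r: "0 < r"
    let ?f = "fps_nth (hyp1F1_fps a b)"
    \<comment> \<open>Beyond N one has |a + n| \<le> 2n and |b + n| \<ge> n/2, so consecutive terms
      have ratio at most 4r / (n + 1), and 8r \<le> n + 1 makes this at most 1/2.\<close>
    obtain N :: nat where N: "2 * norm b + norm a + 8 * r + 1 \<le> real N" using real_arch_simple by blast
    have "summable (\<lambda>n. ?f n * of_real r ^ n)"
    proof (rule summable_ratio_test[of "1 / 2" N])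
      fix n assume n: "n \<ge> N"
      have n1: "2 * norm b + norm a + 8 * r + 1 \<le> real n" using N n by linarith
      then have n2: "norm b \<le> real n / 2" "norm a \<le> real n" "8 * r \<le> real (Suc n)" "real n > 0"
        using r norm_ge_zero[of a] norm_ge_zero[of b] by linarith+
      have "norm (b + of_nat n) \<ge> real n - norm b"
        using norm_diff_ineq[of "of_nat n :: complex" b] by (simp add: add.commute)
      then have bn: "norm (b + of_nat n) \<ge> real n / 2" using n2 by linarith
      have an: "norm (a + of_nat n) \<le> 2 * real n" using norm_triangle_ineq[of a "of_nat n"] n2 by simp
      have "real (Suc n) * norm (b + of_nat n) * norm (?f (Suc n)) = norm (a + of_nat n) * norm (?f n)"
        using arg_cong[OF hyp1F1_fps_rec[OF b, of n a], of norm] by (simp add: norm_mult del: of_nat_Suc)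
      also have "\<dots> \<le> 2 * real n * norm (?f n)" using an by (intro mult_right_mono) auto
      finally have "real (Suc n) * norm (b + of_nat n) * norm (?f (Suc n)) \<le> 2 * real n * norm (?f n)" .
      moreover have "real (Suc n) * (real n / 2) * norm (?f (Suc n)) \<le> real (Suc n) * norm (b + of_nat n) * norm (?f (Suc n))"
        using bn by (intro mult_right_mono mult_left_mono) auto
      moreover have "real (Suc n) * (real n / 2) * norm (?f (Suc n)) = real n * (real (Suc n) * norm (?f (Suc n))) / 2"
        by simp
      ultimately have "real n * (real (Suc n) * norm (?f (Suc n))) \<le> real n * (4 * norm (?f n))" by linarith
      then have 1: "real (Suc n) * norm (?f (Suc n)) \<le> 4 * norm (?f n)" using n2 by (simp del: of_nat_Suc)
      have "8 * r * norm (?f (Suc n)) \<le> real (Suc n) * norm (?f (Suc n))"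
        using n2 by (intro mult_right_mono) auto
      with 1 have "r * norm (?f (Suc n)) \<le> 1 / 2 * norm (?f n)" by simp
      then have "r ^ n * (r * norm (?f (Suc n))) \<le> r ^ n * (1 / 2 * norm (?f n))" using r by (intro mult_left_mono) auto
      then show "norm (?f (Suc n) * of_real r ^ Suc n) \<le> 1 / 2 * norm (?f n * of_real r ^ n)"
        using r by (simp add: norm_mult norm_power mult_ac)
    qed simp
    then show "\<exists>z. norm z = r \<and> summable (\<lambda>n. ?f n * z ^ n)"
      using r by (intro exI[of _ "of_real r"]) auto
  qed
  then show ?thesis by (simp add: fps_conv_radius_def)
qed

definition hyp1F1' :: "complex \<Rightarrow> complex \<Rightarrow> complex \<Rightarrow> complex" where
  "hyp1F1' a b z = eval_fps (fps_deriv (hyp1F1_fps a b)) z"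

definition hyp1F1'' :: "complex \<Rightarrow> complex \<Rightarrow> complex \<Rightarrow> complex" where
  "hyp1F1'' a b z = eval_fps (fps_deriv (fps_deriv (hyp1F1_fps a b))) z"

lemma fps_deriv_entire: "fps_conv_radius (f :: complex fps) = \<infinity> \<Longrightarrow> fps_conv_radius (fps_deriv f) = \<infinity>"
  using fps_conv_radius_deriv[of f] by simp

lemma fps_mult_entire:
  "fps_conv_radius (f :: complex fps) = \<infinity> \<Longrightarrow> fps_conv_radius g = \<infinity> \<Longrightarrow> fps_conv_radius (f * g) = \<infinity>"
  using fps_conv_radius_mult[of f g] by simp

lemma fps_add_entire:
  "fps_conv_radius (f :: complex fps) = \<infinity> \<Longrightarrow> fps_conv_radius g = \<infinity> \<Longrightarrow> fps_conv_radius (f + g) = \<infinity>"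
  using fps_conv_radius_add[of f g] by simp

lemma fps_diff_entire:
  "fps_conv_radius (f :: complex fps) = \<infinity> \<Longrightarrow> fps_conv_radius g = \<infinity> \<Longrightarrow> fps_conv_radius (f - g) = \<infinity>"
  using fps_conv_radius_diff[of f g] by simp

lemmas fps_entire = fps_deriv_entire fps_mult_entire fps_add_entire fps_diff_entire

lemma hyp1F1_derivs:
  assumes "b \<notin> \<int>\<^sub>\<le>\<^sub>0"
  shows "(hyp1F1 a b has_field_derivative hyp1F1' a b z) (at z)"
    and "(hyp1F1' a b has_field_derivative hyp1F1'' a b z) (at z)"
proof -
  note r = hyp1F1_fps_conv_radius[OF assms, of a]
  have "(eval_fps (hyp1F1_fps a b) has_field_derivative hyp1F1' a b z) (at z)"
    unfolding hyp1F1'_def by (rule has_field_derivative_eval_fps) (simp add: r)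
  then show "(hyp1F1 a b has_field_derivative hyp1F1' a b z) (at z)"
    by (simp add: eval_hyp1F1_fps[abs_def])
  have "(eval_fps (fps_deriv (hyp1F1_fps a b)) has_field_derivative hyp1F1'' a b z) (at z)"
    unfolding hyp1F1''_def by (rule has_field_derivative_eval_fps) (simp add: r fps_entire)
  then show "(hyp1F1' a b has_field_derivative hyp1F1'' a b z) (at z)"
    by (simp add: hyp1F1'_def[abs_def])
qed

lemma hyp1F1_0: "hyp1F1 a b 0 = 1"
  unfolding eval_hyp1F1_fps[symmetric] by (simp add: eval_fps_at_0 hyp1F1_fps_def)

text \<open>Kummer's equation; on coefficients it is the recursion
  \<open>hyp1F1_fps_rec\<close>.\<close>

lemma hyp1F1_ode:
  assumes b: "b \<notin> \<int>\<^sub>\<le>\<^sub>0"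
  shows "z * hyp1F1'' a b z + (b - z) * hyp1F1' a b z - a * hyp1F1 a b z = 0"
proof -
  let ?F = "hyp1F1_fps a b"
  have "fps_X * fps_deriv (fps_deriv ?F) + (fps_const b - fps_X) * fps_deriv ?F - fps_const a * ?F = 0"
  proof (rule fps_ext)
    fix n
    show "fps_nth (fps_X * fps_deriv (fps_deriv ?F) + (fps_const b - fps_X) * fps_deriv ?F - fps_const a * ?F) n = fps_nth 0 n"
      using hyp1F1_fps_rec[OF b, of n a] by (cases n) (simp_all add: algebra_simps)
  qed
  then have "eval_fps (fps_X * fps_deriv (fps_deriv ?F) + (fps_const b - fps_X) * fps_deriv ?F - fps_const a * ?F) z = 0"
    by simp
  then show ?thesis
    using hyp1F1_fps_conv_radius[OF b, of a]
    by (simp add: eval_fps_diff eval_fps_add eval_fps_mult fps_entire hyp1F1'_def hyp1F1''_def eval_hyp1F1_fps)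
qed

text \<open>For a = L + 1 - i \<eta> and b = 2L + 2, lowering L by 1 means passing to a - 1 and b -
  2. The relation is the lowering operator seen on the confluent series.\<close>

lemma hyp1F1_contiguous:
  assumes b: "b - 2 \<notin> \<int>\<^sub>\<le>\<^sub>0"
  shows "(b - 1) * hyp1F1 a b z - (b - a - 1) / (b - 2) * (z * hyp1F1 a b z) + z * hyp1F1' a b z
    = (b - 1) * hyp1F1 (a - 1) (b - 2) z"
proof -
  have b1: "b - 1 \<notin> \<int>\<^sub>\<le>\<^sub>0" using plus_one_in_nonpos_Ints_imp[of "b - 2"] b by auto
  have b0: "b \<notin> \<int>\<^sub>\<le>\<^sub>0" using plus_one_in_nonpos_Ints_imp[of "b - 1"] b1 by auto
  let ?F = "hyp1F1_fps a b" and ?M = "hyp1F1_fps (a - 1) (b - 2)"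
  have nz: "b - 2 \<noteq> 0" "b - 1 \<noteq> 0" "b \<noteq> 0" using b b1 b0 by auto
  have "fps_const (b - 1) * ?F - fps_const ((b - a - 1) / (b - 2)) * (fps_X * ?F) + fps_X * fps_deriv ?F
     = fps_const (b - 1) * ?M"
  proof (rule fps_ext)
    fix n
    show "fps_nth (fps_const (b - 1) * ?F - fps_const ((b - a - 1) / (b - 2)) * (fps_X * ?F) + fps_X * fps_deriv ?F) n
     = fps_nth (fps_const (b - 1) * ?M) n"
    proof (cases n)
      case 0
      then show ?thesis by (simp add: hyp1F1_fps_def)
    next
      case (Suc k)
      have p: "pochhammer b k \<noteq> 0" using b0
        by (auto simp: pochhammer_eq_0_iff)
      have bk: "b + of_nat k \<noteq> 0" "b + of_nat k - 1 \<noteq> 0"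
        using add_of_nat_neq_0_nonpos_Ints[OF b0, of k] add_of_nat_neq_0_nonpos_Ints[OF b1, of k]
        by (simp_all add: algebra_simps)
      have pk: "b * pochhammer b k + of_nat k * pochhammer b k \<noteq> 0"
        using p bk by (simp flip: distrib_right)
      \<comment> \<open>Both shifted Pochhammer symbols are expressed through
        \<open>pochhammer a k\<close> and \<open>pochhammer b k\<close>, which reduces the
        comparison of coefficients to a rational identity.\<close>
      have pa: "pochhammer (a - 1) (Suc k) = (a - 1) * pochhammer a k"
        by (subst pochhammer_rec) simp
      have "pochhammer (b - 2) (Suc (Suc k)) = (b - 2) * ((b - 1) * pochhammer b k)"
        by (subst pochhammer_rec, subst pochhammer_rec) simp
      then have pb: "pochhammer (b - 2) (Suc k) * (b + of_nat k - 1) = (b - 2) * ((b - 1) * pochhammer b k)"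
        by (subst (asm) pochhammer_Suc) (simp add: algebra_simps)
      then have pb': "pochhammer (b - 2) (Suc k) = (b - 2) * ((b - 1) * pochhammer b k) / (b + of_nat k - 1)"
        using bk by (simp add: field_simps)
      show ?thesis
        unfolding Suc using nz p bk
        by (simp add: hyp1F1_fps_def pa pb' divide_simps del: pochhammer_Suc of_nat_Suc)
           (use pk in \<open>simp add: pochhammer_Suc algebra_simps\<close>)
    qed
  qed
  then have "eval_fps (fps_const (b - 1) * ?F - fps_const ((b - a - 1) / (b - 2)) * (fps_X * ?F) + fps_X * fps_deriv ?F) z
     = eval_fps (fps_const (b - 1) * ?M) z" by simp
  then show ?thesis
    using hyp1F1_fps_conv_radius[OF b0, of a] hyp1F1_fps_conv_radius[OF b, of "a - 1"]
    by (simp add: eval_fps_diff eval_fps_add eval_fps_mult fps_entire hyp1F1'_def eval_hyp1F1_fps)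
qed

section \<open>Coulomb wave functions\<close>

text \<open>Applied with \<open>k = i\<close> to the Laplace integral and with \<open>k = - i\<close> to the confluent hypergeometric
  function.\<close>
lemma coulomb_ode_gauge:
  fixes k :: complex
  assumes k: "k * k = - 1"
    and g: "\<And>\<rho>. \<rho> > 0 \<Longrightarrow> (g has_vector_derivative g' \<rho>) (at \<rho>)"
    and g': "\<And>\<rho>. \<rho> > 0 \<Longrightarrow> (g' has_vector_derivative g'' \<rho>) (at \<rho>)"
    and eq: "\<And>\<rho>. \<rho> > 0 \<Longrightarrow> of_real \<rho> * g'' \<rho> + (2 * k * of_real \<rho> + of_real (2 * L + 2)) * g' \<rho>
        + (2 * k * of_real (L + 1) - of_real (2 * \<eta>)) * g \<rho> = 0"
  defines "E \<equiv> \<lambda>\<rho>::real. exp (k * of_real \<rho>) * of_real (\<rho> powr (L + 1))"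
  shows "coulomb_ode L \<eta> (\<lambda>\<rho>. c * (E \<rho> * g \<rho>)) (\<lambda>\<rho>. c * (E \<rho> * ((k + of_real ((L + 1) / \<rho>)) * g \<rho> + g' \<rho>)))"
  unfolding coulomb_ode_def
proof (intro allI impI conjI)
  fix \<rho> :: real assume r: "\<rho> > 0"
  let ?k = "\<lambda>\<rho>. k + of_real ((L + 1) / \<rho>)"
  have dE: "(E has_vector_derivative E \<rho> * ?k \<rho>) (at \<rho>)"
  proof -
    have "((\<lambda>\<rho>. exp (k * of_real \<rho>)) has_vector_derivative k * exp (k * of_real \<rho>)) (at \<rho>)"
      by (rule has_vector_derivative_real_field) (auto intro!: derivative_eq_intros)
    moreover have "((\<lambda>\<rho>. of_real (\<rho> powr (L + 1))) has_vector_derivative (of_real ((L + 1) / \<rho> * \<rho> powr (L + 1)) :: complex)) (at \<rho>)"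
    proof (rule has_vector_derivative_of_real)
      have "\<rho> powr (L + 1) = \<rho> * \<rho> powr (L + 1 - 1)" using r by (simp add: powr_add)
      then show "((\<lambda>\<rho>. \<rho> powr (L + 1)) has_real_derivative (L + 1) / \<rho> * \<rho> powr (L + 1)) (at \<rho>)"
        using has_real_derivative_powr[OF r, of "L + 1"] r by simp
    qed
    ultimately show ?thesis unfolding E_def
      by (rule has_vector_derivative_eq_rhs[OF has_vector_derivative_mult]) (simp add: algebra_simps)
  qed
  have dk: "(?k has_vector_derivative of_real (- (L + 1) / \<rho>\<^sup>2)) (at \<rho>)"
  proof -
    have "((\<lambda>\<rho>. of_real ((L + 1) / \<rho>)) has_vector_derivative (of_real (- (L + 1) / \<rho>\<^sup>2) :: complex)) (at \<rho>)"
      using r by (intro has_vector_derivative_of_real) (auto intro!: derivative_eq_intros simp: power2_eq_square)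
    from has_vector_derivative_add[OF has_vector_derivative_const this] show ?thesis by simp
  qed
  have "((\<lambda>\<rho>. E \<rho> * g \<rho>) has_vector_derivative E \<rho> * g' \<rho> + E \<rho> * ?k \<rho> * g \<rho>) (at \<rho>)"
    by (rule has_vector_derivative_mult[OF dE g[OF r]])
  from has_vector_derivative_mult_right[OF this, of c]
  show "((\<lambda>\<rho>. c * (E \<rho> * g \<rho>)) has_vector_derivative c * (E \<rho> * (?k \<rho> * g \<rho> + g' \<rho>))) (at \<rho>)"
    by (simp add: algebra_simps)
  have gg: "g'' \<rho> = - ((2 * k * of_real \<rho> + of_real (2 * L + 2)) * g' \<rho>
      + (2 * k * of_real (L + 1) - of_real (2 * \<eta>)) * g \<rho>) / of_real \<rho>"
    using eq[OF r] r by (simp add: eq_divide_eq mult.commute) (simp add: add_eq_0_iff2 algebra_simps)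
  have "((\<lambda>\<rho>. E \<rho> * (?k \<rho> * g \<rho> + g' \<rho>)) has_vector_derivative
      E \<rho> * ((?k \<rho> * g' \<rho> + of_real (- (L + 1) / \<rho>\<^sup>2) * g \<rho>) + g'' \<rho>) +
      E \<rho> * ?k \<rho> * (?k \<rho> * g \<rho> + g' \<rho>)) (at \<rho>)"
    by (intro has_vector_derivative_mult has_vector_derivative_add dE dk g[OF r] g'[OF r])
  also have "E \<rho> * ((?k \<rho> * g' \<rho> + of_real (- (L + 1) / \<rho>\<^sup>2) * g \<rho>) + g'' \<rho>) +
      E \<rho> * ?k \<rho> * (?k \<rho> * g \<rho> + g' \<rho>) =
      E \<rho> * (2 * ?k \<rho> * g' \<rho> + (?k \<rho> * ?k \<rho> + of_real (- (L + 1) / \<rho>\<^sup>2)) * g \<rho> + g'' \<rho>)"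
    by (simp add: algebra_simps)
  \<comment> \<open>Inserting g'' cancels the terms in g', and (L + 1)^2 - (L + 1) = L (L + 1)
    produces the centrifugal term.\<close>
  also have "2 * ?k \<rho> * g' \<rho> + (?k \<rho> * ?k \<rho> + of_real (- (L + 1) / \<rho>\<^sup>2)) * g \<rho> + g'' \<rho> =
      (k * k + of_real (2 * \<eta> / \<rho> + L * (L + 1) / \<rho>\<^sup>2)) * g \<rho>"
    unfolding gg using r by (simp add: field_simps power2_eq_square)
  also have "k * k + of_real (2 * \<eta> / \<rho> + L * (L + 1) / \<rho>\<^sup>2) =
      of_real (- (1 - 2 * \<eta> / \<rho> - L * (L + 1) / \<rho>\<^sup>2))"
    unfolding k by simp
  finally have "((\<lambda>\<rho>. E \<rho> * (?k \<rho> * g \<rho> + g' \<rho>)) has_vector_derivative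
     E \<rho> * (of_real (- (1 - 2 * \<eta> / \<rho> - L * (L + 1) / \<rho>\<^sup>2)) * g \<rho>)) (at \<rho>)" .
  from has_vector_derivative_mult_right[OF this, of c]
  show "((\<lambda>\<rho>. c * (E \<rho> * (?k \<rho> * g \<rho> + g' \<rho>))) has_vector_derivative
      of_real (- (1 - 2 * \<eta> / \<rho> - L * (L + 1) / \<rho>\<^sup>2)) * (c * (E \<rho> * g \<rho>))) (at \<rho>)"
    by (simp only: mult_ac)
qed

text \<open>From 2L + 2 > - 1 the only candidate is 0, which would mean L = - 1.\<close>

lemma two_L_plus_2_notin_nonpos_Ints:
  assumes "L > - 3 / 2" "L \<noteq> - 1"
  shows "(of_real (2 * L + 2) :: complex) \<notin> \<int>\<^sub>\<le>\<^sub>0"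
proof
  assume "(of_real (2 * L + 2) :: complex) \<in> \<int>\<^sub>\<le>\<^sub>0"
  then obtain n where "(of_real (2 * L + 2) :: complex) = - of_nat n" by (auto elim!: nonpos_Ints_cases')
  then have "complex_of_real (2 * L + 2) = complex_of_real (- real n)" by simp
  then have "2 * L + 2 = - real n" unfolding of_real_eq_iff .
  with assms show False by (cases n) auto
qed

section \<open>The regular function F and its lowering relation\<close>

lemma coulomb_F_holomorphic:
  assumes "L > - 3 / 2" "\<eta> \<noteq> 0 \<Longrightarrow> L \<noteq> - 1"
  shows "coulomb_F L \<eta> holomorphic_on UNIV"
proof (cases "L = - 1")
  case True
  then have "\<eta> = 0" using assms by blast
  with True have "coulomb_F L \<eta> = (\<lambda>t. cos (exp t))" by (simp add: coulomb_F_def fun_eq_iff)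
  then show ?thesis by (auto intro!: holomorphic_intros)
next
  case False
  define a where "a = of_real (L + 1) - \<i> * of_real \<eta>"
  define b where "b = (of_real (2 * L + 2) :: complex)"
  have h: "hyp1F1 a b holomorphic_on UNIV"
    using hyp1F1_derivs(1)[of b a] two_L_plus_2_notin_nonpos_Ints[of L] assms False
    by (auto simp: holomorphic_on_open b_def)
  have "(hyp1F1 a b \<circ> (\<lambda>t. 2 * \<i> * exp t)) holomorphic_on UNIV"
    by (rule holomorphic_on_compose_gen[OF _ h]) (auto intro!: holomorphic_intros)
  then have "(\<lambda>t. hyp1F1 a b (2 * \<i> * exp t)) holomorphic_on UNIV" by (simp add: o_def)
  then have "(\<lambda>t. of_real (coulomb_C L \<eta>) * exp (of_real (L + 1) * t) *
      (exp (- \<i> * exp t) * hyp1F1 a b (2 * \<i> * exp t))) holomorphic_on UNIV"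
    by (intro holomorphic_intros)
  also have "(\<lambda>t. of_real (coulomb_C L \<eta>) * exp (of_real (L + 1) * t) *
      (exp (- \<i> * exp t) * hyp1F1 a b (2 * \<i> * exp t))) = coulomb_F L \<eta>"
    using False by (simp add: coulomb_F_def fun_eq_iff coulomb_phi_def a_def b_def)
  finally show ?thesis .
qed

definition coulomb_F_pos :: "real \<Rightarrow> real \<Rightarrow> real \<Rightarrow> complex" where
  "coulomb_F_pos L \<eta> \<rho> = coulomb_F L \<eta> (of_real (ln \<rho>))"

lemma coulomb_F_pos_eq:
  assumes "L \<noteq> - 1" "\<rho> > 0"
  shows "coulomb_F_pos L \<eta> \<rho> = of_real (coulomb_C L \<eta>) * (exp (- \<i> * of_real \<rho>) * of_real (\<rho> powr (L + 1)) *
     hyp1F1 (of_real (L + 1) - \<i> * of_real \<eta>) (of_real (2 * L + 2)) (2 * \<i> * of_real \<rho>))"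
proof -
  have "exp (of_real (L + 1) * of_real (ln \<rho>)) = complex_of_real (\<rho> powr (L + 1))"
    using assms by (simp only: powr_def exp_of_real flip: of_real_mult) simp
  moreover have "exp (complex_of_real (ln \<rho>)) = of_real \<rho>"
    using assms by (simp add: exp_of_real)
  ultimately show ?thesis
    using assms by (simp add: coulomb_F_pos_def coulomb_F_def coulomb_phi_def)
qed

lemma coulomb_F_pos_ode:
  fixes L \<eta> :: real
  assumes L: "L > - 3 / 2" "L \<noteq> - 1"
  defines "a \<equiv> of_real (L + 1) - \<i> * of_real \<eta>" and "b \<equiv> of_real (2 * L + 2)"
  shows "coulomb_ode L \<eta> (coulomb_F_pos L \<eta>) (\<lambda>\<rho>. of_real (coulomb_C L \<eta>) * (exp (- \<i> * of_real \<rho>) * of_real (\<rho> powr (L + 1)) *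
    ((- \<i> + of_real ((L + 1) / \<rho>)) * hyp1F1 a b (2 * \<i> * of_real \<rho>) + 2 * \<i> * hyp1F1' a b (2 * \<i> * of_real \<rho>))))"
    (is "coulomb_ode L \<eta> _ ?F'")
proof -
  have b: "b \<notin> \<int>\<^sub>\<le>\<^sub>0" unfolding b_def by (rule two_L_plus_2_notin_nonpos_Ints[OF L])
  have lin: "((\<lambda>x. 2 * \<i> * of_real x) has_vector_derivative 2 * \<i>) (at x)" for x :: real
    by (rule has_vector_derivative_real_field) (auto intro!: derivative_eq_intros)
  have d1: "((\<lambda>x. hyp1F1 a b (2 * \<i> * of_real x)) has_vector_derivative 2 * \<i> * hyp1F1' a b (2 * \<i> * of_real x)) (at x)" for x :: real
    using field_vector_diff_chain_at[OF lin hyp1F1_derivs(1)[OF b]] by (simp add: o_def)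
  have "((\<lambda>x. hyp1F1' a b (2 * \<i> * of_real x)) has_vector_derivative 2 * \<i> * hyp1F1'' a b (2 * \<i> * of_real x)) (at x)" for x :: real
    using field_vector_diff_chain_at[OF lin hyp1F1_derivs(2)[OF b]] by (simp add: o_def)
  from has_vector_derivative_mult_right[OF this, of "2 * \<i>"]
  have d2: "((\<lambda>x. 2 * \<i> * hyp1F1' a b (2 * \<i> * of_real x)) has_vector_derivative
     2 * \<i> * (2 * \<i> * hyp1F1'' a b (2 * \<i> * of_real x))) (at x)" for x :: real .
  have "coulomb_ode L \<eta> (\<lambda>\<rho>. of_real (coulomb_C L \<eta>) * (exp (- \<i> * of_real \<rho>) * of_real (\<rho> powr (L + 1)) *
     hyp1F1 a b (2 * \<i> * of_real \<rho>))) ?F'"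
  proof (rule coulomb_ode_gauge[OF _ d1 d2])
    fix \<rho> :: real
    \<comment> \<open>Kummer's equation at 2 i \<rho>, multiplied by 2i, is the gauge equation with
      k = - i.\<close>
    have "2 * \<i> * (2 * \<i> * of_real \<rho> * hyp1F1'' a b (2 * \<i> * of_real \<rho>) + (b - 2 * \<i> * of_real \<rho>) * hyp1F1' a b (2 * \<i> * of_real \<rho>)
        - a * hyp1F1 a b (2 * \<i> * of_real \<rho>)) = 0"
      using hyp1F1_ode[OF b, of "2 * \<i> * of_real \<rho>" a] by simp
    then show "of_real \<rho> * (2 * \<i> * (2 * \<i> * hyp1F1'' a b (2 * \<i> * of_real \<rho>))) +
       (2 * - \<i> * of_real \<rho> + of_real (2 * L + 2)) * (2 * \<i> * hyp1F1' a b (2 * \<i> * of_real \<rho>)) +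
       (2 * - \<i> * of_real (L + 1) - of_real (2 * \<eta>)) * hyp1F1 a b (2 * \<i> * of_real \<rho>) = 0"
      by (simp add: a_def b_def algebra_simps)
  qed simp
  moreover have "coulomb_F_pos L \<eta> \<rho> = of_real (coulomb_C L \<eta>) * (exp (- \<i> * of_real \<rho>) * of_real (\<rho> powr (L + 1)) *
     hyp1F1 a b (2 * \<i> * of_real \<rho>))" if "\<rho> > 0" for \<rho>
    unfolding a_def b_def by (rule coulomb_F_pos_eq[OF L(2) that])
  ultimately show ?thesis
    unfolding coulomb_ode_def
    by (auto intro: has_vector_derivative_transform_within_open[of _ _ _ "{0<..}"])
qed

text \<open>With z = l + i \<eta>, passing from l - 1 to l contributes 2 from the power of 2, |z|
  from Gamma (z + 1), and 1 / ((2l + 1) 2l) from two steps of Gamma at 2l.\<close>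

lemma coulomb_C_lower:
  assumes l: "l > - 1 / 2" "l \<noteq> 0"
  shows "(2 * l + 1) * coulomb_C l \<eta> = sqrt (l\<^sup>2 + \<eta>\<^sup>2) / l * coulomb_C (l - 1) \<eta>"
proof -
  define z where "z = Complex l \<eta>"
  have z: "of_real (l + 1) + \<i> * of_real \<eta> = z + 1" "of_real (l - 1 + 1) + \<i> * of_real \<eta> = z"
    by (simp_all add: z_def complex_eq_iff)
  have zn: "z \<notin> \<int>\<^sub>\<le>\<^sub>0"
  proof
    assume "z \<in> \<int>\<^sub>\<le>\<^sub>0"
    then obtain n where "z = - of_nat n" by (auto elim!: nonpos_Ints_cases')
    then have "l = - real n" by (simp add: z_def complex_eq_iff)
    with l show False by auto
  qed
  have "2 * l \<notin> \<int>\<^sub>\<le>\<^sub>0"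
  proof
    assume "2 * l \<in> \<int>\<^sub>\<le>\<^sub>0"
    then obtain n where "2 * l = - of_nat n" by (auto elim!: nonpos_Ints_cases')
    with l show False by (cases n) auto
  qed
  moreover from this have "2 * l + 1 \<notin> \<int>\<^sub>\<le>\<^sub>0" using plus_one_in_nonpos_Ints_imp by blast
  ultimately have "Gamma (2 * l + 1 + 1) = (2 * l + 1) * Gamma (2 * l + 1)"
      "Gamma (2 * l + 1) = 2 * l * Gamma (2 * l)" "Gamma (2 * l) \<noteq> 0"
    using Gamma_plus1[of "2 * l + 1"] Gamma_plus1[of "2 * l"] Gamma_eq_zero_iff[of "2 * l"] by blast+
  then have G: "Gamma (2 * l + 2) = (2 * l + 1) * (2 * l) * Gamma (2 * l)" "Gamma (2 * l) \<noteq> 0"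
    by (simp_all add: add.assoc)
  have nz: "cmod (Gamma (z + 1)) = sqrt (l\<^sup>2 + \<eta>\<^sup>2) * cmod (Gamma z)"
    using zn by (simp add: Gamma_plus1 norm_mult) (simp add: z_def cmod_def)
  have p: "2 powr l = 2 * 2 powr (l - 1)" by (simp add: powr_diff)
  have l1: "2 * l + 1 \<noteq> 0" "2 * (l - 1) + 2 = 2 * l" using l by auto
  show ?thesis
    unfolding coulomb_C_def z nz p G l1(2)
    using l G(2) l1(1) by (simp add: divide_simps)
qed

text \<open>The operator and the factor are those of \<open>outgoing_lower\<close>, but the proof
  uses the series alone. This allows F = Im H to be carried from l to l - 1.\<close>

lemma coulomb_F_pos_lower:
  assumes l: "l > - 1 / 2" "l \<noteq> 0" and r: "\<rho> > 0"
  obtains F' where "(coulomb_F_pos l \<eta> has_vector_derivative F') (at \<rho>)"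
    "of_real (sqrt (l\<^sup>2 + \<eta>\<^sup>2) / l) * coulomb_F_pos (l - 1) \<eta> \<rho> = of_real (l / \<rho> + \<eta> / l) * coulomb_F_pos l \<eta> \<rho> + F'"
proof -
  define a where "a = of_real (l + 1) - \<i> * of_real \<eta>"
  define b where "b = complex_of_real (2 * l + 2)"
  define z where "z = 2 * \<i> * complex_of_real \<rho>"
  define M where "M = hyp1F1 a b z"
  define M' where "M' = hyp1F1' a b z"
  define N where "N = hyp1F1 (a - 1) (b - 2) z"
  have a1: "of_real (l - 1 + 1) - \<i> * of_real \<eta> = a - 1" by (simp add: a_def)
  have b2: "complex_of_real (2 * (l - 1) + 2) = b - 2" by (simp add: b_def)
  have bn: "b - 2 \<notin> \<int>\<^sub>\<le>\<^sub>0" unfolding b2[symmetric]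
    by (rule two_L_plus_2_notin_nonpos_Ints) (use l in auto)
  have pw: "\<rho> powr (l + 1) = \<rho> * \<rho> powr l" using r by (simp add: powr_add)
  define E where "E = exp (- \<i> * of_real \<rho>) * complex_of_real (\<rho> powr l)"
  have Fl: "coulomb_F_pos l \<eta> \<rho> = of_real (coulomb_C l \<eta>) * (E * (of_real \<rho> * M))"
    using l r by (simp add: coulomb_F_pos_eq pw E_def M_def a_def b_def z_def)
  have Fm: "coulomb_F_pos (l - 1) \<eta> \<rho> = of_real (coulomb_C (l - 1) \<eta>) * (E * N)"
    using l r coulomb_F_pos_eq[of "l - 1" \<rho> \<eta>] unfolding a1 b2
    by (simp add: E_def N_def z_def mult.assoc)
  have cont: "(b - 1) * M - (b - a - 1) / (b - 2) * (z * M) + z * M' = (b - 1) * N"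
    unfolding M_def M'_def N_def by (rule hyp1F1_contiguous[OF bn])
  \<comment> \<open>Here b - a - 1 = l + i \<eta> and b - 2 = 2l.\<close>
  have "(b - a - 1) / (b - 2) * z = (\<i> - of_real (\<eta> / l)) * of_real \<rho>"
    using l by (simp add: a_def b_def z_def field_simps)
  then have "(b - a - 1) / (b - 2) * (z * M) = (\<i> - of_real (\<eta> / l)) * of_real \<rho> * M"
    by (simp only: mult.assoc[symmetric])
  moreover have "b - 1 = of_real (2 * l + 1)" by (simp add: b_def)
  ultimately have cont': "of_real (2 * l + 1) * M - (\<i> - of_real (\<eta> / l)) * of_real \<rho> * M + z * M' = of_real (2 * l + 1) * N"
    using cont by (simp only:)
  show ?thesis
  proof
    show "(coulomb_F_pos l \<eta> has_vector_derivative of_real (coulomb_C l \<eta>) * (exp (- \<i> * of_real \<rho>) * of_real (\<rho> powr (l + 1)) *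
    ((- \<i> + of_real ((l + 1) / \<rho>)) * M + 2 * \<i> * M'))) (at \<rho>)"
      unfolding M_def M'_def a_def b_def z_def
      by (rule coulomb_odeD(1)[OF coulomb_F_pos_ode r]) (use l in auto)
    have "of_real (sqrt (l\<^sup>2 + \<eta>\<^sup>2) / l) * coulomb_F_pos (l - 1) \<eta> \<rho> =
       of_real (sqrt (l\<^sup>2 + \<eta>\<^sup>2) / l * coulomb_C (l - 1) \<eta>) * (E * N)" by (simp add: Fm)
    also have "\<dots> = of_real (coulomb_C l \<eta>) * E * (of_real (2 * l + 1) * N)"
      unfolding coulomb_C_lower[OF l, symmetric] by simp
    also have "\<dots> = of_real (coulomb_C l \<eta>) * E * (of_real (2 * l + 1) * M - (\<i> - of_real (\<eta> / l)) * of_real \<rho> * M + z * M')"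
      unfolding cont' ..
    also have "\<dots> = of_real (l / \<rho> + \<eta> / l) * coulomb_F_pos l \<eta> \<rho> + of_real (coulomb_C l \<eta>) * (exp (- \<i> * of_real \<rho>) * of_real (\<rho> powr (l + 1)) *
    ((- \<i> + of_real ((l + 1) / \<rho>)) * M + 2 * \<i> * M'))"
    proof -
      have e: "exp (- \<i> * of_real \<rho>) * complex_of_real (\<rho> powr (l + 1)) = E * of_real \<rho>"
        by (simp add: pw E_def)
      show ?thesis unfolding e Fl using r by (simp add: z_def field_simps)
    qed
    finally show "of_real (sqrt (l\<^sup>2 + \<eta>\<^sup>2) / l) * coulomb_F_pos (l - 1) \<eta> \<rho> = of_real (l / \<rho> + \<eta> / l) * coulomb_F_pos l \<eta> \<rho> +
       of_real (coulomb_C l \<eta>) * (exp (- \<i> * of_real \<rho>) * of_real (\<rho> powr (l + 1)) *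
    ((- \<i> + of_real ((l + 1) / \<rho>)) * M + 2 * \<i> * M'))" .
  qed
qed


section \<open>Matching F with the Laplace integral for L > 0\<close>

lemma powr_of_real_Re_Im:
  fixes a :: complex
  assumes "x > 0"
  shows "of_real x powr a = of_real (x powr Re a) * cis (Im a * ln x)"
proof -
  have "a * of_real (ln x) = of_real (Re a * ln x) + \<i> * of_real (Im a * ln x)"
    by (simp add: complex_eq_iff)
  then have "of_real x powr a = exp (of_real (Re a * ln x)) * exp (\<i> * of_real (Im a * ln x))"
    using assms by (simp only: powr_of_real_exp exp_add)
  then show ?thesis
    using assms by (simp only: exp_of_real cis_conv_exp powr_def) simp
qed

text \<open>The Laplace integral is evaluated at 2 \<rho>, so powers of \<rho> have to be traded for
  powers of 2 \<rho>.\<close>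

lemma of_real_powr_double:
  assumes "\<rho> > 0"
  shows "complex_of_real (\<rho> powr c) = of_real (2 powr (- c)) * of_real (2 * \<rho>) powr of_real c"
proof -
  have "\<rho> powr c = 2 powr (- c) * (2 * \<rho>) powr c"
    using assms by (simp add: powr_mult powr_minus field_simps)
  moreover have "of_real (2 * \<rho>) powr of_real c = complex_of_real ((2 * \<rho>) powr c)"
    using assms by (intro powr_of_real) auto
  ultimately show ?thesis by (simp only: of_real_mult)
qed

lemma outgoing_base:
  fixes L \<eta> :: real
  assumes L: "L > 0"
  obtains H H' where "outgoing L \<eta> H H'"
    and "\<And>\<rho>. \<rho> > 0 \<Longrightarrow> coulomb_F_pos L \<eta> \<rho> = of_real (Im (H \<rho>))"
proof -
  define a where "a = Complex L \<eta>"
  define b where "b = Complex L (- \<eta>)"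
  define J0 where "J0 \<rho> = coulomb_laplace a b (2 * \<rho>)" for \<rho>
  define J1 where "J1 \<rho> = coulomb_laplace (a + 1) b (2 * \<rho>)" for \<rho>
  define J2 where "J2 \<rho> = coulomb_laplace (a + 1 + 1) b (2 * \<rho>)" for \<rho>
  define g where "g = cmod (Gamma (a + 1))"
  \<comment> \<open>K makes the limit at infinity 1: it completes \<rho>^(L+1) to (2 \<rho>)^(L+1),
    divides out |Gamma (a + 1)| and matches the term - L \<pi>/2 of \<theta>. The argument of Gamma
    is supplied by the Laplace limit itself.\<close>
  define K where "K = of_real (2 powr (L + 1) / g) * cis (- (L * pi / 2))"
  define E where "E \<rho> = exp (\<i> * of_real \<rho>) * complex_of_real (\<rho> powr (L + 1))" for \<rho> :: real
  define H where "H = (\<lambda>\<rho>. K * (E \<rho> * J0 \<rho>))"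
  define H' where "H' = (\<lambda>\<rho>. K * (E \<rho> * ((\<i> + of_real ((L + 1) / \<rho>)) * J0 \<rho> + (- 2) * J1 \<rho>)))"
  have re: "Re a > - 1" "Re (a + 1) > - 1" "Re b \<ge> 0" using L by (auto simp: a_def b_def)
  have a1: "of_real (L + 1) + \<i> * of_real \<eta> = a + 1" by (simp add: a_def complex_eq_iff)
  have zn: "a + 1 \<notin> \<int>\<^sub>\<le>\<^sub>0"
  proof
    assume "a + 1 \<in> \<int>\<^sub>\<le>\<^sub>0"
    then obtain n where "a + 1 = - of_nat n" by (auto elim!: nonpos_Ints_cases')
    then have "L + 1 = - real n" by (simp add: a_def complex_eq_iff)
    with L show False by auto
  qed
  have g0: "g > 0" using zn by (simp add: g_def Gamma_eq_zero_iff)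
  have d2: "((\<lambda>\<rho>. f (2 * \<rho>)) has_vector_derivative 2 * f') (at \<rho>)"
    if "(f has_vector_derivative f') (at (2 * \<rho>))" for f and f' :: complex and \<rho> :: real
  proof -
    have "((\<lambda>x. 2 * x) has_vector_derivative (2::real)) (at \<rho>)"
      by (auto intro!: derivative_eq_intros simp flip: has_real_derivative_iff_has_vector_derivative)
    from vector_diff_chain_at[OF this that] show ?thesis by (simp add: o_def scaleR_conv_of_real)
  qed
  have dJ0: "(J0 has_vector_derivative (- 2) * J1 \<rho>) (at \<rho>)" if "\<rho> > 0" for \<rho>
    using d2[OF coulomb_laplace_has_vector_derivative[OF re(1,3), of "2 * \<rho>"]] that by (simp add: J0_def[abs_def] J1_def)
  have "(J1 has_vector_derivative (- 2) * J2 \<rho>) (at \<rho>)" if "\<rho> > 0" for \<rho>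
    using d2[OF coulomb_laplace_has_vector_derivative[OF re(2,3), of "2 * \<rho>"]] that by (simp add: J1_def[abs_def] J2_def)
  then have dJ1: "((\<lambda>\<rho>. (- 2) * J1 \<rho>) has_vector_derivative (- 2) * ((- 2) * J2 \<rho>)) (at \<rho>)" if "\<rho> > 0" for \<rho>
    using that by (intro has_vector_derivative_mult_right)
  have "coulomb_ode L \<eta> H H'"
    unfolding H_def H'_def E_def
  proof (rule coulomb_ode_gauge[OF _ dJ0 dJ1])
    fix \<rho> :: real assume r: "\<rho> > 0"
    have ab: "a + b + 2 = of_real (2 * L + 2)" by (simp add: a_def b_def complex_eq_iff)
    have "(a + 1) * J0 \<rho> + \<i> * of_real (2 * L + 2) * J1 \<rho> = of_real (2 * \<rho>) * (J1 \<rho> + \<i> * J2 \<rho>)"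
      using coulomb_laplace_by_parts[OF re(1,3), of "2 * \<rho>"] r unfolding ab J0_def J1_def J2_def by simp
    then have "2 * \<i> * ((a + 1) * J0 \<rho> + \<i> * of_real (2 * L + 2) * J1 \<rho> - of_real (2 * \<rho>) * (J1 \<rho> + \<i> * J2 \<rho>)) = 0"
      by simp
    moreover have "2 * \<i> * (a + 1) = 2 * \<i> * of_real (L + 1) - of_real (2 * \<eta>)"
      by (simp add: a_def complex_eq_iff)
    moreover have "2 * \<i> * ((a + 1) * J0 \<rho> + \<i> * of_real (2 * L + 2) * J1 \<rho> - of_real (2 * \<rho>) * (J1 \<rho> + \<i> * J2 \<rho>)) =
      of_real \<rho> * (- 2 * (- 2 * J2 \<rho>)) + (2 * \<i> * of_real \<rho> + of_real (2 * L + 2)) * (- 2 * J1 \<rho>) + 2 * \<i> * (a + 1) * J0 \<rho>"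
      by (simp add: algebra_simps)
    ultimately show "of_real \<rho> * (- 2 * (- 2 * J2 \<rho>)) + (2 * \<i> * of_real \<rho> + of_real (2 * L + 2)) * (- 2 * J1 \<rho>) +
         (2 * \<i> * of_real (L + 1) - of_real (2 * \<eta>)) * J0 \<rho> = 0" by simp
  qed simp
  have f2: "filterlim (\<lambda>\<rho>. 2 * \<rho>) at_top (at_top :: real filter)" by real_asymp
  have f20: "filterlim (\<lambda>\<rho>. 2 * \<rho>) (at_right 0) (at_right (0::real))" by real_asymp
  define \<kappa> where "\<kappa> = cis (- Arg (Gamma (a + 1))) / of_real g"
  have \<kappa>: "\<kappa> * Gamma (a + 1) = 1"
  proof -
    define A where "A = Arg (Gamma (a + 1))"
    have G: "Gamma (a + 1) = of_real g * cis A"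
      using rcis_cmod_Arg[of "Gamma (a + 1)"] by (simp add: rcis_def g_def A_def)
    have "\<kappa> = cis (- A) / of_real g" by (simp add: \<kappa>_def A_def)
    then show ?thesis using g0 unfolding G by (simp add: cis_mult)
  qed
  \<comment> \<open>The logarithmic term of \<theta> is accounted for by the imaginary part \<eta>
    of the exponent a + 1.\<close>
  have KE: "K * E \<rho> * cis (- coulomb_theta L \<eta> \<rho>) = \<kappa> * of_real (2 * \<rho>) powr (a + 1)" if r: "\<rho> > 0" for \<rho>
  proof -
    have "- coulomb_theta L \<eta> \<rho> = - \<rho> + (\<eta> * ln (2 * \<rho>) + (L * pi / 2 + - Arg (Gamma (a + 1))))"
      unfolding coulomb_theta_def a1 by simp
    then have "cis (- coulomb_theta L \<eta> \<rho>) = cis (- \<rho>) * (cis (\<eta> * ln (2 * \<rho>)) * (cis (L * pi / 2) * cis (- Arg (Gamma (a + 1)))))"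
      by (simp only: cis_mult)
    moreover have "exp (\<i> * of_real \<rho>) = cis \<rho>" by (simp add: cis_conv_exp)
    moreover have P: "of_real (2 * \<rho>) powr (a + 1) = of_real (2 powr (L + 1)) * of_real (\<rho> powr (L + 1)) * cis (\<eta> * ln (2 * \<rho>))"
      using r by (subst powr_of_real_Re_Im) (auto simp: a_def powr_mult)
    ultimately have "K * E \<rho> * cis (- coulomb_theta L \<eta> \<rho>) =
       (cis \<rho> * cis (- \<rho>)) * (cis (- (L * pi / 2)) * cis (L * pi / 2)) * (\<kappa> * of_real (2 * \<rho>) powr (a + 1))"
      unfolding K_def E_def \<kappa>_def P divide_inverse of_real_mult of_real_inverse by (simp only: mult_ac)
    moreover have "cis \<rho> * cis (- \<rho>) = 1" "cis (- (L * pi / 2)) * cis (L * pi / 2) = 1" by (simp_all add: cis_mult)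
    ultimately show ?thesis by simp
  qed
  have l0: "((\<lambda>\<rho>. of_real (2 * \<rho>) powr (a + 1) * J0 \<rho>) \<longlongrightarrow> Gamma (a + 1)) at_top"
    unfolding J0_def by (rule filterlim_compose[OF coulomb_laplace_at_top[OF re(1,3)] f2])
  \<comment> \<open>J1 decays faster than J0 by one power of \<rho>.\<close>
  have l1: "((\<lambda>\<rho>. of_real (2 * \<rho>) powr (a + 1) * J1 \<rho>) \<longlongrightarrow> 0) at_top"
  proof -
    have "((\<lambda>\<rho>. of_real (1 / (2 * \<rho>)) * (of_real (2 * \<rho>) powr (a + 1 + 1) * J1 \<rho>)) \<longlongrightarrow> of_real 0 * Gamma (a + 1 + 1)) at_top"
      unfolding J1_def
      by (intro tendsto_mult tendsto_of_real filterlim_compose[OF coulomb_laplace_at_top[OF re(2,3)] f2]) real_asymp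
    then have "((\<lambda>\<rho>. of_real (1 / (2 * \<rho>)) * (of_real (2 * \<rho>) powr (a + 1 + 1) * J1 \<rho>)) \<longlongrightarrow> 0) at_top" by simp
    moreover have "\<forall>\<^sub>F \<rho> in at_top. of_real (1 / (2 * \<rho>)) * (of_real (2 * \<rho>) powr (a + 1 + 1) * J1 \<rho>) = of_real (2 * \<rho>) powr (a + 1) * J1 \<rho>"
    proof (rule eventually_mono[OF eventually_gt_at_top[of 0]])
      fix \<rho> :: real assume r: "\<rho> > 0"
      have "complex_of_real (2 * \<rho>) powr (a + 1 + 1) = of_real (2 * \<rho>) powr (a + 1) * of_real (2 * \<rho>)"
        by (subst powr_add) (simp add: powr_to_1)
      moreover have "complex_of_real (1 / (2 * \<rho>)) * of_real (2 * \<rho>) = 1" using r by simp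
      ultimately show "of_real (1 / (2 * \<rho>)) * (of_real (2 * \<rho>) powr (a + 1 + 1) * J1 \<rho>) = of_real (2 * \<rho>) powr (a + 1) * J1 \<rho>"
        by algebra
    qed
    ultimately show ?thesis by (rule Lim_transform_eventually)
  qed
  have "((\<lambda>\<rho>. \<kappa> * (of_real (2 * \<rho>) powr (a + 1) * J0 \<rho>)) \<longlongrightarrow> \<kappa> * Gamma (a + 1)) at_top"
    by (intro tendsto_intros l0)
  moreover have "\<forall>\<^sub>F \<rho> in at_top. \<kappa> * (of_real (2 * \<rho>) powr (a + 1) * J0 \<rho>) = H \<rho> * cis (- coulomb_theta L \<eta> \<rho>)"
    by (rule eventually_mono[OF eventually_gt_at_top[of 0]]) (simp only: mult.assoc[symmetric] KE[symmetric], simp add: H_def mult_ac)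
  ultimately have limH: "((\<lambda>\<rho>. H \<rho> * cis (- coulomb_theta L \<eta> \<rho>)) \<longlongrightarrow> 1) at_top"
    unfolding \<kappa> by (rule Lim_transform_eventually)
  have "((\<lambda>\<rho>. \<kappa> * ((\<i> + of_real ((L + 1) / \<rho>)) * (of_real (2 * \<rho>) powr (a + 1) * J0 \<rho>) + (- 2) * (of_real (2 * \<rho>) powr (a + 1) * J1 \<rho>)))
     \<longlongrightarrow> \<kappa> * ((\<i> + of_real 0) * Gamma (a + 1) + (- 2) * 0)) at_top"
    by (intro tendsto_intros l0 l1) real_asymp
  moreover have "\<kappa> * ((\<i> + of_real 0) * Gamma (a + 1) + (- 2) * 0) = \<i>"
    using \<kappa> by (simp add: mult.left_commute[of \<kappa>])
  ultimately have "((\<lambda>\<rho>. \<kappa> * ((\<i> + of_real ((L + 1) / \<rho>)) * (of_real (2 * \<rho>) powr (a + 1) * J0 \<rho>) + (- 2) * (of_real (2 * \<rho>) powr (a + 1) * J1 \<rho>)))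
     \<longlongrightarrow> \<i>) at_top" by (simp only:)
  moreover have "\<forall>\<^sub>F \<rho> in at_top. \<kappa> * ((\<i> + of_real ((L + 1) / \<rho>)) * (of_real (2 * \<rho>) powr (a + 1) * J0 \<rho>) + (- 2) * (of_real (2 * \<rho>) powr (a + 1) * J1 \<rho>))
      = H' \<rho> * cis (- coulomb_theta L \<eta> \<rho>)"
  proof (rule eventually_mono[OF eventually_gt_at_top[of 0]])
    fix \<rho> :: real assume r: "\<rho> > 0"
    have "\<kappa> * ((\<i> + of_real ((L + 1) / \<rho>)) * (of_real (2 * \<rho>) powr (a + 1) * J0 \<rho>) + (- 2) * (of_real (2 * \<rho>) powr (a + 1) * J1 \<rho>))
      = (\<kappa> * of_real (2 * \<rho>) powr (a + 1)) * ((\<i> + of_real ((L + 1) / \<rho>)) * J0 \<rho> + (- 2) * J1 \<rho>)"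
      by algebra
    also have "\<dots> = H' \<rho> * cis (- coulomb_theta L \<eta> \<rho>)"
      unfolding KE[OF r, symmetric] H'_def by (simp only: mult_ac)
    finally show "\<kappa> * ((\<i> + of_real ((L + 1) / \<rho>)) * (of_real (2 * \<rho>) powr (a + 1) * J0 \<rho>) + (- 2) * (of_real (2 * \<rho>) powr (a + 1) * J1 \<rho>))
      = H' \<rho> * cis (- coulomb_theta L \<eta> \<rho>)" .
  qed
  ultimately have limH': "((\<lambda>\<rho>. H' \<rho> * cis (- coulomb_theta L \<eta> \<rho>)) \<longlongrightarrow> \<i>) at_top"
    by (rule Lim_transform_eventually)
  have out: "outgoing L \<eta> H H'"
    using \<open>coulomb_ode L \<eta> H H'\<close> limH limH' by (simp add: outgoing_def)

  \<comment> \<open>The leading coefficient at 0, where H behaves like h \<rho>^(- L).\<close>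
  define h where "h = 2 powr (- L) * exp (pi * \<eta> / 2) * Gamma (2 * L + 1) / g"
  have ab: "a + b + 1 = of_real (2 * L + 1)" "a + 1 + b + 1 = of_real (2 * L + 2)"
    by (simp_all add: a_def b_def complex_eq_iff)
  have ib: "\<i> powr b = cis (L * pi / 2) * of_real (exp (pi * \<eta> / 2))"
  proof -
    have "b * Ln \<i> = \<i> * of_real (L * pi / 2) + of_real (pi * \<eta> / 2)"
      by (simp add: b_def complex_eq_iff)
    then have "exp (b * Ln \<i>) = exp (\<i> * of_real (L * pi / 2)) * exp (of_real (pi * \<eta> / 2))"
      by (simp only: exp_add)
    moreover have "\<i> powr b = exp (b * Ln \<i>)" by (simp add: powr_def)
    ultimately show ?thesis by (simp only: cis_conv_exp exp_of_real)
  qed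
  \<comment> \<open>The phase of K cancels that of i^b, so the limits at 0 below are real.\<close>
  have Kib: "K * (\<i> powr b) = of_real (2 powr (L + 1) / g * exp (pi * \<eta> / 2))"
  proof -
    have "cis (- (L * pi / 2)) * cis (L * pi / 2) = 1" by (simp add: cis_mult)
    then show ?thesis by (simp add: K_def ib)
  qed
  have m0: "((\<lambda>\<rho>. K * (of_real (\<rho> powr (2 * L + 1)) * J0 \<rho>)) \<longlongrightarrow> of_real h) (at_right 0)"
  proof -
    have "((\<lambda>\<rho>. of_real (2 powr (- (2 * L + 1))) * K * (of_real (2 * \<rho>) powr (a + b + 1) * J0 \<rho>)) \<longlongrightarrow>
       of_real (2 powr (- (2 * L + 1))) * K * (\<i> powr b * Gamma (a + b + 1))) (at_right 0)"
      unfolding J0_def by (intro tendsto_mult tendsto_const filterlim_compose[OF coulomb_laplace_at_0[OF re(1,3)] f20])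
    also have "of_real (2 powr (- (2 * L + 1))) * K * (\<i> powr b * Gamma (a + b + 1)) =
       of_real (2 powr (- (2 * L + 1)) * (2 powr (L + 1) / g * exp (pi * \<eta> / 2)) * Gamma (2 * L + 1))"
      unfolding ab(1) Gamma_complex_of_real of_real_mult[of _ "Gamma _"] of_real_mult[of "2 powr _" "2 powr _ / _ * _"] Kib[symmetric] by (simp only: mult_ac)
    also have "2 powr (- (2 * L + 1)) * (2 powr (L + 1) / g * exp (pi * \<eta> / 2)) * Gamma (2 * L + 1) = h"
    proof -
      have "2 powr (- (2 * L + 1)) * 2 powr (L + 1) = 2 powr (- L :: real)" by (simp flip: powr_add)
      then show ?thesis by (simp add: h_def flip: mult.assoc)
    qed
    finally show ?thesis
    proof (rule Lim_transform_eventually)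
      show "\<forall>\<^sub>F \<rho> in at_right 0. of_real (2 powr (- (2 * L + 1))) * K * (of_real (2 * \<rho>) powr (a + b + 1) * J0 \<rho>) = K * (of_real (\<rho> powr (2 * L + 1)) * J0 \<rho>)"
      proof (rule eventually_mono[OF eventually_at_right_less[of 0]])
        fix \<rho> :: real assume r: "0 < \<rho>"
        have "complex_of_real (\<rho> powr (2 * L + 1)) = of_real (2 powr (- (2 * L + 1))) * of_real (2 * \<rho>) powr (a + b + 1)"
          unfolding ab(1) by (rule of_real_powr_double[OF r])
        then show "of_real (2 powr (- (2 * L + 1))) * K * (of_real (2 * \<rho>) powr (a + b + 1) * J0 \<rho>) = K * (of_real (\<rho> powr (2 * L + 1)) * J0 \<rho>)"
          by (simp only: mult_ac)
      qed
    qed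
  qed
  \<comment> \<open>Compared with \<open>m0\<close>, the factor 2L + 1 comes from Gamma (2L + 2) and
    the factor 1/2 from one more power of 2 \<rho>.\<close>
  have m1: "((\<lambda>\<rho>. K * (of_real (\<rho> powr (2 * L + 2)) * J1 \<rho>)) \<longlongrightarrow> of_real ((2 * L + 1) * h / 2)) (at_right 0)"
  proof -
    have "((\<lambda>\<rho>. of_real (2 powr (- (2 * L + 2))) * K * (of_real (2 * \<rho>) powr (a + 1 + b + 1) * J1 \<rho>)) \<longlongrightarrow>
       of_real (2 powr (- (2 * L + 2))) * K * (\<i> powr b * Gamma (a + 1 + b + 1))) (at_right 0)"
      unfolding J1_def by (intro tendsto_mult tendsto_const filterlim_compose[OF coulomb_laplace_at_0[OF re(2,3)] f20])
    also have "of_real (2 powr (- (2 * L + 2))) * K * (\<i> powr b * Gamma (a + 1 + b + 1)) =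
       of_real (2 powr (- (2 * L + 2)) * (2 powr (L + 1) / g * exp (pi * \<eta> / 2)) * Gamma (2 * L + 2))"
      unfolding ab(2) Gamma_complex_of_real of_real_mult[of _ "Gamma _"] of_real_mult[of "2 powr _" "2 powr _ / _ * _"] Kib[symmetric] by (simp only: mult_ac)
    also have "2 powr (- (2 * L + 2)) * (2 powr (L + 1) / g * exp (pi * \<eta> / 2)) * Gamma (2 * L + 2) = (2 * L + 1) * h / 2"
    proof -
      have "2 powr (- (2 * L + 2)) * 2 powr (L + 1) = 2 powr (- L - 1 :: real)" by (simp flip: powr_add)
      also have "\<dots> = 2 powr (- L) / 2" by (simp add: powr_diff)
      finally have "2 powr (- (2 * L + 2)) * 2 powr (L + 1) = 2 powr (- L) / (2::real)" .
      moreover have "Gamma (2 * L + 1 + 1) = (2 * L + 1) * Gamma (2 * L + 1)"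
        using L by (intro Gamma_plus1) (auto dest: nonpos_Ints_nonpos)
      then have G: "Gamma (2 * L + 2) = (2 * L + 1) * Gamma (2 * L + 1)" by (simp add: add.assoc)
      moreover have "2 powr (- (2 * L + 2)) * (2 powr (L + 1) / g * exp (pi * \<eta> / 2)) * Gamma (2 * L + 2) =
         (2 powr (- (2 * L + 2)) * 2 powr (L + 1)) * (exp (pi * \<eta> / 2) * Gamma (2 * L + 2) / g)"
        by (simp only: times_divide_eq_left times_divide_eq_right mult_ac)
      ultimately have "2 powr (- (2 * L + 2)) * (2 powr (L + 1) / g * exp (pi * \<eta> / 2)) * Gamma (2 * L + 2) =
        2 powr (- L) / 2 * (exp (pi * \<eta> / 2) * ((2 * L + 1) * Gamma (2 * L + 1)) / g)" by (simp only:)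
      then show ?thesis by (simp add: h_def mult_ac)
    qed
    finally show ?thesis
    proof (rule Lim_transform_eventually)
      show "\<forall>\<^sub>F \<rho> in at_right 0. of_real (2 powr (- (2 * L + 2))) * K * (of_real (2 * \<rho>) powr (a + 1 + b + 1) * J1 \<rho>) = K * (of_real (\<rho> powr (2 * L + 2)) * J1 \<rho>)"
      proof (rule eventually_mono[OF eventually_at_right_less[of 0]])
        fix \<rho> :: real assume r: "0 < \<rho>"
        have "complex_of_real (\<rho> powr (2 * L + 2)) = of_real (2 powr (- (2 * L + 2))) * of_real (2 * \<rho>) powr (a + 1 + b + 1)"
          unfolding ab(2) by (rule of_real_powr_double[OF r])
        then show "of_real (2 powr (- (2 * L + 2))) * K * (of_real (2 * \<rho>) powr (a + 1 + b + 1) * J1 \<rho>) = K * (of_real (\<rho> powr (2 * L + 2)) * J1 \<rho>)"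
          by (simp only: mult_ac)
      qed
    qed
  qed
  have id0: "((\<lambda>\<rho>. of_real \<rho>) \<longlongrightarrow> (0::complex)) (at_right 0)"
    using tendsto_of_real[OF tendsto_ident_at[of 0 "{0<..}"]] by simp
  have e0: "((\<lambda>\<rho>. exp (k * of_real \<rho>)) \<longlongrightarrow> 1) (at_right 0)" for k :: complex
    using tendsto_exp[OF tendsto_mult[OF tendsto_const id0, of k]] by simp
  have HL: "((\<lambda>\<rho>. of_real (\<rho> powr L) * H \<rho>) \<longlongrightarrow> of_real h) (at_right 0)"
  proof -
    have "((\<lambda>\<rho>. exp (\<i> * of_real \<rho>) * (K * (of_real (\<rho> powr (2 * L + 1)) * J0 \<rho>))) \<longlongrightarrow> 1 * of_real h) (at_right 0)"
      by (intro tendsto_mult e0 m0)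
    then have "((\<lambda>\<rho>. exp (\<i> * of_real \<rho>) * (K * (of_real (\<rho> powr (2 * L + 1)) * J0 \<rho>))) \<longlongrightarrow> of_real h) (at_right 0)" by simp
    then show ?thesis
    proof (rule Lim_transform_eventually, intro eventually_mono[OF eventually_at_right_less[of 0]])
      fix \<rho> :: real assume r: "0 < \<rho>"
      have "\<rho> powr (2 * L + 1) = \<rho> powr L * \<rho> powr (L + 1)" by (simp flip: powr_add)
      then show "exp (\<i> * of_real \<rho>) * (K * (of_real (\<rho> powr (2 * L + 1)) * J0 \<rho>)) = of_real (\<rho> powr L) * H \<rho>"
        by (simp add: H_def E_def mult_ac)
    qed
  qed
  \<comment> \<open>The coefficient is (L + 1) h - (2L + 1) h = - L h, in accordance with
    differentiating h \<rho>^(- L).\<close>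
  have HL': "((\<lambda>\<rho>. of_real (\<rho> powr (L + 1)) * H' \<rho>) \<longlongrightarrow> of_real (- (L * h))) (at_right 0)"
  proof -
    have "((\<lambda>\<rho>. exp (\<i> * of_real \<rho>) * ((\<i> * of_real \<rho> + of_real (L + 1)) * (K * (of_real (\<rho> powr (2 * L + 1)) * J0 \<rho>)) -
       2 * (K * (of_real (\<rho> powr (2 * L + 2)) * J1 \<rho>)))) \<longlongrightarrow>
       1 * ((\<i> * 0 + of_real (L + 1)) * of_real h - 2 * of_real ((2 * L + 1) * h / 2))) (at_right 0)"
      by (intro tendsto_mult tendsto_diff tendsto_add tendsto_const e0 m0 m1 id0)
    also have "1 * ((\<i> * 0 + of_real (L + 1)) * of_real h - 2 * of_real ((2 * L + 1) * h / 2)) = complex_of_real (- (L * h))"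
      by (simp add: algebra_simps)
    finally show ?thesis
    proof (rule Lim_transform_eventually, intro eventually_mono[OF eventually_at_right_less[of 0]])
      fix \<rho> :: real assume r: "0 < \<rho>"
      have p: "\<rho> powr (2 * L + 1) * \<rho> = \<rho> powr (2 * L + 2)" using r by (simp add: powr_add power2_eq_square)
      have q: "\<rho> powr (L + 1) * \<rho> powr (L + 1) = \<rho> powr (2 * L + 2)" by (simp flip: powr_add)
      have s: "complex_of_real (\<rho> powr (2 * L + 2)) * (\<i> + of_real ((L + 1) / \<rho>)) =
         of_real (\<rho> powr (2 * L + 1)) * (\<i> * of_real \<rho> + of_real (L + 1))"
        unfolding p[symmetric] using r by (simp add: field_simps)
      have "of_real (\<rho> powr (L + 1)) * H' \<rho> = exp (\<i> * of_real \<rho>) * (of_real (\<rho> powr (L + 1) * \<rho> powr (L + 1))) * K *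
          ((\<i> + of_real ((L + 1) / \<rho>)) * J0 \<rho> + (- 2) * J1 \<rho>)"
        unfolding H'_def E_def of_real_mult by (simp only: mult_ac)
      also have "\<dots> = exp (\<i> * of_real \<rho>) * K * ((of_real (\<rho> powr (2 * L + 2)) * (\<i> + of_real ((L + 1) / \<rho>))) * J0 \<rho> -
          2 * of_real (\<rho> powr (2 * L + 2)) * J1 \<rho>)"
        unfolding q by (simp add: algebra_simps)
      also have "\<dots> = exp (\<i> * of_real \<rho>) * ((\<i> * of_real \<rho> + of_real (L + 1)) * (K * (of_real (\<rho> powr (2 * L + 1)) * J0 \<rho>)) -
       2 * (K * (of_real (\<rho> powr (2 * L + 2)) * J1 \<rho>)))"
        unfolding s by (simp add: algebra_simps)
      finally show "exp (\<i> * of_real \<rho>) * ((\<i> * of_real \<rho> + of_real (L + 1)) * (K * (of_real (\<rho> powr (2 * L + 1)) * J0 \<rho>)) -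
       2 * (K * (of_real (\<rho> powr (2 * L + 2)) * J1 \<rho>))) = of_real (\<rho> powr (L + 1)) * H' \<rho>" ..
    qed
  qed

  define \<alpha> where "\<alpha> = of_real (L + 1) - \<i> * of_real \<eta>"
  define \<beta> where "\<beta> = complex_of_real (2 * L + 2)"
  define C where "C = coulomb_C L \<eta>"
  define F where "F = coulomb_F_pos L \<eta>"
  define F' where "F' = (\<lambda>\<rho>. of_real C * (exp (- \<i> * of_real \<rho>) * of_real (\<rho> powr (L + 1)) *
    ((- \<i> + of_real ((L + 1) / \<rho>)) * hyp1F1 \<alpha> \<beta> (2 * \<i> * of_real \<rho>) + 2 * \<i> * hyp1F1' \<alpha> \<beta> (2 * \<i> * of_real \<rho>))))"
  have Fode: "coulomb_ode L \<eta> F F'"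
    unfolding F_def F'_def C_def \<alpha>_def \<beta>_def by (rule coulomb_F_pos_ode) (use L in auto)
  have \<beta>n: "\<beta> \<notin> \<int>\<^sub>\<le>\<^sub>0" unfolding \<beta>_def by (rule two_L_plus_2_notin_nonpos_Ints) (use L in auto)
  have z0: "((\<lambda>\<rho>. 2 * \<i> * of_real \<rho>) \<longlongrightarrow> (0::complex)) (at_right 0)"
    using tendsto_mult[OF tendsto_const id0, of "2 * \<i>"] by simp
  have M0: "((\<lambda>\<rho>. hyp1F1 \<alpha> \<beta> (2 * \<i> * of_real \<rho>)) \<longlongrightarrow> 1) (at_right 0)"
    using isCont_tendsto_compose[OF DERIV_isCont[OF hyp1F1_derivs(1)[OF \<beta>n]] z0, of \<alpha>] by (simp add: hyp1F1_0)
  have M1: "((\<lambda>\<rho>. hyp1F1' \<alpha> \<beta> (2 * \<i> * of_real \<rho>)) \<longlongrightarrow> hyp1F1' \<alpha> \<beta> 0) (at_right 0)"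
    by (rule isCont_tendsto_compose[OF DERIV_isCont[OF hyp1F1_derivs(2)[OF \<beta>n]] z0])
  have FL: "((\<lambda>\<rho>. of_real (\<rho> powr (- L - 1)) * F \<rho>) \<longlongrightarrow> of_real C) (at_right 0)"
  proof -
    have "((\<lambda>\<rho>. of_real C * (exp (- \<i> * of_real \<rho>) * hyp1F1 \<alpha> \<beta> (2 * \<i> * of_real \<rho>))) \<longlongrightarrow> of_real C * (1 * 1)) (at_right 0)"
      by (intro tendsto_mult tendsto_const e0 M0)
    then have "((\<lambda>\<rho>. of_real C * (exp (- \<i> * of_real \<rho>) * hyp1F1 \<alpha> \<beta> (2 * \<i> * of_real \<rho>))) \<longlongrightarrow> of_real C) (at_right 0)" by simp
    then show ?thesis
    proof (rule Lim_transform_eventually, intro eventually_mono[OF eventually_at_right_less[of 0]])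
      fix \<rho> :: real assume r: "0 < \<rho>"
      have "\<rho> powr (- L - 1) * \<rho> powr (L + 1) = 1" using r by (simp flip: powr_add)
      then have "complex_of_real (\<rho> powr (- L - 1)) * of_real (\<rho> powr (L + 1)) = 1" by (simp only: of_real_1 flip: of_real_mult)
      moreover have "F \<rho> = of_real C * (exp (- \<i> * of_real \<rho>) * of_real (\<rho> powr (L + 1)) * hyp1F1 \<alpha> \<beta> (2 * \<i> * of_real \<rho>))"
        unfolding F_def C_def \<alpha>_def \<beta>_def by (rule coulomb_F_pos_eq) (use L r in auto)
      ultimately show "of_real C * (exp (- \<i> * of_real \<rho>) * hyp1F1 \<alpha> \<beta> (2 * \<i> * of_real \<rho>)) = of_real (\<rho> powr (- L - 1)) * F \<rho>"
        by (simp only:) algebra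
    qed
  qed
  have FL': "((\<lambda>\<rho>. of_real (\<rho> powr (- L)) * F' \<rho>) \<longlongrightarrow> of_real (C * (L + 1))) (at_right 0)"
  proof -
    have "((\<lambda>\<rho>. of_real C * (exp (- \<i> * of_real \<rho>) *
      ((- \<i> * of_real \<rho> + of_real (L + 1)) * hyp1F1 \<alpha> \<beta> (2 * \<i> * of_real \<rho>) + 2 * \<i> * of_real \<rho> * hyp1F1' \<alpha> \<beta> (2 * \<i> * of_real \<rho>)))) \<longlongrightarrow>
      of_real C * (1 * ((- \<i> * 0 + of_real (L + 1)) * 1 + 0 * hyp1F1' \<alpha> \<beta> 0))) (at_right 0)"
      by (intro tendsto_mult[OF tendsto_const] tendsto_mult[OF e0] tendsto_add tendsto_mult[OF _ M0] tendsto_mult[OF z0] id0 M1 tendsto_const)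
    also have "of_real C * (1 * ((- \<i> * 0 + of_real (L + 1)) * 1 + 0 * hyp1F1' \<alpha> \<beta> 0)) = of_real (C * (L + 1))" by simp
    finally show ?thesis
    proof (rule Lim_transform_eventually, intro eventually_mono[OF eventually_at_right_less[of 0]])
      fix \<rho> :: real assume r: "0 < \<rho>"
      have "\<rho> powr (- L) * \<rho> powr (L + 1) = \<rho>" using r by (simp flip: powr_add)
      then have e: "complex_of_real (\<rho> powr (- L)) * of_real (\<rho> powr (L + 1)) = of_real \<rho>" by (simp only: flip: of_real_mult)
      have s: "complex_of_real \<rho> * of_real ((L + 1) / \<rho>) = of_real (L + 1)" using r by simp
      have "of_real (\<rho> powr (- L)) * F' \<rho> = of_real C * (exp (- \<i> * of_real \<rho>) *
         ((- \<i> * of_real \<rho> + of_real \<rho> * of_real ((L + 1) / \<rho>)) * hyp1F1 \<alpha> \<beta> (2 * \<i> * of_real \<rho>) + 2 * \<i> * of_real \<rho> * hyp1F1' \<alpha> \<beta> (2 * \<i> * of_real \<rho>)))"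
        unfolding F'_def e[symmetric] by (simp only: algebra_simps)
      then show "of_real C * (exp (- \<i> * of_real \<rho>) *
      ((- \<i> * of_real \<rho> + of_real (L + 1)) * hyp1F1 \<alpha> \<beta> (2 * \<i> * of_real \<rho>) + 2 * \<i> * of_real \<rho> * hyp1F1' \<alpha> \<beta> (2 * \<i> * of_real \<rho>)))
        = of_real (\<rho> powr (- L)) * F' \<rho>" unfolding s ..
    qed
  qed

  \<comment> \<open>The left side is (2L + 1) C h, in which the Gamma factors, exponentials and
    powers of 2 of C and h cancel.\<close>
  have Ch: "C * (L + 1) * h + C * (L * h) = 1"
  proof -
    have "Gamma (2 * L + 1 + 1) = (2 * L + 1) * Gamma (2 * L + 1)"
      using L by (intro Gamma_plus1) (auto dest: nonpos_Ints_nonpos)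
    then have G: "Gamma (2 * L + 2) = (2 * L + 1) * Gamma (2 * L + 1)" by (simp add: add.assoc)
    have "Gamma (2 * L + 1) > 0" using L by (intro Gamma_real_pos) auto
    then have G0: "Gamma (2 * L + 1) \<noteq> 0" by (rule less_imp_neq[symmetric])
    have aux: "x * (p1 * e1 * y / (x * G) * (p2 * e2 * G / y)) = (p1 * p2) * (e1 * e2)"
      if "x \<noteq> 0" "G \<noteq> 0" "y \<noteq> 0" for x y G p1 p2 e1 e2 :: real
      using that by (simp add: field_simps)
    have CC: "C = 2 powr L * exp (- pi * \<eta> / 2) * g / ((2 * L + 1) * Gamma (2 * L + 1))"
      unfolding C_def coulomb_C_def a1 g_def G ..
    have "C * (L + 1) * h + C * (L * h) = (2 * L + 1) * (C * h)" by (simp add: algebra_simps)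
    also have "\<dots> = (2 powr L * 2 powr (- L)) * (exp (- pi * \<eta> / 2) * exp (pi * \<eta> / 2))"
      unfolding CC h_def by (rule aux) (use L G0 g0 in auto)
    also have "\<dots> = 1" by (simp flip: exp_add powr_add)
    finally show ?thesis .
  qed
  \<comment> \<open>Formulated for any X with this behaviour at 0, as it is applied to H and to
    \<open>cnj H\<close>; since h is real, both have the same leading coefficients.\<close>
  have W: "w = 1" if X: "((\<lambda>\<rho>. of_real (\<rho> powr L) * X \<rho>) \<longlongrightarrow> of_real h) (at_right 0)"
      "((\<lambda>\<rho>. of_real (\<rho> powr (L + 1)) * X' \<rho>) \<longlongrightarrow> of_real (- (L * h))) (at_right 0)"
     and w: "\<And>\<rho>. \<rho> > 0 \<Longrightarrow> F' \<rho> * X \<rho> - F \<rho> * X' \<rho> = w" for X X' :: "real \<Rightarrow> complex" and w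
  proof -
    have "((\<lambda>\<rho>. (of_real (\<rho> powr (- L)) * F' \<rho>) * (of_real (\<rho> powr L) * X \<rho>) -
       (of_real (\<rho> powr (- L - 1)) * F \<rho>) * (of_real (\<rho> powr (L + 1)) * X' \<rho>)) \<longlongrightarrow>
       of_real (C * (L + 1)) * of_real h - of_real C * of_real (- (L * h))) (at_right 0)"
      by (intro tendsto_diff tendsto_mult FL FL' X)
    also have "of_real (C * (L + 1)) * of_real h - of_real C * of_real (- (L * h)) = complex_of_real (C * (L + 1) * h + C * (L * h))"
      by simp
    finally have "((\<lambda>\<rho>. (of_real (\<rho> powr (- L)) * F' \<rho>) * (of_real (\<rho> powr L) * X \<rho>) -
       (of_real (\<rho> powr (- L - 1)) * F \<rho>) * (of_real (\<rho> powr (L + 1)) * X' \<rho>)) \<longlongrightarrow> 1) (at_right 0)"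
      unfolding Ch by simp
    moreover have "\<forall>\<^sub>F \<rho> in at_right 0. (of_real (\<rho> powr (- L)) * F' \<rho>) * (of_real (\<rho> powr L) * X \<rho>) -
       (of_real (\<rho> powr (- L - 1)) * F \<rho>) * (of_real (\<rho> powr (L + 1)) * X' \<rho>) = w"
    proof (rule eventually_mono[OF eventually_at_right_less[of 0]])
      fix \<rho> :: real assume r: "0 < \<rho>"
      have "\<rho> powr (- L) * \<rho> powr L = 1" "\<rho> powr (- L - 1) * \<rho> powr (L + 1) = 1" using r by (simp_all flip: powr_add)
      then have "complex_of_real (\<rho> powr (- L)) * of_real (\<rho> powr L) = 1"
         "complex_of_real (\<rho> powr (- L - 1)) * of_real (\<rho> powr (L + 1)) = 1" by (simp_all only: of_real_1 flip: of_real_mult)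
      then show "(of_real (\<rho> powr (- L)) * F' \<rho>) * (of_real (\<rho> powr L) * X \<rho>) -
       (of_real (\<rho> powr (- L - 1)) * F \<rho>) * (of_real (\<rho> powr (L + 1)) * X' \<rho>) = w"
        unfolding w[OF r, symmetric] by algebra
    qed
    ultimately have "((\<lambda>\<rho>::real. w) \<longlongrightarrow> 1) (at_right 0)" by (rule Lim_transform_eventually)
    then show "w = 1" by (simp add: tendsto_const_iff)
  qed
  have Hode: "coulomb_ode L \<eta> H H'" by fact
  obtain A where A: "\<And>\<rho>. \<rho> > 0 \<Longrightarrow> F' \<rho> * H \<rho> - F \<rho> * H' \<rho> = A"
    using coulomb_ode_wronskian[OF Fode Hode] by metis
  obtain B where B: "\<And>\<rho>. \<rho> > 0 \<Longrightarrow> F' \<rho> * cnj (H \<rho>) - F \<rho> * cnj (H' \<rho>) = B"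
    using coulomb_ode_wronskian[OF Fode coulomb_ode_cnj[OF Hode]] by metis
  have A1: "A = 1" by (rule W[OF HL HL' A])
  have B1: "B = 1"
  proof (rule W[OF _ _ B])
    show "((\<lambda>\<rho>. of_real (\<rho> powr L) * cnj (H \<rho>)) \<longlongrightarrow> of_real h) (at_right 0)"
      using tendsto_cnj[OF HL] by simp
    show "((\<lambda>\<rho>. of_real (\<rho> powr (L + 1)) * cnj (H' \<rho>)) \<longlongrightarrow> of_real (- (L * h))) (at_right 0)"
      using tendsto_cnj[OF HL'] by simp
  qed
  have "F \<rho> = of_real (Im (H \<rho>))" if r: "\<rho> > 0" for \<rho>
  proof -
    \<comment> \<open>Cramer's rule in the basis H, \<open>cnj H\<close>; with A = B = 1 it gives 2i
      F = H - cnj H.\<close>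
    have "A * cnj (H \<rho>) - B * H \<rho> = - (2 * \<i>) * F \<rho>"
      unfolding A[OF r, symmetric] B[OF r, symmetric] outgoing_wronskian[OF out r, symmetric]
      by (simp add: algebra_simps)
    moreover have "cnj (H \<rho>) - H \<rho> = - (2 * \<i>) * of_real (Im (H \<rho>))" by (simp add: complex_eq_iff)
    ultimately have "(2 * \<i>) * F \<rho> = (2 * \<i>) * of_real (Im (H \<rho>))" using A1 B1 by simp
    then show ?thesis by simp
  qed
  then show ?thesis using that[OF out] unfolding F_def by blast
qed

text \<open>At \<open>l = \<eta> = 0\<close> this is the limit \<open>l \<rightarrow> 0\<^sup>+\<close>. There \<open>\<eta> / l = 0\<close>, and the lowering relation then
  reads \<open>H\<^sub>-\<^sub>1 = H\<^sub>0'\<close>, which is the prescribed case \<open>L = - 1\<close>.\<close>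
definition coulomb_ladder :: "real \<Rightarrow> real \<Rightarrow> real" where
  "coulomb_ladder l \<eta> = (if l = 0 \<and> \<eta> = 0 then 1 else sqrt (l\<^sup>2 + \<eta>\<^sup>2) / l)"

section \<open>Descent in L, ladder relations and the three-term recurrence\<close>

text \<open>The two properties descend together: the asymptotics identify G with the real part of H,
  the other clause identifies F with its imaginary part.\<close>

definition coulomb_pair :: "real \<Rightarrow> real \<Rightarrow> (real \<Rightarrow> complex) \<Rightarrow> (real \<Rightarrow> complex) \<Rightarrow> bool" where
  "coulomb_pair L \<eta> H H' \<longleftrightarrow> outgoing L \<eta> H H' \<and> (\<forall>\<rho>>0. coulomb_F_pos L \<eta> \<rho> = of_real (Im (H \<rho>)))"

text \<open>R and S are real, so taking imaginary parts turns the lowering relation of H into that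
  of F.\<close>

lemma coulomb_pair_lower:
  assumes H: "coulomb_pair l \<eta> H H'" and l: "l > - 1 / 2" "l \<noteq> 0"
  defines "R \<equiv> sqrt (l\<^sup>2 + \<eta>\<^sup>2) / l"
  defines "S \<equiv> \<lambda>\<rho>. of_real (l / \<rho> + \<eta> / l)"
  defines "K \<equiv> \<lambda>\<rho>. (S \<rho> * H \<rho> + H' \<rho>) / of_real R"
  shows "coulomb_pair (l - 1) \<eta> K (\<lambda>\<rho>. S \<rho> * K \<rho> - of_real R * H \<rho>)"
  unfolding coulomb_pair_def
proof (intro conjI allI impI)
  have out: "outgoing l \<eta> H H'" using H by (simp add: coulomb_pair_def)
  show "outgoing (l - 1) \<eta> K (\<lambda>\<rho>. S \<rho> * K \<rho> - of_real R * H \<rho>)"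
    unfolding K_def S_def R_def by (rule outgoing_lower[OF out]) (use l in auto)
  fix \<rho> :: real assume r: "\<rho> > 0"
  have R0: "R \<noteq> 0" using l by (simp add: R_def sum_power2_eq_zero_iff)
  obtain F' where F': "(coulomb_F_pos l \<eta> has_vector_derivative F') (at \<rho>)"
    "of_real R * coulomb_F_pos (l - 1) \<eta> \<rho> = S \<rho> * coulomb_F_pos l \<eta> \<rho> + F'"
    unfolding R_def S_def using coulomb_F_pos_lower[OF l r] by blast
  have "((\<lambda>\<rho>. of_real (Im (H \<rho>))) has_vector_derivative complex_of_real (Im (H' \<rho>))) (at \<rho>)"
  proof -
    have "(H has_vector_derivative H' \<rho>) (at \<rho>)"
      using out r unfolding outgoing_def by (blast dest: coulomb_odeD)
    from bounded_linear.has_vector_derivative[OF bounded_linear_Im this]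
    have "((\<lambda>\<rho>. Im (H \<rho>)) has_real_derivative Im (H' \<rho>)) (at \<rho>)"
      by (simp add: has_real_derivative_iff_has_vector_derivative)
    then show ?thesis by (rule has_vector_derivative_of_real)
  qed
  then have "(coulomb_F_pos l \<eta> has_vector_derivative complex_of_real (Im (H' \<rho>))) (at \<rho>)"
    by (rule has_vector_derivative_transform_within_open[of _ _ _ "{0<..}"])
      (use H r in \<open>auto simp: coulomb_pair_def\<close>)
  then have "F' = of_real (Im (H' \<rho>))" using F'(1) vector_derivative_unique_at by blast
  moreover have "coulomb_F_pos l \<eta> \<rho> = of_real (Im (H \<rho>))" using H r by (simp add: coulomb_pair_def)
  ultimately have "of_real R * coulomb_F_pos (l - 1) \<eta> \<rho> = of_real (Im (S \<rho> * H \<rho> + H' \<rho>))"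
    using F'(2) by (simp add: S_def)
  then have "coulomb_F_pos (l - 1) \<eta> \<rho> = of_real (Im (S \<rho> * H \<rho> + H' \<rho>) / R)"
    using R0 by (simp add: field_simps)
  then show "coulomb_F_pos (l - 1) \<eta> \<rho> = of_real (Im (K \<rho>))" by (simp add: K_def)
qed

text \<open>One lowering from positive parameters reaches every L > - 1, a second one the remaining
  - 3/2 < L < - 1. Excluding L = - 1 avoids the undefined step from 0.\<close>

lemma coulomb_pair_exists:
  assumes "L > - 3 / 2" "L \<noteq> - 1"
  shows "\<exists>H H'. coulomb_pair L \<eta> H H'"
proof -
  have base: "\<exists>H H'. coulomb_pair L \<eta> H H'" if "L > 0" for L
    using outgoing_base[OF that, of \<eta>] unfolding coulomb_pair_def by metis
  have step: "\<exists>H H'. coulomb_pair L \<eta> H H'"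
    if "L > - 3 / 2" "L \<noteq> - 1" "\<exists>H H'. coulomb_pair (L + 1) \<eta> H H'" for L
  proof -
    obtain H H' where "coulomb_pair (L + 1) \<eta> H H'" using \<open>\<exists>H H'. coulomb_pair (L + 1) \<eta> H H'\<close> by blast
    from coulomb_pair_lower[OF this] that show ?thesis by force
  qed
  have one: "\<exists>H H'. coulomb_pair L \<eta> H H'" if "L > - 1" for L
    using base[of "L + 1"] step[of L] that by simp
  show ?thesis using one[of "L + 1"] step[of L] assms by simp
qed

text \<open>K is known only through its normalisation, and uniqueness identifies it with the lowered
  H. The raising relation is then the formula K' = S K - R H, rearranged.\<close>

lemma coulomb_pair_ladder:
  assumes H: "coulomb_pair l \<eta> H H'" and K: "coulomb_pair (l - 1) \<eta> K K'"
    and l: "l > - 1 / 2" "l \<noteq> 0" and r: "\<rho> > 0"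
  shows "of_real (coulomb_ladder l \<eta>) * K \<rho> = of_real (l / \<rho> + \<eta> / l) * H \<rho> + H' \<rho>"
    and "of_real (coulomb_ladder l \<eta>) * H \<rho> = of_real (l / \<rho> + \<eta> / l) * K \<rho> - K' \<rho>"
proof -
  define R where "R = sqrt (l\<^sup>2 + \<eta>\<^sup>2) / l"
  define S where "S \<rho> = complex_of_real (l / \<rho> + \<eta> / l)" for \<rho>
  have R: "coulomb_ladder l \<eta> = R" using l by (simp add: coulomb_ladder_def R_def)
  have R0: "R \<noteq> 0" using l by (simp add: R_def sum_power2_eq_zero_iff)
  define X where "X = (\<lambda>\<rho>. (S \<rho> * H \<rho> + H' \<rho>) / of_real R)"
  have X: "outgoing (l - 1) \<eta> X (\<lambda>\<rho>. S \<rho> * X \<rho> - of_real R * H \<rho>)"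
    using coulomb_pair_lower[OF H l] unfolding coulomb_pair_def X_def S_def R_def by blast
  have K': "outgoing (l - 1) \<eta> K K'" using K by (simp add: coulomb_pair_def)
  have KX: "K \<rho> = X \<rho>" by (rule outgoing_unique[OF K' X r])
  have K'X: "K' \<rho> = S \<rho> * X \<rho> - of_real R * H \<rho>" by (rule outgoing_unique_deriv[OF K' X r])
  show "of_real (coulomb_ladder l \<eta>) * K \<rho> = of_real (l / \<rho> + \<eta> / l) * H \<rho> + H' \<rho>"
    unfolding R KX S_def[symmetric] using R0 by (simp add: X_def)
  show "of_real (coulomb_ladder l \<eta>) * H \<rho> = of_real (l / \<rho> + \<eta> / l) * K \<rho> - K' \<rho>"
    unfolding R KX K'X S_def[symmetric] by simp
qed

text \<open>Its derivative i exp (i \<rho>) has real part - sin \<rho> and imaginary part cos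
  \<rho>, the prescribed G and F for L = - 1, \<eta> = 0.\<close>

lemma outgoing_0_0: "outgoing 0 0 cis (\<lambda>\<rho>. \<i> * cis \<rho>)"
proof -
  have "(cis has_vector_derivative \<i> * cis \<rho>) (at \<rho>)" for \<rho>
  proof -
    have "((\<lambda>x. exp (\<i> * of_real x)) has_vector_derivative \<i> * exp (\<i> * of_real \<rho>)) (at \<rho>)"
      by (rule has_vector_derivative_real_field) (auto intro!: derivative_eq_intros)
    then show ?thesis by (simp add: cis_conv_exp[abs_def])
  qed
  moreover from has_vector_derivative_mult_right[OF this, of \<i>]
  have "((\<lambda>\<rho>. \<i> * cis \<rho>) has_vector_derivative - cis \<rho>) (at \<rho>)" for \<rho>
    by (simp flip: mult.assoc)
  moreover have "coulomb_theta 0 0 \<rho> = \<rho>" for \<rho> by (simp add: coulomb_theta_def)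
  ultimately show ?thesis
    by (simp add: outgoing_def coulomb_ode_def cis_mult mult.assoc)
qed

text \<open>Here \<open>D k = F\<^sub>L G\<^sub>L\<^sub>+\<^sub>k - F\<^sub>L\<^sub>+\<^sub>k G\<^sub>L\<close>. The hypothesis on \<open>h 0\<close> replaces membership in \<open>coulomb_pair\<close>
  because for \<open>L = - 1\<close> the phase \<open>\<theta>\<^sub>L\<close> involves \<open>Gamma\<close> at its pole.\<close>
lemma coulomb_recurrence:
  assumes L: "L > - 3 / 2" and L\<eta>: "\<eta> \<noteq> 0 \<Longrightarrow> L \<noteq> - 1" and \<rho>: "\<rho> > 0"
    and h0: "\<And>k::nat. k > 0 \<Longrightarrow> coulomb_pair (L + real k) \<eta> (h k) (h' k)"
    and h1: "of_real (coulomb_ladder (L + 1) \<eta>) * h 0 \<rho> =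
      of_real ((L + 1) / \<rho> + \<eta> / (L + 1)) * h 1 \<rho> + h' 1 \<rho>"
  defines "D \<equiv> \<lambda>k::nat. Im (h 0 \<rho> * cnj (h k \<rho>))"
  shows "poly (coulomb_P L \<eta> n) (of_real (1 / \<rho>)) =
      of_real (coulomb_ladder (L + 1) \<eta> * sqrt ((2 * L + 2 * real n + 3) / (2 * L + 3)) * D (Suc n))"
proof -
  define R where "R k = coulomb_ladder (L + real k) \<eta>" for k
  define S where "S k = (L + real k) / \<rho> + \<eta> / (L + real k)" for k
  have down: "of_real (R (Suc k)) * h k \<rho> = of_real (S (Suc k)) * h (Suc k) \<rho> + h' (Suc k) \<rho>" for k
  proof (cases "k = 0")
    case False
    then show ?thesis
      using coulomb_pair_ladder(1)[OF h0[of "Suc k"] _ _ _ \<rho>, of "h k" "h' k"] h0[of k] L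
      by (simp add: R_def S_def add.commute add.left_commute)
  qed (use h1 in \<open>simp add: R_def S_def\<close>)
  have up: "of_real (R (Suc k)) * h (Suc k) \<rho> = of_real (S (Suc k)) * h k \<rho> - h' k \<rho>" if "k > 0" for k
      using coulomb_pair_ladder(2)[OF h0[of "Suc k"] _ _ _ \<rho>, of "h k" "h' k"] h0[of k] L that
      by (simp add: R_def S_def add.commute add.left_commute)
  \<comment> \<open>The term with S is a real multiple of |h 1|^2 and drops out of the imaginary
    part; the Wronskian 2i gives Im (h' cnj h) = 1.\<close>
  have D1: "D (Suc 0) * coulomb_ladder (L + 1) \<eta> = 1"
  proof -
    have "coulomb_ladder (L + 1) \<eta> * D (Suc 0) = Im (of_real (R (Suc 0)) * h 0 \<rho> * cnj (h (Suc 0) \<rho>))"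
      by (simp add: D_def R_def algebra_simps)
    also have "\<dots> = Im (of_real (S (Suc 0)) * (h (Suc 0) \<rho> * cnj (h (Suc 0) \<rho>)) + h' (Suc 0) \<rho> * cnj (h (Suc 0) \<rho>))"
      unfolding down by (simp add: algebra_simps)
    also have "\<dots> = Im (h' (Suc 0) \<rho> * cnj (h (Suc 0) \<rho>))" by (simp add: algebra_simps)
    also have "\<dots> = 1"
    proof -
      have "outgoing (L + real (Suc 0)) \<eta> (h (Suc 0)) (h' (Suc 0))" using h0[of "Suc 0"] by (simp add: coulomb_pair_def)
      from arg_cong[OF outgoing_wronskian[OF this \<rho>], of Im] show ?thesis by (simp add: algebra_simps)
    qed
    finally show ?thesis by (simp add: mult.commute)
  qed
  \<comment> \<open>Raising and lowering the same function \<open>h (k + 1)\<close> and adding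
    eliminates its derivative. All coefficients are real, so the relation passes to D.\<close>
  have three: "R (Suc (Suc k)) * D (Suc (Suc k)) + R (Suc k) * D k = (S (Suc k) + S (Suc (Suc k))) * D (Suc k)" for k
  proof -
    have "of_real (R (Suc (Suc k))) * h (Suc (Suc k)) \<rho> + of_real (R (Suc k)) * h k \<rho> =
      of_real (S (Suc k) + S (Suc (Suc k))) * h (Suc k) \<rho>"
      unfolding up[of "Suc k", simplified] down by (simp add: algebra_simps)
    from arg_cong[OF this, of "\<lambda>x. Im (h 0 \<rho> * cnj x)"]
    show ?thesis by (simp add: D_def algebra_simps)
  qed
  have D0: "D 0 = 0" by (simp add: D_def algebra_simps)
  \<comment> \<open>The index is shifted by one: \<open>Q (n + 1)\<close> is the claimed value of
    the n-th polynomial and \<open>Q 0\<close> vanishes with \<open>D 0\<close>. The square root is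
    the weight that symmetrises the recurrence for D.\<close>
  define Q where "Q k = R 1 * sqrt ((2 * L + 2 * real k + 1) / (2 * L + 3)) * D k" for k
  have Qrec: "1 / \<rho> * Q (Suc k) = (if k = 0 then 0 else coulomb_w \<eta> (L + real k) * Q k)
      + coulomb_lambda \<eta> (L + real k + 1) * Q (Suc k) + coulomb_w \<eta> (L + real k + 1) * Q (Suc (Suc k))" for k
  proof -
    define m where "m = L + real k + 1"
    define s where "s = sqrt (2 * L + 3)"
    have s: "s > 0" using L by (simp add: s_def)
    have m: "m > - 1 / 2" using L by (simp add: m_def)
    define q1 where "q1 = sqrt (2 * m + 1)"
    define q2 where "q2 = sqrt (2 * m + 3)"
    have q: "q1 > 0" "q2 > 0" "q1 * q1 = 2 * m + 1" using m by (simp_all add: q1_def q2_def)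
    have Q1: "Q (Suc k) = R 1 * (q1 / s) * D (Suc k)"
      by (simp add: Q_def s_def q1_def m_def real_sqrt_divide algebra_simps)
    have Q2: "Q (Suc (Suc k)) = R 1 * (q2 / s) * D (Suc (Suc k))"
      by (simp add: Q_def s_def q2_def m_def real_sqrt_divide algebra_simps)
    have R2: "R (Suc (Suc k)) = sqrt ((m + 1)\<^sup>2 + \<eta>\<^sup>2) / (m + 1)"
      using m by (simp add: R_def coulomb_ladder_def m_def algebra_simps)
    have w1: "coulomb_w \<eta> m * q2 * q1 = R (Suc (Suc k))"
    proof -
      have "sqrt ((2 * m + 1) * (2 * m + 3)) = q1 * q2" by (simp add: q1_def q2_def real_sqrt_mult)
      then show ?thesis using q unfolding R2 by (simp add: coulomb_w_def)
    qed
    \<comment> \<open>For k = 0 both sides are 0, by the convention on the left and by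
      \<open>D 0 = 0\<close> on the right; for k > 0 the index m - 1 exceeds - 1/2 and all roots are
      positive.\<close>
    have prev: "(if k = 0 then 0 else coulomb_w \<eta> (L + real k) * Q k) * q1 = R 1 / s * R (Suc k) * D k"
    proof (cases "k = 0")
      case False
      then have m0: "m - 1 > - 1 / 2" using L by (simp add: m_def)
      define q0 where "q0 = sqrt (2 * (m - 1) + 1)"
      have q0: "q0 > 0" using m0 by (simp add: q0_def)
      have Q0: "Q k = R 1 * (q0 / s) * D k"
        by (simp add: Q_def s_def q0_def m_def real_sqrt_divide algebra_simps)
      have R1: "R (Suc k) = sqrt (m\<^sup>2 + \<eta>\<^sup>2) / m"
        using m0 by (simp add: R_def coulomb_ladder_def m_def algebra_simps)
      have "sqrt ((2 * (m - 1) + 1) * (2 * (m - 1) + 3)) = q0 * q1"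
        unfolding real_sqrt_mult by (simp add: q0_def q1_def)
      then have "coulomb_w \<eta> (m - 1) * q0 * q1 = R (Suc k)"
        using q q0 unfolding R1 by (simp add: coulomb_w_def)
      moreover have "L + real k = m - 1" by (simp add: m_def)
      ultimately show ?thesis using False unfolding Q0 by (simp add: mult_ac)
    qed (simp add: D0)
    \<comment> \<open>The case m = 0 forces k = 0 and L = - 1, hence \<eta> = 0; the quotients
      \<eta> / m and \<eta> / (m (m + 1)) are then 0 and both sides equal 1 / \<rho>.\<close>
    have lam: "S (Suc k) + S (Suc (Suc k)) = (2 * m + 1) * (1 / \<rho> - coulomb_lambda \<eta> m)"
    proof (cases "m = 0")
      case True
      then have "k = 0" using L by (cases k) (auto simp: m_def)
      then have "L = - 1" using True by (simp add: m_def)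
      then show ?thesis using L\<eta> \<open>k = 0\<close> True by (auto simp: S_def coulomb_lambda_def)
    next
      case False
      have "S (Suc k) = m / \<rho> + \<eta> / m" "S (Suc (Suc k)) = (m + 1) / \<rho> + \<eta> / (m + 1)"
        by (simp_all add: S_def m_def algebra_simps)
      moreover have "m / \<rho> + (m + 1) / \<rho> = (2 * m + 1) * (1 / \<rho>)"
        by (simp flip: add_divide_distrib)
      moreover have "\<eta> / m + \<eta> / (m + 1) = (2 * m + 1) * (\<eta> / (m * (m + 1)))"
        using False m by (simp add: divide_simps) (simp add: algebra_simps)
      ultimately have "S (Suc k) + S (Suc (Suc k)) = (2 * m + 1) * (1 / \<rho>) + (2 * m + 1) * (\<eta> / (m * (m + 1)))"
        by linarith
      then show ?thesis by (simp add: coulomb_lambda_def distrib_left)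
    qed
    have "q1 * ((if k = 0 then 0 else coulomb_w \<eta> (L + real k) * Q k) + coulomb_w \<eta> m * Q (Suc (Suc k))) =
      R 1 / s * (R (Suc (Suc k)) * D (Suc (Suc k)) + R (Suc k) * D k)"
      using prev w1 s unfolding Q2 by (simp add: algebra_simps) 
    also have "\<dots> = R 1 / s * ((q1 * q1) * (1 / \<rho> - coulomb_lambda \<eta> m) * D (Suc k))"
      unfolding three lam q ..
    also have "\<dots> = q1 * ((1 / \<rho> - coulomb_lambda \<eta> m) * Q (Suc k))" unfolding Q1 by simp
    finally have "(if k = 0 then 0 else coulomb_w \<eta> (L + real k) * Q k) + coulomb_w \<eta> m * Q (Suc (Suc k)) =
       (1 / \<rho> - coulomb_lambda \<eta> m) * Q (Suc k)" using q by simp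
    then show ?thesis unfolding m_def by (simp add: algebra_simps)
  qed
  have w0: "coulomb_w \<eta> (L + real k + 1) \<noteq> 0" for k
    using coulomb_w_pos[of "L + real k + 1" \<eta>] L by simp
  have "poly (coulomb_P L \<eta> n) (of_real (1 / \<rho>)) = of_real (Q (Suc n))"
  proof (induction n rule: less_induct)
    case (less n)
    show ?case
    proof (cases n)
      case 0
      have "2 * L + 2 * real (Suc 0) + 1 = 2 * L + 3" by simp
      then have "Q (Suc 0) = R 1 * sqrt ((2 * L + 3) / (2 * L + 3)) * D (Suc 0)" by (simp only: Q_def)
      then have "Q (Suc 0) = 1" using D1 L by (simp add: R_def mult.commute)
      then show ?thesis using 0 by simp
    next
      case (Suc k)
      let ?z = "complex_of_real (1 / \<rho>)"
      have "?z * poly (coulomb_P L \<eta> k) ?z =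
        (if k = 0 then 0 else of_real (coulomb_w \<eta> (L + real k)) * poly (coulomb_P L \<eta> (k - 1)) ?z)
        + of_real (coulomb_lambda \<eta> (L + real k + 1)) * poly (coulomb_P L \<eta> k) ?z
        + of_real (coulomb_w \<eta> (L + real k + 1)) * poly (coulomb_P L \<eta> (k + 1)) ?z"
        by (rule coulomb_P_recurrence[OF L])
      moreover have "poly (coulomb_P L \<eta> k) ?z = of_real (Q (Suc k))" using less Suc by simp
      moreover have "poly (coulomb_P L \<eta> (k - 1)) ?z = of_real (Q k)" if "k \<noteq> 0"
        using less.IH[of "k - 1"] Suc that by simp
      ultimately have "?z * of_real (Q (Suc k)) =
        of_real (if k = 0 then 0 else coulomb_w \<eta> (L + real k) * Q k)
        + of_real (coulomb_lambda \<eta> (L + real k + 1)) * of_real (Q (Suc k))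
        + of_real (coulomb_w \<eta> (L + real k + 1)) * poly (coulomb_P L \<eta> (Suc k)) ?z" by auto
      moreover have "?z * of_real (Q (Suc k)) = of_real (if k = 0 then 0 else coulomb_w \<eta> (L + real k) * Q k)
        + of_real (coulomb_lambda \<eta> (L + real k + 1)) * of_real (Q (Suc k))
        + of_real (coulomb_w \<eta> (L + real k + 1)) * of_real (Q (Suc (Suc k)))"
        unfolding of_real_mult[symmetric] Qrec[of k] by simp
      ultimately show ?thesis using w0[of k] Suc by simp
    qed
  qed
  then show "poly (coulomb_P L \<eta> n) (of_real (1 / \<rho>)) =
      of_real (coulomb_ladder (L + 1) \<eta> * sqrt ((2 * L + 2 * real n + 3) / (2 * L + 3)) * D (Suc n))"
    by (simp add: Q_def R_def algebra_simps)
qed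


section \<open>The identity for every branch of log \<rho>\<close>

theorem proposition7:
  fixes L \<eta> :: real and n :: nat and \<rho> t :: complex
  assumes "L > - 3 / 2" and "\<eta> \<noteq> 0 \<Longrightarrow> L \<noteq> - 1"
    and "\<rho> \<noteq> 0" and "exp t = \<rho>"
  shows "coulomb_R L \<eta> n \<rho> =
    of_real ((if L = - 1 \<and> \<eta> = 0 then 1 else sqrt ((L + 1)\<^sup>2 + \<eta>\<^sup>2) / (L + 1)) *
      sqrt ((2 * L + 2 * real n + 3) / (2 * L + 3))) *
    (coulomb_F L \<eta> t * coulomb_G (L + real n + 1) \<eta> t
     - coulomb_F (L + real n + 1) \<eta> t * coulomb_G L \<eta> t)"
proof -
  have "\<exists>h h'. coulomb_pair (L + real k) \<eta> h h'" if "k > 0" for k :: nat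
    by (rule coulomb_pair_exists) (use assms(1) that in auto)
  then obtain h h' where hk: "\<And>k::nat. k > 0 \<Longrightarrow> coulomb_pair (L + real k) \<eta> (h k) (h' k)"
    by metis
  define M where "M = L + real n + 1"
  have M: "M > - 1 / 2" using assms(1) by (simp add: M_def)
  have pairM: "coulomb_pair M \<eta> (h (Suc n)) (h' (Suc n))"
    using hk[of "Suc n"] by (simp add: M_def add.assoc add.commute[of 1])
  \<comment> \<open>H takes the place of h 0. For L = - 1 the witness is i exp (i \<rho>), and the
    lowering relation reduces to H = h' 1.\<close>
  obtain H where H: "coulomb_G L \<eta> holomorphic_on UNIV"
      "\<And>s. coulomb_F L \<eta> (of_real s) = of_real (Im (H (exp s)))"
      "\<And>s. coulomb_G L \<eta> (of_real s) = of_real (Re (H (exp s)))"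
      "\<And>x. x > 0 \<Longrightarrow> of_real (coulomb_ladder (L + 1) \<eta>) * H x =
        of_real ((L + 1) / x + \<eta> / (L + 1)) * h 1 x + h' 1 x"
  proof (cases "L = - 1")
    case True
    with assms have \<eta>: "\<eta> = 0" by blast
    have out: "outgoing 0 0 (h 1) (h' 1)" using hk[of 1] True \<eta> by (simp add: coulomb_pair_def)
    show ?thesis
    proof
      have G: "coulomb_G L \<eta> = (\<lambda>t. - sin (exp t))" using True \<eta> by (simp add: coulomb_G_def fun_eq_iff)
      show "coulomb_G L \<eta> holomorphic_on UNIV" unfolding G by (intro holomorphic_intros)
      show "coulomb_F L \<eta> (of_real s) = of_real (Im (\<i> * cis (exp s)))" for s
        using True \<eta> by (simp add: coulomb_F_def cos_of_real exp_of_real)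
      show "coulomb_G L \<eta> (of_real s) = of_real (Re (\<i> * cis (exp s)))" for s
        unfolding G by (simp add: sin_of_real exp_of_real)
      show "of_real (coulomb_ladder (L + 1) \<eta>) * (\<i> * cis x) =
        of_real ((L + 1) / x + \<eta> / (L + 1)) * h 1 x + h' 1 x" if "x > 0" for x
        using outgoing_unique_deriv[OF out outgoing_0_0 that] True \<eta> by (simp add: coulomb_ladder_def)
    qed
  next
    case False
    then obtain H H' where H: "coulomb_pair L \<eta> H H'" using coulomb_pair_exists assms(1) by blast
    then have out: "outgoing L \<eta> H H'" by (simp add: coulomb_pair_def)
    show ?thesis
    proof
      show "coulomb_G L \<eta> holomorphic_on UNIV" by (rule coulomb_G_outgoing[OF out]) (use False in simp)
      show "coulomb_G L \<eta> (of_real s) = of_real (Re (H (exp s)))" for s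
        by (rule coulomb_G_outgoing[OF out]) (use False in simp)
      show "coulomb_F L \<eta> (of_real s) = of_real (Im (H (exp s)))" for s
        using H by (auto simp: coulomb_pair_def coulomb_F_pos_def dest: spec[of _ "exp s"])
      show "of_real (coulomb_ladder (L + 1) \<eta>) * H x =
        of_real ((L + 1) / x + \<eta> / (L + 1)) * h 1 x + h' 1 x" if "x > 0" for x
        by (rule coulomb_pair_ladder(1)) (use hk[of 1] H assms(1) False that in auto)
    qed
  qed
  define c where "c = (if L = - 1 \<and> \<eta> = 0 then 1 else sqrt ((L + 1)\<^sup>2 + \<eta>\<^sup>2) / (L + 1)) *
      sqrt ((2 * L + 2 * real n + 3) / (2 * L + 3))"
  have c: "c = coulomb_ladder (L + 1) \<eta> * sqrt ((2 * L + 2 * real n + 3) / (2 * L + 3))"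
  proof -
    have "L = - 1 \<longleftrightarrow> L + 1 = 0" by auto
    then show ?thesis by (simp add: c_def coulomb_ladder_def)
  qed
  note outM = pairM[unfolded coulomb_pair_def, THEN conjunct1]
  have M1: "\<not> (M = - 1 \<and> \<eta> = 0)" using M by auto
  have FM: "coulomb_F M \<eta> (of_real s) = of_real (Im (h (Suc n) (exp s)))" for s
    using pairM by (auto simp: coulomb_pair_def coulomb_F_pos_def dest: spec[of _ "exp s"])
  have "poly (coulomb_P L \<eta> n) (exp (- t)) =
    of_real c * (coulomb_F L \<eta> t * coulomb_G M \<eta> t - coulomb_F M \<eta> t * coulomb_G L \<eta> t)"
  \<comment> \<open>Both sides are entire in t, since 1 / \<rho> = exp (- t); agreement for real t,
    that is \<rho> > 0, therefore extends to every t, and with it to every branch of log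
    \<rho>.\<close>
  proof (rule entire_eqI_real[where z = t])
    have "(poly (coulomb_P L \<eta> n) \<circ> (\<lambda>t. exp (- t))) holomorphic_on UNIV"
      by (intro holomorphic_on_compose holomorphic_intros)
    then show "(\<lambda>t. poly (coulomb_P L \<eta> n) (exp (- t))) holomorphic_on UNIV" by (simp add: o_def)
    show "(\<lambda>t. of_real c * (coulomb_F L \<eta> t * coulomb_G M \<eta> t - coulomb_F M \<eta> t * coulomb_G L \<eta> t)) holomorphic_on UNIV"
      using M by (intro holomorphic_intros H(1) coulomb_G_outgoing(1)[OF outM M1] coulomb_F_holomorphic assms) auto
    fix s :: real
    let ?x = "exp s"
    have *: "poly (coulomb_P L \<eta> n) (of_real (1 / ?x)) =
      of_real (c * Im ((H ?x) * cnj (h (Suc n) ?x)))"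
      using coulomb_recurrence[where \<rho> = ?x and h = "\<lambda>k. if k = 0 then H else h k" and h' = h' and n = n, OF assms(1,2)] hk H(4)[of ?x]
      by (simp add: c)
    have "exp (- complex_of_real s) = of_real (1 / ?x)"
      by (simp add: exp_minus exp_of_real inverse_eq_divide)
    then have "poly (coulomb_P L \<eta> n) (exp (- of_real s)) = of_real (c * Im ((H ?x) * cnj (h (Suc n) ?x)))"
      using * by simp
    also have "\<dots> = of_real c * (coulomb_F L \<eta> (of_real s) * coulomb_G M \<eta> (of_real s)
        - coulomb_F M \<eta> (of_real s) * coulomb_G L \<eta> (of_real s))"
      unfolding H(2,3) FM coulomb_G_outgoing(2)[OF outM M1] by (simp add: algebra_simps)
    finally show "poly (coulomb_P L \<eta> n) (exp (- of_real s)) = \<dots>" .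
  qed
  moreover have "exp (- t) = inverse \<rho>" using assms(4) by (simp add: exp_minus)
  ultimately show ?thesis unfolding coulomb_R_def c_def[symmetric] M_def[symmetric] by simp
qed

end
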